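(* Let $G$ be a group equipped with a conjugation-invariant norm. The following are equivalent: (a) $G$ is independent of scaling. (b) The homomorphism $\rho_{\omega,\mathbf{d}}\colon\hat{\mathcal{C}}(G)\to\mathrm{Cone}_\omega(G,\mathbf{d})$, $[g]\mapsto\{g(d_n)\}_n$, is injective for any non-principal ultrafilter $\omega$ on $\mathbb{N}$ and any scaling sequence $\mathbf{d}=(d_n)$. If, in addition, $\|[g]\|_{\hat{\mathcal{C}}(G)}=\lim_{t\to\infty}\tfrac1t\|g(t)\|$ for every $[g]\in\hat{\mathcal{C}}(G)$, then $\rho_{\omega,\mathbf{d}}$ is an isometric embedding.
   Context: Norms. A norm on a group $G$ is a function $\|\cdot\|\colon G\to[0,\infty)$ with $\|g\|=0\iff g=1$, $\|g^{-1}\|=\|g\|$ and $\|gh\|\le\|g\|+\|h\|$; for a pseudonorm one only requires $\|1\|=0$ instead of the first condition. It is conjugation-invariant if $\|hgh^{-1}\|=\|g\|$ for all $g,h$. It induces the bi-invariant (pseudo)metric $d(g,h)=\|g^{-1}h\|$; all metric notions refer to it. The groups $F_{\mathbb{R}}(G)$ and $F(G)$. $F_{\mathbb{R}}(G)$ is the free product of copies of the additive group $\mathbb{R}$ indexed by the elements $g$ of the set $G$; the element $r$ of the copy indexed by $g$ is written $\overline{g}(r)$. It carries the conjugation-invariant pseudonorm $$\|x\|=\inf\Big\{\sum_{i=1}^n |r_i|\,\|g_i\| : x=\prod_{i=1}^n h_i\,\overline{g_i}(r_i)^{\pm1}h_i^{-1},\ h_i\in F_{\mathbb{R}}(G)\Big\}.$$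 $F(G)\le F_{\mathbb{R}}(G)$ is the subgroup generated by the elements $\overline{g}:=\overline{g}(1)$; it is free on $\{\overline{g}: g\in G\}$. For $t\in\mathbb{R}$, $\psi_t\colon F_{\mathbb{R}}(G)\to F_{\mathbb{R}}(G)$ is the homomorphism with $\psi_t(\overline{g}(r))=\overline{g}(tr)$. $\pi\colon F(G)\to G$ is the homomorphism with $\pi(\overline{g})=g$. Directional asymptotic cone. A scaling set is an unbounded subset $T\subseteq(0,\infty)$; limits over $t\in T$ are taken as $t\to\infty$. A function $f$ from $T$ to a pseudometric space is Cauchy if for every $\epsilon>0$, $d(f(t),f(t'))<\epsilon$ for all sufficiently large $t,t'\in T$. $\mathcal{D}(G,T)$ is the group (pointwise product) of all functions $w\colon T\to F(G)$ such that $t\mapsto\psi_{1/t}(w(t))\in F_{\mathbb{R}}(G)$ is Cauchy, with pseudonorm $\|w\|=\lim_{t\in T}\|\psi_{1/t}(w(t))\|$. $\mathcal{C}(G,T)=\{\pi\circ w: w\in\mathcal{D}(G,T)\}$, a group of functions $T\to G$, with pseudonorm $\|g\|=\inf\{\|w\|: w\in\mathcal{D}(G,T),\ \pi\circ w=g\}$. The directional asymptotic cone $\hat{\mathcal{C}}(G,T)$ is the quotient of $\mathcal{C}(G,T)$ by the normal subgroup of elements of pseudonorm $0$, with the induced conjugation-invariant norm; $[g]$ denotes the class of $g$. Write $\hat{\mathcal{C}}(G)=\hat{\mathcal{C}}(G,(0,\infty))$. Independence of scaling. For scaling sets $T\subseteq T'$ there is a well-defined homomorphism $\hat{\mathcal{C}}(G,T')\to\hat{\mathcal{C}}(G,T)$,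 $[g]\mapsto[g|_T]$. $G$ is independent of scaling if this is an isometry for all scaling sets $T\subseteq T'$. Ultrafilter cone. A scaling sequence is a sequence $\mathbf{d}=(d_n)$ of positive reals with $d_n\to\infty$. For a non-principal ultrafilter $\omega$ on $\mathbb{N}$, $\mathrm{Cone}_\omega(G,\mathbf{d})$ is the group of sequences $(g_n)$ in $G$ with $\limsup_n\|g_n\|/d_n<\infty$ (pointwise product), modulo $(g_n)\sim(h_n)\iff\omega\text{-}\lim_n\|g_n^{-1}h_n\|/d_n=0$, with the norm $\|\{g_n\}\|=\omega\text{-}\lim_n\|g_n\|/d_n$; $\{g_n\}$ denotes the class of $(g_n)$. The map $\rho_{\omega,\mathbf{d}}$ is a well-defined homomorphism. *)

theory Defs
  imports "HOL-Algebra.Product_Groups" "HOL-Library.Extended_Real"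
begin

definition conj_inv_norm :: "('a, 'b) monoid_scheme \<Rightarrow> ('a \<Rightarrow> real) \<Rightarrow> bool" where
  "conj_inv_norm G N \<longleftrightarrow>
     (\<forall>g \<in> carrier G. 0 \<le> N g) \<and>
     (\<forall>g \<in> carrier G. N g = 0 \<longleftrightarrow> g = \<one>\<^bsub>G\<^esub>) \<and>
     (\<forall>g \<in> carrier G. N (inv\<^bsub>G\<^esub> g) = N g) \<and>
     (\<forall>g \<in> carrier G. \<forall>h \<in> carrier G. N (g \<otimes>\<^bsub>G\<^esub> h) \<le> N g + N h) \<and>
     (\<forall>g \<in> carrier G. \<forall>h \<in> carrier G. N (h \<otimes>\<^bsub>G\<^esub> g \<otimes>\<^bsub>G\<^esub> inv\<^bsub>G\<^esub> h) = N g)"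

definition norm_dist :: "('a, 'b) monoid_scheme \<Rightarrow> ('a \<Rightarrow> real) \<Rightarrow> 'a \<Rightarrow> 'a \<Rightarrow> real" where
  "norm_dist G N g h = N (inv\<^bsub>G\<^esub> g \<otimes>\<^bsub>G\<^esub> h)"

definition isometric_embedding ::
  "('a, 'c) monoid_scheme \<Rightarrow> ('a \<Rightarrow> real) \<Rightarrow> ('b, 'd) monoid_scheme \<Rightarrow> ('b \<Rightarrow> real) \<Rightarrow> ('a \<Rightarrow> 'b) \<Rightarrow> bool"
  where
  "isometric_embedding A NA B NB f \<longleftrightarrow>
     f \<in> carrier A \<rightarrow> carrier B \<and>
     (\<forall>x \<in> carrier A. \<forall>y \<in> carrier A. norm_dist B NB (f x) (f y) = norm_dist A NA x y)"

text \<open>An isometry is surjective, as opposed to an isometric embedding.\<close>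

definition isometry ::
  "('a, 'c) monoid_scheme \<Rightarrow> ('a \<Rightarrow> real) \<Rightarrow> ('b, 'd) monoid_scheme \<Rightarrow> ('b \<Rightarrow> real) \<Rightarrow> ('a \<Rightarrow> 'b) \<Rightarrow> bool"
  where
  "isometry A NA B NB f \<longleftrightarrow>
     isometric_embedding A NA B NB f \<and> f ` carrier A = carrier B"


text \<open>
  The free product of copies of the additive group of the reals indexed by a set \<open>I\<close>: words in
  the letters \<open>(i, r)\<close>, where \<open>(i, r)\<close> stands for the element \<open>r\<close> of the copy indexed by \<open>i\<close>,
  modulo the equivalence relation generated by deleting a trivial letter and by adding up two
  adjacent letters from the same copy. The elements are the equivalence classes of words.
\<close>

inductive word_step :: "'i set \<Rightarrow> ('i \<times> real) list \<Rightarrow> ('i \<times> real) list \<Rightarrow> bool" for I where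
  zero: "\<lbrakk>u \<in> lists (I \<times> UNIV); v \<in> lists (I \<times> UNIV); i \<in> I\<rbrakk>
           \<Longrightarrow> word_step I (u @ [(i, 0)] @ v) (u @ v)"
| add: "\<lbrakk>u \<in> lists (I \<times> UNIV); v \<in> lists (I \<times> UNIV); i \<in> I\<rbrakk>
           \<Longrightarrow> word_step I (u @ [(i, r), (i, s)] @ v) (u @ [(i, r + s)] @ v)"

definition word_rel :: "'i set \<Rightarrow> (('i \<times> real) list \<times> ('i \<times> real) list) set" where
  "word_rel I = {(u, v). u \<in> lists (I \<times> UNIV) \<and> v \<in> lists (I \<times> UNIV) \<and> equivclp (word_step I) u v}"

definition free_real :: "'i set \<Rightarrow> ('i \<times> real) list set monoid" where
  "free_real I =
     \<lparr>carrier = lists (I \<times> UNIV) // word_rel I,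
      monoid.mult = (\<lambda>X Y. \<Union>u\<in>X. \<Union>v\<in>Y. word_rel I `` {u @ v}),
      one = word_rel I `` {[]}\<rparr>"

definition fbar :: "'i set \<Rightarrow> 'i \<Rightarrow> real \<Rightarrow> ('i \<times> real) list set" where
  "fbar I i r = word_rel I `` {[(i, r)]}"

text \<open>
  A list entry \<open>(h, g, r, e)\<close> stands for the conjugate by \<open>h\<close> of the \<open>e\<close>-th power (\<open>e\<close> a sign)
  of the letter \<open>(g, r)\<close>; the entries are multiplied in the order of the list.
\<close>

definition free_real_norm :: "'i set \<Rightarrow> ('i \<Rightarrow> real) \<Rightarrow> ('i \<times> real) list set \<Rightarrow> real" where
  "free_real_norm I N x =
     Inf {(\<Sum>(h, g, r, e) \<leftarrow> l. \<bar>r\<bar> * N g) | l.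
            set l \<subseteq> carrier (free_real I) \<times> I \<times> UNIV \<times> {1, - 1 :: int} \<and>
            x = foldr (\<otimes>\<^bsub>free_real I\<^esub>)
                  (map (\<lambda>(h, g, r, e).
                     h \<otimes>\<^bsub>free_real I\<^esub> (fbar I g r [^]\<^bsub>free_real I\<^esub> e) \<otimes>\<^bsub>free_real I\<^esub> inv\<^bsub>free_real I\<^esub> h) l)
                  \<one>\<^bsub>free_real I\<^esub>}"

definition free_int :: "'i set \<Rightarrow> ('i \<times> real) list set monoid" where
  "free_int I = subgroup_generated (free_real I) ((\<lambda>i. fbar I i 1) ` I)"

definition psi :: "'i set \<Rightarrow> real \<Rightarrow> ('i \<times> real) list set \<Rightarrow> ('i \<times> real) list set" where
  "psi I t = (THE f. f \<in> hom (free_real I) (free_real I) \<inter> extensional (carrier (free_real I)) \<and>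
                     (\<forall>i \<in> I. \<forall>r. f (fbar I i r) = fbar I i (t * r)))"

definition free_proj :: "('a, 'b) monoid_scheme \<Rightarrow> ('a \<times> real) list set \<Rightarrow> 'a" where
  "free_proj G = (THE f. f \<in> hom (free_int (carrier G)) G \<inter> extensional (carrier (free_int (carrier G))) \<and>
                         (\<forall>g \<in> carrier G. f (fbar (carrier G) g 1) = g))"


definition scaling_set :: "real set \<Rightarrow> bool" where
  "scaling_set T \<longleftrightarrow> T \<subseteq> {0<..} \<and> \<not> bdd_above T"

abbreviation at_top_in :: "real set \<Rightarrow> real filter" where
  "at_top_in T \<equiv> inf at_top (principal T)"

definition cauchy_at_top :: "real set \<Rightarrow> ('a \<Rightarrow> 'a \<Rightarrow> real) \<Rightarrow> (real \<Rightarrow> 'a) \<Rightarrow> bool" where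
  "cauchy_at_top T d f \<longleftrightarrow>
     (\<forall>\<epsilon> > 0. \<exists>t\<^sub>0. \<forall>t \<in> T. \<forall>t' \<in> T. t\<^sub>0 \<le> t \<and> t\<^sub>0 \<le> t' \<longrightarrow> d (f t) (f t') < \<epsilon>)"

text \<open>
  Functions on a scaling set \<open>T\<close> are extensional functions on the reals (undefined outside \<open>T\<close>),
  so that equality of such functions is equality on \<open>T\<close>.
\<close>

definition dir_D :: "('a, 'b) monoid_scheme \<Rightarrow> ('a \<Rightarrow> real) \<Rightarrow> real set \<Rightarrow> (real \<Rightarrow> ('a \<times> real) list set) monoid"
  where
  "dir_D G N T = (product_group T (\<lambda>_. free_int (carrier G)))
     \<lparr>carrier := {w \<in> T \<rightarrow>\<^sub>E carrier (free_int (carrier G)).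
                    cauchy_at_top T
                      (norm_dist (free_real (carrier G)) (free_real_norm (carrier G) N))
                      (\<lambda>t. psi (carrier G) (1 / t) (w t))}\<rparr>"

definition dir_D_norm :: "('a, 'b) monoid_scheme \<Rightarrow> ('a \<Rightarrow> real) \<Rightarrow> real set \<Rightarrow> (real \<Rightarrow> ('a \<times> real) list set) \<Rightarrow> real"
  where
  "dir_D_norm G N T w =
     Lim (at_top_in T) (\<lambda>t. free_real_norm (carrier G) N (psi (carrier G) (1 / t) (w t)))"

definition dir_C :: "('a, 'b) monoid_scheme \<Rightarrow> ('a \<Rightarrow> real) \<Rightarrow> real set \<Rightarrow> (real \<Rightarrow> 'a) monoid" where
  "dir_C G N T = (product_group T (\<lambda>_. G))
     \<lparr>carrier := compose T (free_proj G) ` carrier (dir_D G N T)\<rparr>"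

definition dir_C_norm :: "('a, 'b) monoid_scheme \<Rightarrow> ('a \<Rightarrow> real) \<Rightarrow> real set \<Rightarrow> (real \<Rightarrow> 'a) \<Rightarrow> real" where
  "dir_C_norm G N T g =
     Inf (dir_D_norm G N T ` {w \<in> carrier (dir_D G N T). compose T (free_proj G) w = g})"

definition dir_null :: "('a, 'b) monoid_scheme \<Rightarrow> ('a \<Rightarrow> real) \<Rightarrow> real set \<Rightarrow> (real \<Rightarrow> 'a) set" where
  "dir_null G N T = {g \<in> carrier (dir_C G N T). dir_C_norm G N T g = 0}"

definition dir_cone :: "('a, 'b) monoid_scheme \<Rightarrow> ('a \<Rightarrow> real) \<Rightarrow> real set \<Rightarrow> (real \<Rightarrow> 'a) set monoid" where
  "dir_cone G N T = dir_C G N T Mod dir_null G N T"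

definition dir_class :: "('a, 'b) monoid_scheme \<Rightarrow> ('a \<Rightarrow> real) \<Rightarrow> real set \<Rightarrow> (real \<Rightarrow> 'a) \<Rightarrow> (real \<Rightarrow> 'a) set" where
  "dir_class G N T g = dir_null G N T #>\<^bsub>dir_C G N T\<^esub> g"

text \<open>
  Elements of the directional cone are cosets of the subgroup of elements of pseudonorm 0.
  Maps out of a quotient are written \<open>the_elem (f ` X)\<close>, the common value of \<open>f\<close> on the
  representatives of the class \<open>X\<close>, as for the factor map of a homomorphism in HOL-Algebra.
\<close>

definition dir_cone_norm :: "('a, 'b) monoid_scheme \<Rightarrow> ('a \<Rightarrow> real) \<Rightarrow> real set \<Rightarrow> (real \<Rightarrow> 'a) set \<Rightarrow> real" where
  "dir_cone_norm G N T X = the_elem (dir_C_norm G N T ` X)"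

definition dir_restrict ::
  "('a, 'b) monoid_scheme \<Rightarrow> ('a \<Rightarrow> real) \<Rightarrow> real set \<Rightarrow> (real \<Rightarrow> 'a) set \<Rightarrow> (real \<Rightarrow> 'a) set" where
  "dir_restrict G N T X = the_elem ((\<lambda>g. dir_class G N T (restrict g T)) ` X)"

definition independent_of_scaling :: "('a, 'b) monoid_scheme \<Rightarrow> ('a \<Rightarrow> real) \<Rightarrow> bool" where
  "independent_of_scaling G N \<longleftrightarrow>
     (\<forall>T T'. scaling_set T \<and> scaling_set T' \<and> T \<subseteq> T' \<longrightarrow>
        isometry (dir_cone G N T') (dir_cone_norm G N T') (dir_cone G N T) (dir_cone_norm G N T)
          (dir_restrict G N T))"


definition scaling_sequence :: "(nat \<Rightarrow> real) \<Rightarrow> bool" where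
  "scaling_sequence d \<longleftrightarrow> (\<forall>n. 0 < d n) \<and> filterlim d at_top sequentially"

text \<open>
  A set of indices belongs to the ultrafilter iff its membership predicate holds eventually;
  the limit along the ultrafilter is then \<open>Lim \<omega>\<close>.
\<close>

definition nonprincipal_ultrafilter :: "nat filter \<Rightarrow> bool" where
  "nonprincipal_ultrafilter \<omega> \<longleftrightarrow>
     \<omega> \<noteq> bot \<and>
     (\<forall>P. eventually P \<omega> \<or> eventually (\<lambda>n. \<not> P n) \<omega>) \<and>
     (\<forall>n. \<omega> \<noteq> principal {n})"

definition bounded_seqs :: "('a, 'b) monoid_scheme \<Rightarrow> ('a \<Rightarrow> real) \<Rightarrow> (nat \<Rightarrow> real) \<Rightarrow> (nat \<Rightarrow> 'a) monoid" where
  "bounded_seqs G N d = (product_group UNIV (\<lambda>_. G))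
     \<lparr>carrier := {g \<in> UNIV \<rightarrow> carrier G. limsup (\<lambda>n. ereal (N (g n) / d n)) < \<infinity>}\<rparr>"

definition ultra_rel ::
  "('a, 'b) monoid_scheme \<Rightarrow> ('a \<Rightarrow> real) \<Rightarrow> nat filter \<Rightarrow> (nat \<Rightarrow> real) \<Rightarrow> ((nat \<Rightarrow> 'a) \<times> (nat \<Rightarrow> 'a)) set"
  where
  "ultra_rel G N \<omega> d =
     {(g, h). g \<in> carrier (bounded_seqs G N d) \<and> h \<in> carrier (bounded_seqs G N d) \<and>
              Lim \<omega> (\<lambda>n. N (inv\<^bsub>G\<^esub> (g n) \<otimes>\<^bsub>G\<^esub> h n) / d n) = 0}"

definition ultra_cone ::
  "('a, 'b) monoid_scheme \<Rightarrow> ('a \<Rightarrow> real) \<Rightarrow> nat filter \<Rightarrow> (nat \<Rightarrow> real) \<Rightarrow> (nat \<Rightarrow> 'a) set monoid" where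
  "ultra_cone G N \<omega> d =
     \<lparr>carrier = carrier (bounded_seqs G N d) // ultra_rel G N \<omega> d,
      monoid.mult = set_mult (bounded_seqs G N d),
      one = ultra_rel G N \<omega> d `` {\<one>\<^bsub>bounded_seqs G N d\<^esub>}\<rparr>"

definition ultra_cone_norm ::
  "('a, 'b) monoid_scheme \<Rightarrow> ('a \<Rightarrow> real) \<Rightarrow> nat filter \<Rightarrow> (nat \<Rightarrow> real) \<Rightarrow> (nat \<Rightarrow> 'a) set \<Rightarrow> real" where
  "ultra_cone_norm G N \<omega> d X = the_elem ((\<lambda>g. Lim \<omega> (\<lambda>n. N (g n) / d n)) ` X)"

definition rho ::
  "('a, 'b) monoid_scheme \<Rightarrow> ('a \<Rightarrow> real) \<Rightarrow> nat filter \<Rightarrow> (nat \<Rightarrow> real) \<Rightarrow> (real \<Rightarrow> 'a) set \<Rightarrow> (nat \<Rightarrow> 'a) set" where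
  "rho G N \<omega> d X = the_elem ((\<lambda>g. ultra_rel G N \<omega> d `` {\<lambda>n. g (d n)}) ` X)"

end

theory Submission
  imports Defs
begin

text \<open>
  The main point is a comparison of norms. If \<open>x\<close> lies in the free group \<open>F(G)\<close>, then the norm of
  its projection to \<open>G\<close> is at most the norm of \<open>x\<close> in the free product \<open>F\<^sub>R(G)\<close> of real lines,
  although that norm is an infimum over factorisations with real exponents
  (\<open>norm_free_proj_le\<close>). A factorisation of \<open>x\<close> into conjugates of letters means that a certain
  word cancels to the empty word. Its letters fall into blocks of letters with the same generator
  that cancel each other (\<open>null_word_blocks\<close>). All that is needed of the exponents is that the
  block sums vanish. The exponents in the conjugators occur twice with opposite signs, so these
  equations describe a circulation between blocks, and a real circulation with integral demands
  can be made integral without raising its cost (\<open>integral_flow\<close>). Integral exponents can be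
  evaluated in \<open>G\<close>, where the triangle inequality applies.

  Consequently, if \<open>w\<close> is a lift of \<open>g\<close>, then \<open>N (g t) / t\<close> is bounded by the norm of the rescaled
  value of \<open>w\<close> at \<open>t\<close>. Thus the elements of norm zero are exactly the functions of sublinear
  growth, and the map \<open>\<rho>\<close> to an ultrafilter cone is well defined. Moreover, a lift on
  a scaling set extends to any larger one by dilating and rounding words (\<open>dir_D_extend\<close>), and
  the extension has the same norm, since that norm is a limit which can be computed on the
  smaller set. So restriction between directional cones is always onto, and independence
  of scaling says that it preserves norms.

  Assume independence and let \<open>\<rho>\<close> send \<open>[g]\<close> to the identity. Then \<open>g\<close> is sublinear along some
  scaling set \<open>T\<close> of sampling points, its restriction to \<open>T\<close> has norm zero, and so has
  \<open>g\<close>. Conversely, assume injectivity and take a lift of the restriction of \<open>g\<close> to \<open>T\<close>. Its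
  extension to all scales projects to a function that agrees with \<open>g\<close> along a sequence in
  \<open>T\<close>, hence has the same class as \<open>g\<close>, and so the restriction to \<open>T\<close> has the norm of \<open>g\<close>. If the
  norm in the directional cone is always the limit of \<open>N (g t) / t\<close>, then it is also the limit
  along any ultrafilter on any scaling sequence, which is the norm in the ultrafilter cone.
\<close>

section \<open>Groups with a conjugation-invariant pseudonorm\<close>

locale pseudonormed_group = group G for G (structure) and N :: "'a \<Rightarrow> real" +
  assumes norm_nonneg: "x \<in> carrier G \<Longrightarrow> 0 \<le> N x"
    and norm_one: "N \<one> = 0"
    and norm_inv: "x \<in> carrier G \<Longrightarrow> N (inv x) = N x"
    and norm_mult: "\<lbrakk>x \<in> carrier G; y \<in> carrier G\<rbrakk> \<Longrightarrow> N (x \<otimes> y) \<le> N x + N y"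
    and norm_conj: "\<lbrakk>x \<in> carrier G; h \<in> carrier G\<rbrakk> \<Longrightarrow> N (h \<otimes> x \<otimes> inv h) = N x"
begin

lemma norm_nat_pow: "x \<in> carrier G \<Longrightarrow> N (x [^] (n::nat)) \<le> real n * N x"
proof (induction n)
  case (Suc n)
  then show ?case
    using norm_mult[of "x [^] n" x] by (simp add: distrib_right)
qed (simp add: norm_one)

lemma norm_int_pow: "x \<in> carrier G \<Longrightarrow> N (x [^] (n::int)) \<le> \<bar>real_of_int n\<bar> * N x"
proof (cases n rule: int_cases2)
  case (nonneg k)
  assume "x \<in> carrier G"
  then show ?thesis using norm_nat_pow[of x k] nonneg by (simp add: int_pow_int)
next
  case (nonpos k)
  assume "x \<in> carrier G"
  then show ?thesis
    using norm_nat_pow[of x k] nonpos by (simp add: int_pow_neg int_pow_int norm_inv)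
qed

lemma norm_conj': "\<lbrakk>x \<in> carrier G; h \<in> carrier G\<rbrakk> \<Longrightarrow> N (inv h \<otimes> x \<otimes> h) = N x"
  using norm_conj[of x "inv h"] by simp

lemma norm_dist_sym: "\<lbrakk>x \<in> carrier G; y \<in> carrier G\<rbrakk> \<Longrightarrow> norm_dist G N x y = norm_dist G N y x"
  using norm_inv[of "inv x \<otimes> y"] by (simp add: norm_dist_def inv_mult_group)

lemma norm_dist_triangle:
  assumes "x \<in> carrier G" "y \<in> carrier G" "z \<in> carrier G"
  shows "norm_dist G N x z \<le> norm_dist G N x y + norm_dist G N y z"
proof -
  have "inv x \<otimes> z = (inv x \<otimes> y) \<otimes> (inv y \<otimes> z)"
    using assms by (simp add: m_assoc[symmetric]) (simp add: m_assoc)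
  then show ?thesis
    using norm_mult[of "inv x \<otimes> y" "inv y \<otimes> z"] assms by (simp add: norm_dist_def)
qed

lemma norm_dist_one: "x \<in> carrier G \<Longrightarrow> norm_dist G N \<one> x = N x"
  by (simp add: norm_dist_def)

lemma norm_diff_le_dist:
  assumes "x \<in> carrier G" "y \<in> carrier G"
  shows "\<bar>N x - N y\<bar> \<le> norm_dist G N x y"
  using norm_dist_triangle[of \<one> x y] norm_dist_triangle[of \<one> y x] norm_dist_sym[of x y] assms
  by (simp add: norm_dist_one)

lemma norm_dist_mult:
  assumes "x \<in> carrier G" "y \<in> carrier G" "x' \<in> carrier G" "y' \<in> carrier G"
  shows "norm_dist G N (x \<otimes> x') (y \<otimes> y') \<le> norm_dist G N x y + norm_dist G N x' y'"
proof -
  have "x' \<otimes> (inv x' \<otimes> y') = y'"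
    using assms by (simp add: m_assoc[symmetric])
  then have "inv (x \<otimes> x') \<otimes> (y \<otimes> y') = (inv x' \<otimes> (inv x \<otimes> y) \<otimes> x') \<otimes> (inv x' \<otimes> y')"
    using assms by (simp add: inv_mult_group m_assoc)
  then show ?thesis
    using norm_mult[of "inv x' \<otimes> (inv x \<otimes> y) \<otimes> x'" "inv x' \<otimes> y'"] norm_conj'[of "inv x \<otimes> y" x'] assms
    by (simp add: norm_dist_def)
qed

lemma norm_dist_inv:
  assumes "x \<in> carrier G" "y \<in> carrier G"
  shows "norm_dist G N (inv x) (inv y) = norm_dist G N x y"
proof -
  have "x \<otimes> inv y = x \<otimes> (inv y \<otimes> x) \<otimes> inv x"
    using assms by (simp add: m_assoc)
  then show ?thesis
    using norm_conj[of "inv y \<otimes> x" x] norm_dist_sym[of x y] assms by (simp add: norm_dist_def)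
qed

definition null :: "'a set" where "null = {x \<in> carrier G. N x = 0}"

lemma normal_null: "null \<lhd> G"
proof (rule normal_invI)
  show "subgroup null G"
  proof (rule subgroupI)
    fix x y assume "x \<in> null" "y \<in> null"
    then show "x \<otimes> y \<in> null"
      using norm_mult[of x y] norm_nonneg[of "x \<otimes> y"] by (simp add: null_def)
  qed (use norm_one in \<open>auto simp: null_def norm_inv\<close>)
qed (auto simp: null_def norm_conj)

lemma coset_eq_iff:
  assumes x: "x \<in> carrier G" and y: "y \<in> carrier G"
  shows "null #> x = null #> y \<longleftrightarrow> N (inv x \<otimes> y) = 0"
proof -
  have sub: "subgroup null G" by (rule normal_imp_subgroup[OF normal_null])
  have "null #> x = null #> y \<longleftrightarrow> y \<in> null #> x"
    using repr_independence[OF _ x sub] rcos_self[OF y sub] by metis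
  also have "\<dots> \<longleftrightarrow> y \<otimes> inv x \<in> null"
    by (rule subgroup.rcos_module[OF sub group_axioms x y])
  also have "\<dots> \<longleftrightarrow> N (y \<otimes> inv x) = 0"
    using x y by (simp add: null_def)
  also have "N (y \<otimes> inv x) = N (inv x \<otimes> (y \<otimes> inv x) \<otimes> x)"
    by (rule norm_conj'[symmetric]) (use x y in auto)
  also have "inv x \<otimes> (y \<otimes> inv x) \<otimes> x = inv x \<otimes> y"
    using x y by (simp add: m_assoc)
  finally show ?thesis .
qed

lemma mem_coset_iff:
  assumes "x \<in> carrier G"
  shows "y \<in> null #> x \<longleftrightarrow> y \<in> carrier G \<and> N (inv x \<otimes> y) = 0"
proof -
  interpret normal null G by (rule normal_null)
  have "y \<in> null #> x \<longleftrightarrow> y \<in> carrier G \<and> null #> x = null #> y"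
    using repr_independence[OF _ assms is_subgroup, of y] rcos_self[of y, OF _ is_subgroup]
      r_coset_subset_G[OF subset assms] by blast
  then show ?thesis using coset_eq_iff[OF assms] by auto
qed

text \<open>
  Serves to evaluate maps out of the quotient, which are given by their common value on the
  elements of a coset.
\<close>

lemma the_elem_image_coset:
  assumes "x \<in> carrier G" and "\<And>y. \<lbrakk>y \<in> carrier G; N (inv x \<otimes> y) = 0\<rbrakk> \<Longrightarrow> f y = f x"
  shows "the_elem (f ` (null #> x)) = f x"
proof -
  have "x \<in> null #> x" using assms(1) by (simp add: mem_coset_iff norm_one)
  moreover have "f y = f x" if "y \<in> null #> x" for y
    using that by (intro assms(2)) (simp_all add: mem_coset_iff assms(1))
  ultimately have "f ` (null #> x) = {f x}" by blast
  then show ?thesis by simp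
qed

lemma norm_coset:
  assumes "x \<in> carrier G" shows "the_elem (N ` (null #> x)) = N x"
proof (rule the_elem_image_coset[OF assms])
  fix y assume "y \<in> carrier G" "N (inv x \<otimes> y) = 0"
  then show "N y = N x"
    using norm_diff_le_dist[of x y] assms by (simp add: norm_dist_def)
qed

lemma inv_mult_Mod_null:
  assumes "x \<in> carrier G" "y \<in> carrier G"
  shows "inv\<^bsub>G Mod null\<^esub> (null #> x) \<otimes>\<^bsub>G Mod null\<^esub> (null #> y) = null #> (inv x \<otimes> y)"
proof -
  interpret normal null G by (rule normal_null)
  show ?thesis
    using assms by (subst inv_FactGroup) (auto simp: carrier_FactGroup rcos_inv rcos_sum)
qed

end

lemma pseudonormed_groupI:
  fixes G (structure)
  assumes "group G"
    and nonneg: "\<And>x. x \<in> carrier G \<Longrightarrow> 0 \<le> N x" and one: "N \<one> \<le> 0"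
    and inv: "\<And>x. x \<in> carrier G \<Longrightarrow> N (inv x) \<le> N x"
    and mult: "\<And>x y. \<lbrakk>x \<in> carrier G; y \<in> carrier G\<rbrakk> \<Longrightarrow> N (x \<otimes> y) \<le> N x + N y"
    and conj: "\<And>x h. \<lbrakk>x \<in> carrier G; h \<in> carrier G\<rbrakk> \<Longrightarrow> N (h \<otimes> x \<otimes> inv h) \<le> N x"
  shows "pseudonormed_group G N"
proof -
  interpret group G by fact
  show ?thesis
  proof
    show "N \<one> = 0" using nonneg[of \<one>] one by simp
  next
    fix x assume x: "x \<in> carrier G"
    show "N (inv x) = N x" using inv[of x] inv[of "inv x"] x by simp
  next
    fix x h assume x: "x \<in> carrier G" and h: "h \<in> carrier G"
    have "inv h \<otimes> (h \<otimes> x \<otimes> inv h) \<otimes> inv (inv h) = x"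
      using x h by (simp add: m_assoc) (simp flip: m_assoc add: x)
    then show "N (h \<otimes> x \<otimes> inv h) = N x"
      using conj[OF x h] conj[of "h \<otimes> x \<otimes> inv h" "inv h"] x h by simp
  qed (use nonneg mult in auto)
qed

section \<open>Normal forms of words with real exponents\<close>

text \<open>
  Van der Waerden's trick: a letter acts on reduced words by left multiplication, and the
  normal form of a word is the result of letting its letters act on the empty word.
\<close>

fun push_letter :: "'i \<times> real \<Rightarrow> ('i \<times> real) list \<Rightarrow> ('i \<times> real) list" where
  "push_letter (i, r) w =
     (if r = 0 then w else
      case w of [] \<Rightarrow> [(i, r)]
      | (j, s) # w' \<Rightarrow> if i = j then (if r + s = 0 then w' else (i, r + s) # w') else (i, r) # w)"

definition normal_form :: "('i \<times> real) list \<Rightarrow> ('i \<times> real) list" where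
  "normal_form u = foldr push_letter u []"

definition reduced :: "('i \<times> real) list \<Rightarrow> bool" where
  "reduced u \<longleftrightarrow> successively (\<lambda>x y. fst x \<noteq> fst y) u \<and> (\<forall>x\<in>set u. snd x \<noteq> 0)"

lemma reduced_push_letter: "reduced w \<Longrightarrow> reduced (push_letter x w)"
  by (cases x; cases w; cases "tl w") (auto simp: reduced_def split: prod.splits list.splits)

lemma reduced_normal_form: "reduced (normal_form u)"
  unfolding normal_form_def
  by (induction u) (simp add: reduced_def, simp add: reduced_push_letter del: push_letter.simps)

text \<open>
  The action of one copy of the reals is additive, so adding up adjacent letters does not change
  the normal form.
\<close>

lemma push_letter_add:
  "reduced w \<Longrightarrow> push_letter (i, r) (push_letter (i, s) w) = push_letter (i, r + s) w"
  by (cases w; cases "tl w") (auto simp: reduced_def add.assoc split: prod.splits list.splits)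

lemma normal_form_step: "word_step I u v \<Longrightarrow> normal_form u = normal_form v"
proof (induction rule: word_step.induct)
  case (add u v i r s)
  have "push_letter (i, r) (push_letter (i, s) (normal_form v)) = push_letter (i, r + s) (normal_form v)"
    by (rule push_letter_add[OF reduced_normal_form])
  then show ?case
    by (simp add: normal_form_def del: push_letter.simps)
qed (simp add: normal_form_def)

lemma normal_form_cong: "equivclp (word_step I) u v \<Longrightarrow> normal_form u = normal_form v"
  by (induction rule: equivclp_induct) (auto dest: normal_form_step)

text \<open>
  In particular a nonempty reduced word does not represent the identity. A nonempty word that
  does therefore contains a zero letter or two adjacent letters of the same copy, which is what
  drives the induction on trivial words below.
\<close>

lemma normal_form_reduced: "reduced u \<Longrightarrow> normal_form u = u"
proof (induction u)
  case (Cons x u)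
  then have "normal_form u = u"
    by (cases u) (auto simp: reduced_def)
  then show ?case
    using Cons.prems by (cases x; cases u) (auto simp: reduced_def normal_form_def)
qed (simp add: normal_form_def)

lemma reducible_cases:
  assumes "\<not> reduced u"
  obtains u1 i u2 where "u = u1 @ [(i, 0)] @ u2"
  | u1 i r s u2 where "u = u1 @ [(i, r), (i, s)] @ u2"
  using assms
proof (induction u arbitrary: thesis)
  case (Cons x u)
  show ?case
  proof (cases "reduced u")
    case False
    show ?thesis
      by (rule Cons.IH[OF _ _ False]) (metis Cons.prems(1) append_Cons, metis Cons.prems(2) append_Cons)
  next
    case True
    then have "snd x = 0 \<or> (\<exists>y v. u = y # v \<and> fst x = fst y)"
      using Cons.prems(3) by (cases u) (auto simp: reduced_def)
    then show ?thesis
      using Cons.prems(1)[of "[]"] Cons.prems(2)[of "[]"] by (metis append_Nil append_Cons prod.collapse)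
  qed
qed (simp add: reduced_def)

section \<open>Blocks of a trivial word\<close>

definition eval_word :: "('a, 'b) monoid_scheme \<Rightarrow> ('a \<times> int) list \<Rightarrow> 'a" where
  "eval_word G u = foldr (\<lambda>(g, n) y. (g [^]\<^bsub>G\<^esub> n) \<otimes>\<^bsub>G\<^esub> y) u \<one>\<^bsub>G\<^esub>"

lemma eval_word_Nil [simp]: "eval_word G [] = \<one>\<^bsub>G\<^esub>"
  by (simp add: eval_word_def)

lemma eval_word_Cons [simp]: "eval_word G ((g, n) # u) = (g [^]\<^bsub>G\<^esub> n) \<otimes>\<^bsub>G\<^esub> eval_word G u"
  by (simp add: eval_word_def)

lemma (in group) eval_word_closed [simp]:
  "fst ` set u \<subseteq> carrier G \<Longrightarrow> eval_word G u \<in> carrier G"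
  by (induction u) (auto)

lemma (in group) eval_word_append:
  "\<lbrakk>fst ` set u \<subseteq> carrier G; fst ` set v \<subseteq> carrier G\<rbrakk> \<Longrightarrow> eval_word G (u @ v) = eval_word G u \<otimes> eval_word G v"
  by (induction u) (auto simp: m_assoc)

definition inverse_word :: "('i \<times> 'n::uminus) list \<Rightarrow> ('i \<times> 'n) list" where
  "inverse_word u = rev (map (\<lambda>(i, r). (i, - r)) u)"

lemma inverse_word_simps [simp]:
  "inverse_word [] = []"
  "inverse_word ((i, r) # u) = inverse_word u @ [(i, - r)]"
  "inverse_word (u @ v) = inverse_word v @ inverse_word u"
  "fst ` set (inverse_word u) = fst ` set u"
  by (auto simp: inverse_word_def image_image split_def)

lemma (in group) eval_word_inverse:
  "fst ` set u \<subseteq> carrier G \<Longrightarrow> eval_word G (inverse_word u) = inv (eval_word G u)"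
  by (induction u) (auto simp: eval_word_append inv_mult_group int_pow_neg)

text \<open>
  Record which letters of a trivial word merge with each other while it is cancelled down to the
  empty word. This groups the positions into blocks that share a generator and whose exponents
  add up to zero. The same cancellation works for any other exponents with vanishing block sums;
  when those are integers it can be carried out in the group \<open>G\<close> itself, where only integral
  powers of generators make sense.
  
  Positions are elements of a list \<open>L\<close> without repetitions, with generators \<open>gen\<close> and
  exponents \<open>a\<close>, and \<open>b\<close> sends a position to a name of its block. Keeping positions
  apart from letters makes it possible to vary the exponents and leave the blocks alone.
\<close>

lemma (in group) null_word_blocks:
  assumes "distinct L" and "gen ` set L \<subseteq> carrier G"
    and "normal_form (map (\<lambda>e. (gen e, a e)) L) = []"
  shows "\<exists>b. (\<forall>e\<in>set L. b e \<in> set L \<and> gen (b e) = gen e) \<and>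
             (\<forall>k. (\<Sum>e\<in>set L. if b e = k then a e else 0) = 0) \<and>
             (\<forall>a'. (\<forall>k. (\<Sum>e\<in>set L. if b e = k then a' e else 0) = 0)
                    \<longrightarrow> eval_word G (map (\<lambda>e. (gen e, a' e)) L) = \<one>)"
  using assms
proof (induction "length L" arbitrary: L a rule: less_induct)
  case less
  let ?W = "\<lambda>a. map (\<lambda>e. (gen e, a e))"
  show ?case
  proof (cases "L = []")
    case True
    then show ?thesis by simp
  next
    case False
    have "\<not> reduced (?W a L)"
      using normal_form_reduced[of "?W a L"] less.prems False by auto
    then show ?thesis
    proof (cases rule: reducible_cases)
      case (1 u1 i u2)
      then obtain L1 e L2 where L: "L = L1 @ [e] @ L2" and e: "gen e = i" "a e = 0"
        by (auto simp: map_eq_append_conv)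
      have e_notin: "e \<notin> set L1" "e \<notin> set L2" using less.prems L by auto
      have nf: "normal_form (?W a (L1 @ L2)) = []"
        using less.prems(3) e by (simp add: L normal_form_def)
      obtain b where b: "\<And>x. x \<in> set (L1 @ L2) \<Longrightarrow> b x \<in> set (L1 @ L2) \<and> gen (b x) = gen x"
        and b0: "\<And>k. (\<Sum>x\<in>set (L1 @ L2). if b x = k then a x else 0) = 0"
        and b1: "\<And>a'. (\<And>k. (\<Sum>x\<in>set (L1 @ L2). if b x = k then a' x else 0) = 0)
                    \<Longrightarrow> eval_word G (?W a' (L1 @ L2)) = \<one>"
        using less.hyps[OF _ _ _ nf] less.prems L by auto
      \<comment> \<open>A zero letter forms a block of its own.\<close>
      define b' where "b' = b(e := e)"
      have split: "(\<Sum>x\<in>set L. if b' x = k then f x else 0)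
          = (if k = e then f e else 0) + (\<Sum>x\<in>set (L1 @ L2). if b x = k then f x else 0)" for k and f :: "_ \<Rightarrow> 'z::ab_group_add"
      proof -
        have "set L = insert e (set (L1 @ L2))" by (auto simp: L)
        moreover have "(\<Sum>x\<in>set (L1 @ L2). if b' x = k then f x else 0) = (\<Sum>x\<in>set (L1 @ L2). if b x = k then f x else 0)"
          by (rule sum.cong) (use e_notin in \<open>auto simp: b'_def\<close>)
        ultimately show ?thesis using e_notin by (simp add: b'_def)
      qed
      have be: "(\<Sum>x\<in>set (L1 @ L2). if b x = e then f x else 0) = 0" for f :: "_ \<Rightarrow> 'z::ab_group_add"
        by (rule sum.neutral) (use b e_notin in fastforce)
      show ?thesis
      proof (intro exI[of _ b'] conjI allI impI ballI)
        fix x assume "x \<in> set L"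
        then show "b' x \<in> set L" "gen (b' x) = gen x"
          using b[of x] by (auto simp: L b'_def)
      next
        fix k show "(\<Sum>x\<in>set L. if b' x = k then a x else 0) = 0"
          unfolding split b0 using e by simp
      next
        fix a' :: "_ \<Rightarrow> int"
        assume a': "\<forall>k. (\<Sum>x\<in>set L. if b' x = k then a' x else 0) = 0"
        have e0: "a' e = 0" using a'[rule_format, of e] unfolding split be by simp
        have "eval_word G (?W a' (L1 @ L2)) = \<one>"
        proof (rule b1)
          fix k show "(\<Sum>x\<in>set (L1 @ L2). if b x = k then a' x else 0) = 0"
            using a'[rule_format, of k] e0 unfolding split by (simp split: if_splits)
        qed
        then show "eval_word G (?W a' L) = \<one>"
          using less.prems(2) e0 by (auto simp: L eval_word_append image_image image_Un)
      qed
    next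
      case (2 u1 i r s u2)
      then obtain L1 e d L2 where L: "L = L1 @ [e, d] @ L2" and e: "gen e = i" "a e = r" "gen d = i" "a d = s"
        by (auto simp: map_eq_append_conv map_eq_Cons_conv append_eq_Cons_conv)
      let ?L = "L1 @ [e] @ L2"
      have notin: "e \<notin> set L1" "e \<notin> set L2" "d \<notin> set L1" "d \<notin> set L2" "e \<noteq> d" using less.prems L by auto
      have Wm: "?W (a(e := r + s)) ?L = ?W a L1 @ [(i, r + s)] @ ?W a L2"
        using notin e by auto
      have "push_letter (i, r) (push_letter (i, s) (normal_form (?W a L2))) = push_letter (i, r + s) (normal_form (?W a L2))"
        by (rule push_letter_add[OF reduced_normal_form])
      then have nf: "normal_form (?W (a(e := r + s)) ?L) = []"
        using less.prems(3) e unfolding Wm by (simp add: L normal_form_def del: push_letter.simps)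
      obtain b where b: "\<And>x. x \<in> set ?L \<Longrightarrow> b x \<in> set ?L \<and> gen (b x) = gen x"
        and b0: "\<And>k. (\<Sum>x\<in>set ?L. if b x = k then (a(e := r + s)) x else 0) = 0"
        and b1: "\<And>a'. (\<And>k. (\<Sum>x\<in>set ?L. if b x = k then a' x else 0) = 0)
                    \<Longrightarrow> eval_word G (?W a' ?L) = \<one>"
        using less.hyps[OF _ _ _ nf] less.prems L by auto
      \<comment> \<open>Two merged letters join the block of their sum.\<close>
      define b' where "b' = b(d := b e)"
      have merge: "(\<Sum>x\<in>set L. if b' x = k then f x else 0)
          = (\<Sum>x\<in>set ?L. if b x = k then (f(e := f e + f d)) x else 0)" for k and f :: "_ \<Rightarrow> 'z::ab_group_add"
      proof -
        have sL: "set L = insert e (insert d (set (L1 @ L2)))" "set ?L = insert e (set (L1 @ L2))" by (auto simp: L)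
        have "(\<Sum>x\<in>set (L1 @ L2). if b' x = k then f x else 0) = (\<Sum>x\<in>set (L1 @ L2). if b x = k then (f(e := f e + f d)) x else 0)"
          by (rule sum.cong) (use notin in \<open>auto simp: b'_def\<close>)
        then show ?thesis using notin unfolding sL by (simp add: b'_def)
      qed
      show ?thesis
      proof (intro exI[of _ b'] conjI allI impI ballI)
        fix x assume "x \<in> set L"
        then show "b' x \<in> set L" "gen (b' x) = gen x"
          using b[of x] b[of e] e by (auto simp: L b'_def)
      next
        fix k show "(\<Sum>x\<in>set L. if b' x = k then a x else 0) = 0"
          unfolding merge e(2) e(4) by (rule b0)
      next
        fix a' :: "_ \<Rightarrow> int"
        assume a': "\<forall>k. (\<Sum>x\<in>set L. if b' x = k then a' x else 0) = 0"
        have "eval_word G (?W (a'(e := a' e + a' d)) ?L) = \<one>"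
          by (rule b1) (use a' in \<open>simp only: merge\<close>)
        moreover have "?W (a'(e := a' e + a' d)) ?L = ?W a' L1 @ [(i, a' e + a' d)] @ ?W a' L2"
          using notin e by auto
        ultimately have "eval_word G (?W a' L1 @ [(i, a' e + a' d)] @ ?W a' L2) = \<one>"
          by (simp only:)
        then show "eval_word G (?W a' L) = \<one>"
          using less.prems(2) e by (auto simp: L eval_word_append image_image image_Un int_pow_mult m_assoc)
      qed
    qed
  qed
qed

section \<open>Integral circulations\<close>

text \<open>
  A real circulation with integral demands can be replaced by an integral one that is not more
  expensive. The edges \<open>V\<close> lead from \<open>q v\<close> to \<open>p v\<close> and carry their flow \<open>s\<close> for
  free; supplies \<open>r\<close> enter from outside at the nodes \<open>nd i\<close>, at the price \<open>c\<close> of the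
  node per unit, and the demand is \<open>- D\<close>. The price is constant along edges, so an edge can be
  contracted: a solution after contraction leaves opposite imbalances at its two ends, and sending
  that integer along the edge repairs both. When no edges are left, all supplies entering
  at one node can be concentrated in a single one, which is then forced to be an integer; the
  triangle inequality shows that the price does not go up.
\<close>

lemma integral_flow:
  fixes s :: "'v \<Rightarrow> real" and r :: "'c \<Rightarrow> real" and D :: "'k \<Rightarrow> int"
  assumes "finite V" and "finite R"
    and "\<And>v. v \<in> V \<Longrightarrow> c (p v) = c (q v)" and "\<And>i. i \<in> R \<Longrightarrow> 0 \<le> c (nd i)"
    and "\<And>k. real_of_int (D k) + (\<Sum>i\<in>R. if nd i = k then r i else 0)
              + (\<Sum>v\<in>V. (if p v = k then s v else 0) - (if q v = k then s v else 0)) = 0"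
  shows "\<exists>(r' :: 'c \<Rightarrow> int) (s' :: 'v \<Rightarrow> int).
           (\<forall>k. D k + (\<Sum>i\<in>R. if nd i = k then r' i else 0)
              + (\<Sum>v\<in>V. (if p v = k then s' v else 0) - (if q v = k then s' v else 0)) = 0) \<and>
           (\<Sum>i\<in>R. \<bar>real_of_int (r' i)\<bar> * c (nd i)) \<le> (\<Sum>i\<in>R. \<bar>r i\<bar> * c (nd i))"
  using assms(1,3-5)
proof (induction V arbitrary: p q nd D rule: finite_induct)
  case empty
  show ?case
    using \<open>finite R\<close> empty.prems(2,3)
  proof (induction R arbitrary: r D rule: finite_induct)
    case empty
    then show ?case by simp
  next
    case (insert i R)
    show ?case
    proof (cases "\<exists>j\<in>R. nd j = nd i")
      case True
      then obtain j where j: "j \<in> R" "nd j = nd i" by auto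
      \<comment> \<open>Two supplies at the same node: move the supply \<open>i\<close> to \<open>j\<close>.\<close>
      define r1 where "r1 = r(j := r j + r i)"
      have "(\<Sum>x\<in>R. if nd x = k then r1 x else 0) = (\<Sum>x\<in>insert i R. if nd x = k then r x else 0)" for k
      proof -
        have "(\<Sum>x\<in>R - {j}. if nd x = k then r1 x else 0) = (\<Sum>x\<in>R - {j}. if nd x = k then r x else 0)"
          by (rule sum.cong) (auto simp: r1_def)
        then show ?thesis
          using j insert.hyps by (auto simp: sum.remove[OF insert.hyps(1) j(1)] r1_def add_ac)
      qed
      then obtain r' s' where r': "\<And>k. D k + (\<Sum>x\<in>R. if nd x = k then r' x else 0) = 0"
          and le: "(\<Sum>x\<in>R. \<bar>real_of_int (r' x)\<bar> * c (nd x)) \<le> (\<Sum>x\<in>R. \<bar>r1 x\<bar> * c (nd x))"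
        using insert.IH[of D r1] insert.prems by auto
      have "(\<Sum>x\<in>R. \<bar>r1 x\<bar> * c (nd x)) \<le> (\<Sum>x\<in>insert i R. \<bar>r x\<bar> * c (nd x))"
      proof -
        have "(\<Sum>x\<in>R - {j}. \<bar>r1 x\<bar> * c (nd x)) = (\<Sum>x\<in>R - {j}. \<bar>r x\<bar> * c (nd x))"
          by (rule sum.cong) (auto simp: r1_def)
        moreover have "\<bar>r j + r i\<bar> * c (nd i) \<le> (\<bar>r j\<bar> + \<bar>r i\<bar>) * c (nd i)"
          using insert.prems(1)[of i] by (intro mult_right_mono) auto
        ultimately show ?thesis
          using j insert.hyps by (auto simp: sum.remove[OF insert.hyps(1) j(1)] r1_def distrib_right)
      qed
      moreover have "(\<Sum>x\<in>R. if nd x = k then (r'(i := 0)) x else 0) = (\<Sum>x\<in>R. if nd x = k then r' x else 0)" for k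
        by (rule sum.cong) (use insert.hyps in auto)
      moreover have "(\<Sum>x\<in>R. \<bar>real_of_int ((r'(i := 0)) x)\<bar> * c (nd x)) = (\<Sum>x\<in>R. \<bar>real_of_int (r' x)\<bar> * c (nd x))"
        by (rule sum.cong) (use insert.hyps in auto)
      ultimately show ?thesis
        using r' le insert.hyps by (intro exI[of _ "r'(i := 0)"] exI[of _ s']) auto
    next
      case False
      have zero: "(\<Sum>x\<in>R. if nd x = nd i then f x else 0) = 0" for f :: "_ \<Rightarrow> 'z::comm_monoid_add"
        by (rule sum.neutral) (use False in auto)
      have ri: "r i = - real_of_int (D (nd i))"
        using insert.prems(2)[of "nd i"] insert.hyps zero[of r] by simp
      have "real_of_int ((D(nd i := 0)) k) + (\<Sum>x\<in>R. if nd x = k then r x else 0) = 0" for k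
        using insert.prems(2)[of k] insert.hyps zero[of r] by auto
      then obtain r' s' where r': "\<And>k. (D(nd i := 0)) k + (\<Sum>x\<in>R. if nd x = k then r' x else 0) = 0"
          and le: "(\<Sum>x\<in>R. \<bar>real_of_int (r' x)\<bar> * c (nd x)) \<le> (\<Sum>x\<in>R. \<bar>r x\<bar> * c (nd x))"
        using insert.IH[of "D(nd i := 0)" r] insert.prems by auto
      define r2 where "r2 = r'(i := - D (nd i))"
      have "(\<Sum>x\<in>R. if nd x = k then r2 x else 0) = (\<Sum>x\<in>R. if nd x = k then r' x else 0)" for k
        by (rule sum.cong) (use insert.hyps in \<open>auto simp: r2_def\<close>)
      moreover have "(\<Sum>x\<in>R. \<bar>real_of_int (r2 x)\<bar> * c (nd x)) = (\<Sum>x\<in>R. \<bar>real_of_int (r' x)\<bar> * c (nd x))"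
        by (rule sum.cong) (use insert.hyps in \<open>auto simp: r2_def\<close>)
      moreover have "r2 i = - D (nd i)" by (simp add: r2_def)
      moreover have "D k + (\<Sum>x\<in>R. if nd x = k then r' x else 0) = 0" if "nd i \<noteq> k" for k
        using r'[of k] that by simp
      ultimately show ?thesis
        using le insert.hyps ri zero[of r']
        by (intro exI[of _ r2] exI[of _ s']) auto
    qed
  qed
next
  case (insert v V)
  show ?case
  proof (cases "p v = q v")
    case True
    then obtain r' s' where r': "\<And>k. D k + (\<Sum>i\<in>R. if nd i = k then r' i else 0)
              + (\<Sum>v\<in>V. (if p v = k then s' v else 0) - (if q v = k then s' v else 0)) = 0"
           and le: "(\<Sum>i\<in>R. \<bar>real_of_int (r' i)\<bar> * c (nd i)) \<le> (\<Sum>i\<in>R. \<bar>r i\<bar> * c (nd i))"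
      using insert.IH[of p q nd D] insert.prems insert.hyps by auto
    then show ?thesis
      using True insert.hyps by (intro exI[of _ r'] exI[of _ s']) auto
  next
    case False
    define P where "P = p v"
    define Q where "Q = q v"
    have PQ: "P \<noteq> Q" "c P = c Q" using False insert.prems(1)[of v] by (auto simp: P_def Q_def)
    \<comment> \<open>Contract the edge: its end \<open>Q\<close> is identified with \<open>P\<close>.\<close>
    define m where "m = (\<lambda>k. if k = Q then P else k)"
    define D' where "D' = (\<lambda>k. if k = Q then 0 else if k = P then D P + D Q else D k)"
    have cm: "c (m k) = c k" for k using PQ by (simp add: m_def)
    have mQ: "m k \<noteq> Q" for k using PQ by (simp add: m_def)
    have at_P: "(if m k = P then z else 0) = (if k = P then z else 0) + (if k = Q then z else 0)" for k and z :: "'z::comm_monoid_add"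
      using PQ by (simp add: m_def)
    have at_k: "\<lbrakk>k' \<noteq> P; k' \<noteq> Q\<rbrakk> \<Longrightarrow> m k = k' \<longleftrightarrow> k = k'" for k k' by (auto simp: m_def)
    have merged: "real_of_int (D' k) + (\<Sum>i\<in>R. if m (nd i) = k then r i else 0)
              + (\<Sum>v\<in>V. (if m (p v) = k then s v else 0) - (if m (q v) = k then s v else 0)) = 0" for k
    proof -
      consider "k = Q" | "k = P" | "k \<noteq> P" "k \<noteq> Q" by auto
      then show ?thesis
      proof cases
        case 1 then show ?thesis by (simp add: D'_def mQ)
      next
        case 2
        then show ?thesis
          using insert.prems(3)[of P] insert.prems(3)[of Q] insert.hyps PQ
          by (simp add: at_P D'_def sum.distrib sum_subtractf P_def[symmetric] Q_def[symmetric])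
      next
        case 3
        then show ?thesis
          using insert.prems(3)[of k] insert.hyps
          by (simp add: at_k D'_def P_def[symmetric] Q_def[symmetric])
      qed
    qed
    obtain r' s' where r': "\<And>k. D' k + (\<Sum>i\<in>R. if m (nd i) = k then r' i else 0)
              + (\<Sum>v\<in>V. (if m (p v) = k then s' v else 0) - (if m (q v) = k then s' v else 0)) = 0"
           and le: "(\<Sum>i\<in>R. \<bar>real_of_int (r' i)\<bar> * c (nd i)) \<le> (\<Sum>i\<in>R. \<bar>r i\<bar> * c (nd i))"
      using insert.IH[of "\<lambda>v. m (p v)" "\<lambda>v. m (q v)" "\<lambda>i. m (nd i)" D'] insert.prems insert.hyps merged
      by (auto simp: cm)
    define bal where "bal = (\<lambda>k. D k + (\<Sum>i\<in>R. if nd i = k then r' i else 0)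
              + (\<Sum>v\<in>V. (if p v = k then s' v else 0) - (if q v = k then s' v else 0)))"
    have bal_PQ: "bal P + bal Q = 0"
      using r'[of P] PQ by (simp add: at_P D'_def bal_def sum.distrib sum_subtractf)
    have bal_k: "bal k = 0" if "k \<noteq> P" "k \<noteq> Q" for k
      using r'[of k] that by (simp add: at_k D'_def bal_def)
    \<comment> \<open>The imbalances at \<open>P\<close> and \<open>Q\<close> cancel, so one flow along the edge repairs both.\<close>
    define s2 where "s2 = s'(v := - bal P)"
    have V: "(\<Sum>x\<in>V. (if p x = k then s2 x else 0) - (if q x = k then s2 x else 0))
      = (\<Sum>x\<in>V. (if p x = k then s' x else 0) - (if q x = k then s' x else 0))" for k
      by (rule sum.cong) (use insert.hyps in \<open>auto simp: s2_def\<close>)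
    have s2v: "s2 v = - bal P" by (simp add: s2_def)
    have "D k + (\<Sum>i\<in>R. if nd i = k then r' i else 0)
              + (\<Sum>x\<in>insert v V. (if p x = k then s2 x else 0) - (if q x = k then s2 x else 0)) = 0" for k
    proof -
      have "D k + (\<Sum>i\<in>R. if nd i = k then r' i else 0)
              + (\<Sum>x\<in>insert v V. (if p x = k then s2 x else 0) - (if q x = k then s2 x else 0))
          = bal k + (if P = k then s2 v else 0) - (if Q = k then s2 v else 0)"
        using insert.hyps by (simp add: V bal_def P_def[symmetric] Q_def[symmetric])
      also have "\<dots> = 0"
        using bal_PQ bal_k[of k] PQ s2v by auto
      finally show ?thesis .
    qed
    then show ?thesis using le by blast
  qed
qed

section \<open>Making a product of conjugates integral\<close>

text \<open>
  Positions in the word \<open>(h 0 g 0 (h 0)\<inverse>) \<dots> (h (n-1) g (n-1) (h (n-1))\<inverse>) x\<inverse>\<close>: the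
  \<open>j\<close>-th letter of \<open>h i\<close>, its inverse, the letter \<open>g i\<close> between the conjugators, and the
  inverse of the \<open>j\<close>-th letter of \<open>x\<close>.
\<close>

datatype letter_pos = Conj nat nat | Conj_Inv nat nat | Core nat | Target nat

definition positions :: "(nat \<Rightarrow> nat) \<Rightarrow> nat \<Rightarrow> nat \<Rightarrow> letter_pos list" where
  "positions len n m =
     concat (map (\<lambda>i. map (Conj i) [0..<len i] @ [Core i] @ rev (map (Conj_Inv i) [0..<len i])) [0..<n])
     @ rev (map Target [0..<m])"

lemma set_positions:
  "set (positions len n m) = case_prod Conj ` (SIGMA i:{..<n}. {..<len i}) \<union>
     case_prod Conj_Inv ` (SIGMA i:{..<n}. {..<len i}) \<union> Core ` {..<n} \<union> Target ` {..<m}"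
  unfolding positions_def by (auto simp: image_iff) 

lemma distinct_positions: "distinct (positions len n m)"
proof -
  have "distinct (concat (map (\<lambda>i. map (Conj i) [0..<len i] @ [Core i] @ rev (map (Conj_Inv i) [0..<len i])) [0..<n]))"
    by (induction n) (auto simp: distinct_map inj_on_def)
  then show ?thesis
    unfolding positions_def by (auto simp: distinct_map inj_on_def)
qed

lemma sum_positions:
  fixes f :: "letter_pos \<Rightarrow> 'z::comm_monoid_add"
  shows "sum f (set (positions len n m)) =
    (\<Sum>(i, j)\<in>(SIGMA i:{..<n}. {..<len i}). f (Conj i j) + f (Conj_Inv i j)) + (\<Sum>i<n. f (Core i)) + (\<Sum>j<m. f (Target j))"
proof -
  let ?P = "SIGMA i:{..<n}. {..<len i}"
  let ?A = "case_prod Conj ` ?P" and ?B = "case_prod Conj_Inv ` ?P" and ?C = "Core ` {..<n}" and ?D = "Target ` {..<m}"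
  have disj: "?A \<inter> ?B = {}" "(?A \<union> ?B) \<inter> ?C = {}" "(?A \<union> ?B \<union> ?C) \<inter> ?D = {}"
    by auto
  have "sum f (set (positions len n m)) = sum f ?A + sum f ?B + sum f ?C + sum f ?D"
    unfolding set_positions using disj by (simp add: sum.union_disjoint)
  also have "sum f (case_prod Conj ` ?P) = (\<Sum>(i, j)\<in>?P. f (Conj i j))"
    by (subst sum.reindex) (auto simp: inj_on_def case_prod_beta)
  also have "sum f (case_prod Conj_Inv ` ?P) = (\<Sum>(i, j)\<in>?P. f (Conj_Inv i j))"
    by (subst sum.reindex) (auto simp: inj_on_def case_prod_beta)
  also have "sum f (Core ` {..<n}) = (\<Sum>i<n. f (Core i))"
    by (subst sum.reindex) (auto simp: inj_on_def)
  also have "sum f (Target ` {..<m}) = (\<Sum>i<m. f (Target i))"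
    by (subst sum.reindex) (auto simp: inj_on_def)
  finally show ?thesis by (simp add: case_prod_beta sum.distrib)
qed

fun pos_exponent :: "(nat \<times> nat \<Rightarrow> 'n::ab_group_add) \<Rightarrow> (nat \<Rightarrow> 'n) \<Rightarrow> (nat \<Rightarrow> 'n) \<Rightarrow> letter_pos \<Rightarrow> 'n" where
  "pos_exponent s r d (Conj i j) = s (i, j)"
| "pos_exponent s r d (Conj_Inv i j) = - s (i, j)"
| "pos_exponent s r d (Core i) = r i"
| "pos_exponent s r d (Target j) = - d j"

fun pos_generator :: "(nat \<times> nat \<Rightarrow> 'i) \<Rightarrow> (nat \<Rightarrow> 'i) \<Rightarrow> (nat \<Rightarrow> 'i) \<Rightarrow> letter_pos \<Rightarrow> 'i" where
  "pos_generator hg cg xg (Conj i j) = hg (i, j)"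
| "pos_generator hg cg xg (Conj_Inv i j) = hg (i, j)"
| "pos_generator hg cg xg (Core i) = cg i"
| "pos_generator hg cg xg (Target j) = xg j"

lemma map_positions:
  "map (\<lambda>e. (pos_generator hg cg xg e, pos_exponent s r d e)) (positions len n m) =
   (let w = \<lambda>i. map (\<lambda>j. (hg (i, j), s (i, j))) [0..<len i] in
     concat (map (\<lambda>i. w i @ [(cg i, r i)] @ inverse_word (w i)) [0..<n])
     @ inverse_word (map (\<lambda>j. (xg j, d j)) [0..<m]))"
  unfolding positions_def Let_def inverse_word_def by (simp add: map_concat rev_map o_def)

definition real_word :: "('i \<times> int) list \<Rightarrow> ('i \<times> real) list" where
  "real_word u = map (\<lambda>(i, n). (i, real_of_int n)) u"

lemma (in pseudonormed_group) norm_eval_conjugates: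
  assumes "\<And>i. i \<in> set is \<Longrightarrow> fst ` set (w i) \<subseteq> carrier G \<and> g i \<in> carrier G"
  shows "N (eval_word G (concat (map (\<lambda>i. w i @ [(g i, r i)] @ inverse_word (w i)) is)))
           \<le> (\<Sum>i\<leftarrow>is. \<bar>real_of_int (r i)\<bar> * N (g i))"
  using assms
proof (induction "is")
  case (Cons i "is")
  let ?h = "eval_word G (w i)" and ?c = "concat (map (\<lambda>i. w i @ [(g i, r i)] @ inverse_word (w i)) is)"
  have w: "fst ` set (w i) \<subseteq> carrier G" "g i \<in> carrier G"
    using Cons.prems[of i] by auto
  have c: "fst ` set ?c \<subseteq> carrier G"
    using Cons.prems by (simp add: image_UN image_Un UN_subset_iff)
  have "eval_word G (concat (map (\<lambda>i. w i @ [(g i, r i)] @ inverse_word (w i)) (i # is)))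
      = (?h \<otimes> (g i [^] r i) \<otimes> inv ?h) \<otimes> eval_word G ?c"
    using w c by (simp add: eval_word_append eval_word_inverse m_assoc image_Un)
  then have "N (eval_word G (concat (map (\<lambda>i. w i @ [(g i, r i)] @ inverse_word (w i)) (i # is))))
      \<le> N (g i [^] r i) + N (eval_word G ?c)"
    using norm_mult[of "?h \<otimes> (g i [^] r i) \<otimes> inv ?h" "eval_word G ?c"] norm_conj[of "g i [^] r i" ?h] w c by simp
  then show ?case
    using norm_int_pow[of "g i" "r i"] Cons w by fastforce
qed (simp add: norm_one)

text \<open>
  The heart of the matter. The word in the hypothesis cancels, so its positions fall into blocks.
  View blocks as nodes. A letter of a conjugator \<open>h\<close> occurs twice with opposite signs: it is a
  flow along an edge between two blocks of the same generator. The letters between the conjugators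
  are the supplies that have to be paid for, and the letters of \<open>x\<close> form an integral demand.
  An integral circulation is a choice of integral exponents for which the word still cancels,
  with \<open>x\<close> unchanged and at no higher cost. It exhibits the value of \<open>x\<close> in the group as a
  product of conjugates of integral powers, whose norm is bounded by the cost.
\<close>

lemma (in pseudonormed_group) norm_eval_le:
  assumes l: "\<And>h g r. (h, g, r) \<in> set l \<Longrightarrow> fst ` set h \<subseteq> carrier G \<and> g \<in> carrier G"
    and x: "fst ` set x \<subseteq> carrier G"
    and nf: "normal_form (concat (map (\<lambda>(h, g, r). h @ [(g, r)] @ inverse_word h) l)
               @ inverse_word (real_word x)) = []"
  shows "N (eval_word G x) \<le> (\<Sum>(h, g, r)\<leftarrow>l. \<bar>r\<bar> * N g)"
proof -
  define n m where "n = length l" and "m = length x"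
  define len where "len = (\<lambda>i. length (fst (l ! i)))"
  define hg where "hg = (\<lambda>(i, j). fst (fst (l ! i) ! j))"
  define cg where "cg = (\<lambda>i. fst (snd (l ! i)))"
  define xg where "xg = (\<lambda>j. fst (x ! j))"
  define s where "s = (\<lambda>(i, j). snd (fst (l ! i) ! j))"
  define r where "r = (\<lambda>i. snd (snd (l ! i)))"
  define d where "d = (\<lambda>j. snd (x ! j))"
  define dr where "dr = (\<lambda>j. real_of_int (d j))"
  define gen where "gen = pos_generator hg cg xg"
  define L where "L = positions len n m"
  define P where "P = (SIGMA i:{..<n}. {..<len i})"
  have xeq: "map (\<lambda>j. (xg j, d j)) [0..<m] = x"
    by (simp add: xg_def d_def m_def map_nth)
  have xeq': "map (\<lambda>j. (xg j, dr j)) [0..<m] = real_word x"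
    by (rule nth_equalityI) (simp_all add: xg_def d_def dr_def m_def real_word_def split_def)
  have "map (\<lambda>e. (gen e, pos_exponent s r dr e)) L =
      concat (map (\<lambda>i. (\<lambda>(h, g, r). h @ [(g, r)] @ inverse_word h) (l ! i)) [0..<n]) @ inverse_word (real_word x)"
    unfolding gen_def L_def map_positions Let_def xeq' 
    by (simp add: len_def hg_def s_def cg_def r_def split_def map_nth)
  also have "map (\<lambda>i. (\<lambda>(h, g, r). h @ [(g, r)] @ inverse_word h) (l ! i)) [0..<n]
      = map (\<lambda>(h, g, r). h @ [(g, r)] @ inverse_word h) l"
    by (rule nth_equalityI) (simp_all add: n_def)
  finally have W: "map (\<lambda>e. (gen e, pos_exponent s r dr e)) L =
      concat (map (\<lambda>(h, g, r). h @ [(g, r)] @ inverse_word h) l) @ inverse_word (real_word x)" .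
  have li: "fst ` set (fst (l ! i)) \<subseteq> carrier G \<and> fst (snd (l ! i)) \<in> carrier G" if "i < n" for i
  proof (rule l)
    show "(fst (l ! i), fst (snd (l ! i)), snd (snd (l ! i))) \<in> set l"
      using that by (simp add: n_def)
  qed
  have hgc: "hg (i, j) \<in> carrier G" if "i < n" "j < len i" for i j
    using li[OF that(1)] nth_mem[OF that(2)[unfolded len_def]] by (auto simp: hg_def)
  have cgc: "cg i \<in> carrier G" if "i < n" for i
    using li[OF that] by (simp add: cg_def)
  have xgc: "xg j \<in> carrier G" if "j < m" for j
    using x that by (auto simp: xg_def m_def image_subset_iff)
  have genc: "gen ` set L \<subseteq> carrier G"
    using hgc cgc xgc by (auto simp: gen_def L_def set_positions)
  have nfL: "normal_form (map (\<lambda>e. (gen e, pos_exponent s r dr e)) L) = []"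
    unfolding W by (rule nf)
  have dL: "distinct L" unfolding L_def by (rule distinct_positions)
  obtain b where b: "\<forall>e\<in>set L. b e \<in> set L \<and> gen (b e) = gen e"
    and b0: "\<forall>k. (\<Sum>e\<in>set L. if b e = k then pos_exponent s r dr e else 0) = 0"
    and b1: "\<forall>a. (\<forall>k. (\<Sum>e\<in>set L. if b e = k then a e else 0) = 0) \<longrightarrow> eval_word G (map (\<lambda>e. (gen e, a e)) L) = \<one>"
    using null_word_blocks[OF dL genc nfL] by blast
  \<comment> \<open>The blocks are the nodes of a flow; its demand comes from the letters of \<open>x\<close>.\<close>
  define D where "D = (\<lambda>k. \<Sum>j<m. if b (Target j) = k then - d j else 0)"
  have sum_split: "(\<Sum>e\<in>set L. if b e = k then pos_exponent s' r' d' e else 0) =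
       (\<Sum>j<m. if b (Target j) = k then - d' j else 0) + (\<Sum>i<n. if b (Core i) = k then r' i else 0)
       + (\<Sum>v\<in>P. (if b (case_prod Conj v) = k then s' v else 0) - (if b (case_prod Conj_Inv v) = k then s' v else 0))"
    for k r' d' and s' :: "nat \<times> nat \<Rightarrow> 'z::ab_group_add"
  proof -
    have "(\<Sum>(i, j)\<in>P. (if b (Conj i j) = k then s' (i, j) else 0) + (if b (Conj_Inv i j) = k then - s' (i, j) else 0))
       = (\<Sum>v\<in>P. (if b (case_prod Conj v) = k then s' v else 0) - (if b (case_prod Conj_Inv v) = k then s' v else 0))"
      by (rule sum.cong) auto
    then show ?thesis
      unfolding L_def sum_positions P_def[symmetric] pos_exponent.simps by (simp add: add_ac)
  qed
  define c where "c = (\<lambda>k. N (gen k))"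
  have "\<exists>r' s'. (\<forall>k. D k + (\<Sum>i\<in>{..<n}. if b (Core i) = k then r' i else 0)
              + (\<Sum>v\<in>P. (if b (case_prod Conj v) = k then s' v else 0) - (if b (case_prod Conj_Inv v) = k then s' v else 0)) = 0) \<and>
           (\<Sum>i\<in>{..<n}. \<bar>real_of_int (r' i)\<bar> * c (b (Core i))) \<le> (\<Sum>i\<in>{..<n}. \<bar>r i\<bar> * c (b (Core i)))"
  proof (rule integral_flow[where s = s])
    fix v assume "v \<in> P"
    then have "case_prod Conj v \<in> set L" "case_prod Conj_Inv v \<in> set L" "gen (case_prod Conj v) = gen (case_prod Conj_Inv v)"
      by (auto simp: L_def set_positions P_def gen_def)
    then show "c (b (case_prod Conj v)) = c (b (case_prod Conj_Inv v))"
      using b by (simp add: c_def)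
  next
    fix i assume "i \<in> {..<n}"
    then have "Core i \<in> set L" by (simp add: L_def set_positions)
    then show "0 \<le> c (b (Core i))"
      using b genc by (auto simp: c_def intro!: norm_nonneg)
  next
    fix k
    have "real_of_int (D k) = (\<Sum>j<m. if b (Target j) = k then - dr j else 0)"
      by (auto simp: D_def dr_def intro!: sum.cong)
    then show "real_of_int (D k) + (\<Sum>i\<in>{..<n}. if b (Core i) = k then r i else 0)
              + (\<Sum>v\<in>P. (if b (case_prod Conj v) = k then s v else 0) - (if b (case_prod Conj_Inv v) = k then s v else 0)) = 0"
      using b0[rule_format, of k] unfolding sum_split by simp
  qed (auto simp: P_def)
  then obtain r' s' where bal: "\<And>k. (\<Sum>e\<in>set L. if b e = k then pos_exponent s' r' d e else 0) = 0"
    and le: "(\<Sum>i<n. \<bar>real_of_int (r' i)\<bar> * c (b (Core i))) \<le> (\<Sum>i<n. \<bar>r i\<bar> * c (b (Core i)))"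
    unfolding sum_split D_def by blast
  have cb: "c (b (Core i)) = N (cg i)" if "i < n" for i
    using b that by (simp add: c_def gen_def L_def set_positions)
  define w where "w = (\<lambda>i. map (\<lambda>j. (hg (i, j), s' (i, j))) [0..<len i])"
  define V where "V = concat (map (\<lambda>i. w i @ [(cg i, r' i)] @ inverse_word (w i)) [0..<n])"
  have wc: "fst ` set (w i) \<subseteq> carrier G" if "i < n" for i
    using hgc that by (auto simp: w_def)
  have Vc: "fst ` set V \<subseteq> carrier G"
    using wc cgc by (simp add: V_def image_UN image_Un UN_subset_iff)
  have "eval_word G (map (\<lambda>e. (gen e, pos_exponent s' r' d e)) L) = \<one>"
    using b1 bal by blast
  then have "eval_word G (V @ inverse_word x) = \<one>"
    unfolding gen_def L_def map_positions Let_def xeq V_def w_def .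
  then have "eval_word G V \<otimes> inv (eval_word G x) = \<one>"
    using Vc x by (simp add: eval_word_append eval_word_inverse)
  then have "eval_word G x = eval_word G V"
    using Vc x inv_solve_right'[of \<one> "eval_word G V" "eval_word G x"] by simp
  also have "N \<dots> \<le> (\<Sum>i\<leftarrow>[0..<n]. \<bar>real_of_int (r' i)\<bar> * N (cg i))"
    unfolding V_def by (rule norm_eval_conjugates) (use wc cgc in auto)
  also have "\<dots> = (\<Sum>i<n. \<bar>real_of_int (r' i)\<bar> * c (b (Core i)))"
    by (simp add: interv_sum_list_conv_sum_set_nat cb atLeast0LessThan)
  also have "\<dots> \<le> (\<Sum>i<n. \<bar>r i\<bar> * c (b (Core i)))" by (rule le)
  also have "\<dots> = (\<Sum>(h, g, r)\<leftarrow>l. \<bar>r\<bar> * N g)"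
    by (simp add: cb sum_list_sum_nth n_def r_def cg_def split_def atLeast0LessThan)
  finally show ?thesis .
qed

section \<open>The free product of real lines\<close>

definition words :: "'i set \<Rightarrow> ('i \<times> real) list set" where
  "words I = lists (I \<times> UNIV)"

definition word_class :: "'i set \<Rightarrow> ('i \<times> real) list \<Rightarrow> ('i \<times> real) list set" where
  "word_class I u = word_rel I `` {u}"

lemma words_iff: "u \<in> words I \<longleftrightarrow> fst ` set u \<subseteq> I"
  by (auto simp: words_def in_lists_conv_set)

lemma words_simps [simp]:
  "[] \<in> words I" "x # u \<in> words I \<longleftrightarrow> fst x \<in> I \<and> u \<in> words I"
  "u @ v \<in> words I \<longleftrightarrow> u \<in> words I \<and> v \<in> words I"
  by (auto simp: words_iff)

lemma mem_word_class: "u' \<in> word_class I u \<longleftrightarrow> u \<in> words I \<and> u' \<in> words I \<and> equivclp (word_step I) u u'"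
  by (simp add: word_class_def word_rel_def words_def)

lemma inverse_word_in_words [simp]: "inverse_word u \<in> words I \<longleftrightarrow> u \<in> words I"
  by (simp add: words_iff)

lemma equiv_word_rel: "equiv (words I) (word_rel I)"
proof (rule equivI)
  show "trans (word_rel I)"
    unfolding word_rel_def by (rule transI) (auto intro: transpD[OF transp_equivclp])
qed (auto simp: word_rel_def words_def refl_on_def sym_def intro: equivclp_sym reflpD[OF reflp_equivclp])

lemma word_class_eq_iff:
  "\<lbrakk>u \<in> words I; v \<in> words I\<rbrakk> \<Longrightarrow> word_class I u = word_class I v \<longleftrightarrow> equivclp (word_step I) u v"
  using eq_equiv_class_iff[OF equiv_word_rel, of u I v] by (simp add: word_class_def word_rel_def words_def)

lemma word_step_context:
  "\<lbrakk>word_step I u v; w \<in> words I; z \<in> words I\<rbrakk> \<Longrightarrow> word_step I (w @ u @ z) (w @ v @ z)"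
proof (induction rule: word_step.induct)
  case (zero u v i)
  then show ?case using word_step.zero[of "w @ u" I "v @ z" i] by (simp add: words_def)
next
  case (add u v i r s)
  then show ?case using word_step.add[of "w @ u" I "v @ z" i r s] by (simp add: words_def)
qed

lemma equivclp_word_context:
  assumes "equivclp (word_step I) u v" "w \<in> words I" "z \<in> words I"
  shows "equivclp (word_step I) (w @ u @ z) (w @ v @ z)"
  using assms(1)
proof (induction rule: equivclp_induct)
  case base
  then show ?case by (rule reflpD[OF reflp_equivclp])
next
  case (step v v')
  then have "word_step I (w @ v @ z) (w @ v' @ z) \<or> word_step I (w @ v' @ z) (w @ v @ z)"
    using word_step_context assms(2,3) by blast
  then have "equivclp (word_step I) (w @ v @ z) (w @ v' @ z)"
    by (metis equivclp_def r_into_rtranclp symclpI1 symclpI2)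
  then show ?case using step.IH transpD[OF transp_equivclp] by metis
qed

lemma carrier_free_real: "carrier (free_real I) = word_class I ` words I"
  by (auto simp: free_real_def quotient_def word_class_def words_def)

lemma fbar_word_class: "fbar I i r = word_class I [(i, r)]"
  by (simp add: fbar_def word_class_def)

lemma word_class_closed [simp]: "u \<in> words I \<Longrightarrow> word_class I u \<in> carrier (free_real I)"
  by (simp add: carrier_free_real)

lemma fbar_closed [simp]: "i \<in> I \<Longrightarrow> fbar I i r \<in> carrier (free_real I)"
  by (simp add: fbar_word_class)

lemma one_free_real: "\<one>\<^bsub>free_real I\<^esub> = word_class I []"
  by (simp add: free_real_def word_class_def)

lemma mult_word_class:
  assumes "u \<in> words I" "v \<in> words I"
  shows "word_class I u \<otimes>\<^bsub>free_real I\<^esub> word_class I v = word_class I (u @ v)"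
proof -
  have "word_class I (u' @ v') = word_class I (u @ v)" if "u' \<in> word_class I u" "v' \<in> word_class I v" for u' v'
  proof -
    have uv: "equivclp (word_step I) u u'" "u' \<in> words I" "equivclp (word_step I) v v'" "v' \<in> words I"
      using that by (auto simp: mem_word_class)
    have "equivclp (word_step I) (u @ v) (u' @ v)"
      using equivclp_word_context[OF uv(1), of "[]" v] assms by simp
    moreover have "equivclp (word_step I) (u' @ v) (u' @ v')"
      using equivclp_word_context[OF uv(3), of u' "[]"] uv by simp
    ultimately have "equivclp (word_step I) (u @ v) (u' @ v')"
      by (rule transpD[OF transp_equivclp])
    then show ?thesis
      using word_class_eq_iff[of "u @ v" I "u' @ v'"] assms uv by simp
  qed
  moreover have "u \<in> word_class I u" "v \<in> word_class I v"
    using assms by (auto simp: mem_word_class intro: reflpD[OF reflp_equivclp])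
  ultimately have "(\<Union>u'\<in>word_class I u. \<Union>v'\<in>word_class I v. word_class I (u' @ v')) = word_class I (u @ v)"
    by blast
  then show ?thesis by (simp add: free_real_def word_class_def)
qed

lemma word_class_zero: "i \<in> I \<Longrightarrow> word_class I [(i, 0)] = word_class I []"
  using word_step.zero[of "[]" I "[]" i]
  by (subst word_class_eq_iff) (auto intro: r_into_equivclp)

lemma word_class_add:
  "\<lbrakk>i \<in> I\<rbrakk> \<Longrightarrow> word_class I [(i, r), (i, s)] = word_class I [(i, r + s)]"
  using word_step.add[of "[]" I "[]" i r s]
  by (subst word_class_eq_iff) (auto intro: r_into_equivclp)

lemma word_class_inverse_append: "u \<in> words I \<Longrightarrow> word_class I (inverse_word u @ u) = word_class I []"
proof (induction u)
  case (Cons x u)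
  obtain i r where x: "x = (i, r)" by force
  have I: "i \<in> I" "u \<in> words I" using Cons.prems x by auto
  have "word_class I (inverse_word (x # u) @ x # u)
      = word_class I (inverse_word u) \<otimes>\<^bsub>free_real I\<^esub> (word_class I [(i, - r), (i, r)] \<otimes>\<^bsub>free_real I\<^esub> word_class I u)"
    using I by (simp add: mult_word_class x)
  also have "word_class I [(i, - r), (i, r)] = word_class I []"
    using I by (simp add: word_class_add word_class_zero)
  also have "word_class I (inverse_word u) \<otimes>\<^bsub>free_real I\<^esub> (word_class I [] \<otimes>\<^bsub>free_real I\<^esub> word_class I u)
     = word_class I (inverse_word u @ u)"
    using I by (simp add: mult_word_class)
  finally show ?case using Cons.IH I by simp
qed simp

lemma group_free_real: "group (free_real I)"
proof (rule groupI)
  fix x assume "x \<in> carrier (free_real I)"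
  then obtain u where u: "u \<in> words I" "x = word_class I u" by (auto simp: carrier_free_real)
  then show "\<exists>y\<in>carrier (free_real I). y \<otimes>\<^bsub>free_real I\<^esub> x = \<one>\<^bsub>free_real I\<^esub>"
    by (intro bexI[of _ "word_class I (inverse_word u)"])
      (auto simp: carrier_free_real mult_word_class one_free_real word_class_inverse_append)
qed (auto simp: carrier_free_real mult_word_class one_free_real)

interpretation free_real: group "free_real I" for I
  by (rule group_free_real)

lemma inv_word_class: "u \<in> words I \<Longrightarrow> inv\<^bsub>free_real I\<^esub> word_class I u = word_class I (inverse_word u)"
  by (rule free_real.inv_equality)
    (auto simp: carrier_free_real mult_word_class one_free_real word_class_inverse_append)

lemma word_class_Cons:
  "\<lbrakk>i \<in> I; u \<in> words I\<rbrakk> \<Longrightarrow> word_class I ((i, r) # u) = fbar I i r \<otimes>\<^bsub>free_real I\<^esub> word_class I u"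
  by (simp add: fbar_word_class mult_word_class)

lemma fbar_add: "i \<in> I \<Longrightarrow> fbar I i r \<otimes>\<^bsub>free_real I\<^esub> fbar I i s = fbar I i (r + s)"
  by (simp add: fbar_word_class mult_word_class word_class_add)

lemma fbar_minus: "i \<in> I \<Longrightarrow> inv\<^bsub>free_real I\<^esub> fbar I i r = fbar I i (- r)"
  by (simp add: fbar_word_class inv_word_class)

definition scale_word :: "real \<Rightarrow> ('i \<times> real) list \<Rightarrow> ('i \<times> real) list" where
  "scale_word t u = map (\<lambda>(i, r). (i, t * r)) u"

lemma scale_word_in_words [simp]: "u \<in> words I \<Longrightarrow> scale_word t u \<in> words I"
  by (force simp: scale_word_def words_iff image_image split_def)

lemma scale_word_scale_word: "scale_word s (scale_word t u) = scale_word (s * t) u"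
  by (simp add: scale_word_def o_def split_def mult.assoc)

lemma scale_word_append [simp]: "scale_word t (u @ v) = scale_word t u @ scale_word t v"
  by (simp add: scale_word_def)

lemma scale_word_cong:
  "equivclp (word_step I) u v \<Longrightarrow> equivclp (word_step I) (scale_word t u) (scale_word t v)"
proof (induction rule: equivclp_induct)
  case base
  then show ?case by (rule reflpD[OF reflp_equivclp])
next
  case (step v v')
  have "word_step I x y \<Longrightarrow> word_step I (scale_word t x) (scale_word t y)" for x y
  proof (induction rule: word_step.induct)
    case (zero u v i)
    then show ?case
      using word_step.zero[of "scale_word t u" I "scale_word t v" i]
      by (simp flip: words_def) (simp add: scale_word_def)
  next
    case (add u v i r s)
    then show ?case
      using word_step.add[of "scale_word t u" I "scale_word t v" i "t * r" "t * s"]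
      by (simp flip: words_def) (simp add: scale_word_def distrib_left)
  qed
  then have "equivclp (word_step I) (scale_word t v) (scale_word t v')"
    using step.hyps(2) by (metis equivclp_sym r_into_equivclp)
  then show ?case using step.IH transpD[OF transp_equivclp] by metis
qed

lemma hom_word_class_unique:
  assumes "group H" "f \<in> hom (free_real I) H" "f' \<in> hom (free_real I) H"
    and "\<And>i r. i \<in> I \<Longrightarrow> f (fbar I i r) = f' (fbar I i r)" and "u \<in> words I"
  shows "f (word_class I u) = f' (word_class I u)"
  using assms(5)
proof (induction u)
  case Nil
  interpret f: group_hom "free_real I" H f
    using assms by (simp add: group_hom_def group_hom_axioms_def group_free_real)
  interpret f': group_hom "free_real I" H f'
    using assms by (simp add: group_hom_def group_hom_axioms_def group_free_real)
  show ?case using f.hom_one f'.hom_one by (simp add: one_free_real)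
next
  case (Cons x u)
  then show ?case
    using hom_mult[OF assms(2)] hom_mult[OF assms(3)] assms(4)
    by (cases x) (simp add: word_class_Cons)
qed

lemma psi_word_class:
  assumes "u \<in> words I"
  shows "psi I t (word_class I u) = word_class I (scale_word t u)"
proof -
  define f where "f = restrict (\<lambda>X. word_class I (scale_word t (SOME u. u \<in> words I \<and> X = word_class I u)))
    (carrier (free_real I))"
  have f: "f (word_class I u) = word_class I (scale_word t u)" if u: "u \<in> words I" for u
  proof -
    define v where "v = (SOME v. v \<in> words I \<and> word_class I u = word_class I v)"
    have v: "v \<in> words I" "word_class I u = word_class I v"
      using someI[of "\<lambda>v. v \<in> words I \<and> word_class I u = word_class I v" u] u by (auto simp: v_def)
    then have "equivclp (word_step I) (scale_word t v) (scale_word t u)"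
      using u word_class_eq_iff[of v I u] scale_word_cong by metis
    then have "word_class I (scale_word t v) = word_class I (scale_word t u)"
      using u v by (subst word_class_eq_iff) auto
    then show ?thesis using u by (simp add: f_def carrier_free_real flip: v_def)
  qed
  have hom: "f \<in> hom (free_real I) (free_real I)"
    by (rule homI) (auto simp: carrier_free_real f mult_word_class)
  have fbar: "f (fbar I i r) = fbar I i (t * r)" if "i \<in> I" for i r
    using that by (simp add: fbar_word_class f) (simp add: scale_word_def)
  have "psi I t = f"
    unfolding psi_def
  proof (rule the_equality)
    fix g assume g: "g \<in> hom (free_real I) (free_real I) \<inter> extensional (carrier (free_real I)) \<and>
                     (\<forall>i\<in>I. \<forall>r. g (fbar I i r) = fbar I i (t * r))"
    show "g = f"
    proof (rule extensionalityI[of _ "carrier (free_real I)"])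
      fix x assume "x \<in> carrier (free_real I)"
      then show "g x = f x"
        using hom_word_class_unique[where f = g and f' = f, OF group_free_real] g hom fbar
        by (auto simp: carrier_free_real)
    qed (use g in \<open>auto simp: f_def\<close>)
  qed (use hom fbar in \<open>auto simp: f_def\<close>)
  then show ?thesis using f assms by simp
qed

lemma psi_hom: "psi I t \<in> hom (free_real I) (free_real I)"
  by (rule homI) (auto simp: carrier_free_real psi_word_class mult_word_class)

lemma psi_closed [simp]: "x \<in> carrier (free_real I) \<Longrightarrow> psi I t x \<in> carrier (free_real I)"
  using psi_hom by (rule hom_in_carrier)

lemma psi_mult:
  "\<lbrakk>x \<in> carrier (free_real I); y \<in> carrier (free_real I)\<rbrakk>
    \<Longrightarrow> psi I t (x \<otimes>\<^bsub>free_real I\<^esub> y) = psi I t x \<otimes>\<^bsub>free_real I\<^esub> psi I t y"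
  using psi_hom by (rule hom_mult)

interpretation psi: group_hom "free_real I" "free_real I" "psi I t" for I t
  by unfold_locales (rule psi_hom)

lemma psi_psi: "x \<in> carrier (free_real I) \<Longrightarrow> psi I s (psi I t x) = psi I (s * t) x"
  by (auto simp: carrier_free_real psi_word_class scale_word_scale_word)

lemma psi_1: "x \<in> carrier (free_real I) \<Longrightarrow> psi I 1 x = x"
  by (auto simp: carrier_free_real psi_word_class scale_word_def)

lemma psi_fbar: "i \<in> I \<Longrightarrow> psi I t (fbar I i r) = fbar I i (t * r)"
  by (simp add: fbar_word_class psi_word_class) (simp add: scale_word_def)

section \<open>The free group inside the free product\<close>

lemma fst_real_word [simp]: "fst ` set (real_word x) = fst ` set x"
  by (auto simp: real_word_def image_image split_def)

lemma real_word_append [simp]: "real_word (x @ y) = real_word x @ real_word y"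
  by (simp add: real_word_def)

lemma real_word_inverse: "real_word (inverse_word x) = inverse_word (real_word x)"
  by (simp add: real_word_def inverse_word_def rev_map o_def split_def)

lemma carrier_free_int: "carrier (free_int I) = {word_class I (real_word x) | x. fst ` set x \<subseteq> I}"
proof
  have S: "carrier (free_real I) \<inter> (\<lambda>i. fbar I i 1) ` I = (\<lambda>i. fbar I i 1) ` I" by auto
  show "carrier (free_int I) \<subseteq> {word_class I (real_word x) | x. fst ` set x \<subseteq> I}"
  proof
    fix X assume "X \<in> carrier (free_int I)"
    then have "X \<in> generate (free_real I) ((\<lambda>i. fbar I i 1) ` I)"
      by (simp add: free_int_def carrier_subgroup_generated S)
    then have "\<exists>x. X = word_class I (real_word x) \<and> fst ` set x \<subseteq> I"
    proof (induction rule: generate.induct)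
      case one
      show ?case by (intro exI[of _ "[]"]) (simp add: one_free_real real_word_def)
    next
      case (incl h)
      then obtain i where "i \<in> I" "h = fbar I i 1" by auto
      then show ?case by (intro exI[of _ "[(i, 1)]"]) (simp add: fbar_word_class real_word_def)
    next
      case (inv h)
      then obtain i where "i \<in> I" "h = fbar I i 1" by auto
      then show ?case by (intro exI[of _ "[(i, -1)]"]) (simp add: fbar_minus, simp add: fbar_word_class real_word_def)
    next
      case (eng h1 h2)
      then obtain x y where "h1 = word_class I (real_word x)" "fst ` set x \<subseteq> I"
        "h2 = word_class I (real_word y)" "fst ` set y \<subseteq> I" by blast
      then show ?case by (intro exI[of _ "x @ y"]) (simp add: mult_word_class words_iff image_Un)
    qed
    then show "X \<in> {word_class I (real_word x) | x. fst ` set x \<subseteq> I}" by blast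
  qed
  let ?H = "carrier (free_int I)"
  interpret H: subgroup ?H "free_real I"
    unfolding free_int_def carrier_subgroup_generated by (rule free_real.generate_is_subgroup) auto
  have one: "fbar I i 1 \<in> ?H" if "i \<in> I" for i
    unfolding free_int_def carrier_subgroup_generated S by (rule generate.incl) (use that in auto)
  have nat: "fbar I i (real n) \<in> ?H" if "i \<in> I" for i n
  proof (induction n)
    case 0
    then show ?case using H.one_closed that by (simp add: fbar_word_class word_class_zero one_free_real)
  next
    case (Suc n)
    then show ?case using H.m_closed[OF one[OF that] Suc] that by (simp add: fbar_add)
  qed
  have int: "fbar I i (real_of_int n) \<in> ?H" if "i \<in> I" for i n
  proof (cases n rule: int_cases2)
    case (nonneg k) then show ?thesis using nat[OF that, of k] by simp
  next
    case (nonpos k) then show ?thesis using H.m_inv_closed[OF nat[OF that, of k]] that by (simp add: fbar_minus)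
  qed
  show "{word_class I (real_word x) | x. fst ` set x \<subseteq> I} \<subseteq> ?H"
  proof clarify
    fix x :: "('a \<times> int) list" assume "fst ` set x \<subseteq> I"
    then show "word_class I (real_word x) \<in> ?H"
    proof (induction x)
      case Nil
      then show ?case using H.one_closed by (simp add: one_free_real real_word_def)
    next
      case (Cons p x)
      obtain i n where p: "p = (i, n)" by force
      have "word_class I (real_word (p # x)) = fbar I i (real_of_int n) \<otimes>\<^bsub>free_real I\<^esub> word_class I (real_word x)"
        using Cons.prems by (simp add: p real_word_def[of "(i, n) # x"] flip: real_word_def)
          (subst word_class_Cons; simp add: words_iff)
      then show ?case using Cons H.m_closed int p by auto
    qed
  qed
qed

lemma free_int_subset: "x \<in> carrier (free_int I) \<Longrightarrow> x \<in> carrier (free_real I)"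
  by (auto simp: carrier_free_int carrier_free_real words_iff)

lemma group_free_int: "group (free_int I)"
  unfolding free_int_def by (rule free_real.group_subgroup_generated)

lemma mult_free_int [simp]: "mult (free_int I) = mult (free_real I)"
  by (simp add: free_int_def)

lemma inv_free_int: "x \<in> carrier (free_int I) \<Longrightarrow> inv\<^bsub>free_int I\<^esub> x = inv\<^bsub>free_real I\<^esub> x"
  unfolding free_int_def by simp

lemma fbar_1_free_int: "i \<in> I \<Longrightarrow> fbar I i 1 \<in> carrier (free_int I)"
  by (auto simp: carrier_free_int fbar_word_class real_word_def intro!: exI[of _ "[(i, 1)]"])

text \<open>
  Passing through real exponents creates no new relations between integral words, because the
  blocks of a cancellation over the reals also serve the integers.
\<close>

lemma (in group) eval_word_null:
  assumes x: "fst ` set x \<subseteq> carrier G" and nf: "normal_form (real_word x) = []"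
  shows "eval_word G x = \<one>"
proof -
  let ?L = "[0..<length x]" and ?g = "\<lambda>j. fst (x ! j)" and ?n = "\<lambda>j. snd (x ! j)"
  have eq: "map (\<lambda>j. (?g j, ?n j)) ?L = x" by (simp add: map_nth)
  have eq': "map (\<lambda>j. (?g j, real_of_int (?n j))) ?L = real_word x"
    by (rule nth_equalityI) (simp_all add: real_word_def split_def)
  have gen: "?g ` set ?L \<subseteq> carrier G" using x by (auto simp: image_subset_iff)
  have nf': "normal_form (map (\<lambda>j. (?g j, real_of_int (?n j))) ?L) = []"
    unfolding eq' by (rule nf)
  obtain b :: "nat \<Rightarrow> nat" where b0: "\<forall>k. (\<Sum>e\<in>set ?L. if b e = k then real_of_int (?n e) else 0) = 0"
    and b1: "\<forall>a. (\<forall>k. (\<Sum>e\<in>set ?L. if b e = k then a e else 0) = 0) \<longrightarrow> eval_word G (map (\<lambda>e. (?g e, a e)) ?L) = \<one>"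
    using null_word_blocks[OF distinct_upt gen nf'] by blast
  have "(\<Sum>e\<in>set ?L. if b e = k then ?n e else 0) = 0" for k
  proof -
    have "real_of_int (\<Sum>e\<in>set ?L. if b e = k then ?n e else 0) = (\<Sum>e\<in>set ?L. if b e = k then real_of_int (?n e) else 0)"
      unfolding of_int_sum by (rule sum.cong) auto
    also have "\<dots> = 0" using b0 by blast
    finally show ?thesis by (simp only: of_int_eq_0_iff)
  qed
  then have "eval_word G (map (\<lambda>e. (?g e, ?n e)) ?L) = \<one>"
    by (rule b1[rule_format])
  then show ?thesis unfolding eq .
qed

lemma (in group) eval_word_cong:
  assumes x: "fst ` set x \<subseteq> carrier G" and y: "fst ` set y \<subseteq> carrier G"
    and eq: "word_class (carrier G) (real_word x) = word_class (carrier G) (real_word y)"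
  shows "eval_word G x = eval_word G y"
proof -
  let ?I = "carrier G"
  have w: "real_word x \<in> words ?I" "real_word y \<in> words ?I" using x y by (simp_all add: words_iff)
  have "word_class ?I (real_word (inverse_word x @ y)) = word_class ?I []"
    using w word_class_inverse_append[OF w(1)] mult_word_class[of "inverse_word (real_word x)" ?I "real_word x"]
      mult_word_class[of "inverse_word (real_word x)" ?I "real_word y"] eq
    by (simp add: real_word_inverse)
  then have "normal_form (real_word (inverse_word x @ y)) = normal_form []"
    using w by (subst (asm) word_class_eq_iff) (auto simp: real_word_inverse intro: normal_form_cong)
  then have "eval_word G (inverse_word x @ y) = \<one>"
    using x y by (intro eval_word_null) (auto simp: normal_form_def image_Un)
  then show ?thesis
    using x y inv_solve_left'[of \<one> "eval_word G x" "eval_word G y"]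
    by (simp add: eval_word_append eval_word_inverse)
qed

text \<open>
  This identifies the function that \<open>free_proj\<close> selects: evaluation of integral
  representatives is a homomorphism, and a homomorphism is determined on generators.
\<close>

lemma (in group) free_proj_word_class:
  assumes "fst ` set x \<subseteq> carrier G"
  shows "free_proj G (word_class (carrier G) (real_word x)) = eval_word G x"
proof -
  let ?I = "carrier G" and ?F = "free_int (carrier G)"
  define f where "f = restrict (\<lambda>X. eval_word G (SOME x. fst ` set x \<subseteq> ?I \<and> X = word_class ?I (real_word x))) (carrier ?F)"
  have f: "f (word_class ?I (real_word x)) = eval_word G x" if x: "fst ` set x \<subseteq> ?I" for x
  proof -
    define y where "y = (SOME y. fst ` set y \<subseteq> ?I \<and> word_class ?I (real_word x) = word_class ?I (real_word y))"
    have y: "fst ` set y \<subseteq> ?I \<and> word_class ?I (real_word x) = word_class ?I (real_word y)"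
      unfolding y_def by (rule someI[of _ x]) (use x in simp)
    have "word_class ?I (real_word x) \<in> carrier ?F" using x by (auto simp: carrier_free_int)
    then have "f (word_class ?I (real_word x)) = eval_word G y" by (simp add: f_def y_def)
    also have "\<dots> = eval_word G x" using x y by (intro eval_word_cong) auto
    finally show ?thesis .
  qed
  have hom: "f \<in> hom ?F G"
  proof (rule homI)
    fix X assume "X \<in> carrier ?F"
    then obtain x where X: "X = word_class ?I (real_word x)" "fst ` set x \<subseteq> ?I" by (auto simp: carrier_free_int)
    show "f X \<in> carrier G" unfolding X(1) f[OF X(2)] using X(2) by simp
    fix Y assume "Y \<in> carrier ?F"
    then obtain y where Y: "Y = word_class ?I (real_word y)" "fst ` set y \<subseteq> ?I" by (auto simp: carrier_free_int)
    have "X \<otimes>\<^bsub>?F\<^esub> Y = word_class ?I (real_word (x @ y))"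
      using X Y by (simp add: mult_word_class words_iff)
    moreover have "f (word_class ?I (real_word (x @ y))) = eval_word G (x @ y)"
      by (rule f) (use X Y in auto)
    ultimately show "f (X \<otimes>\<^bsub>?F\<^esub> Y) = f X \<otimes> f Y"
      using X Y by (simp only: f eval_word_append)
  qed
  have fbar: "f (fbar ?I g 1) = g" if "g \<in> ?I" for g
    using f[of "[(g, 1)]"] that by (simp add: fbar_word_class real_word_def)
  have "free_proj G = f"
    unfolding free_proj_def
  proof (rule the_equality)
    fix h assume h: "h \<in> hom ?F G \<inter> extensional (carrier ?F) \<and> (\<forall>g\<in>?I. h (fbar ?I g 1) = g)"
    show "h = f"
    proof (rule extensionalityI[of _ "carrier ?F"])
      interpret hh: group_hom ?F G h
        using h by (simp add: group_hom_def group_hom_axioms_def group_free_int)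
      interpret ff: group_hom ?F G f
        using hom by (simp add: group_hom_def group_hom_axioms_def group_free_int)
      have S: "?I = ?I" "carrier (free_real ?I) \<inter> (\<lambda>i. fbar ?I i 1) ` ?I = (\<lambda>i. fbar ?I i 1) ` ?I" by auto
      fix X assume "X \<in> carrier ?F"
      then have "X \<in> generate (free_real ?I) ((\<lambda>i. fbar ?I i 1) ` ?I)"
        by (simp add: free_int_def carrier_subgroup_generated S(2))
      then show "h X = f X"
      proof (induction rule: generate.induct)
        case one
        then show ?case using hh.hom_one ff.hom_one by (simp add: free_int_def)
      next
        case (incl X)
        then show ?case using h fbar by auto
      next
        case (inv X)
        then have "X \<in> carrier ?F" "h X = f X" using h fbar fbar_1_free_int by auto
        then show ?case using hh.hom_inv[of X] ff.hom_inv[of X] by (simp add: inv_free_int)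
      next
        case (eng X Y)
        then have "X \<in> carrier ?F" "Y \<in> carrier ?F"
          by (simp_all add: free_int_def carrier_subgroup_generated S(2))
        then show ?case using eng hh.hom_mult[of X Y] ff.hom_mult[of X Y] by simp
      qed
    qed (use h in \<open>auto simp: f_def\<close>)
  qed (use hom fbar in \<open>auto simp: f_def\<close>)
  then show ?thesis using f assms by simp
qed

lemma (in group) free_proj_hom: "free_proj G \<in> hom (free_int (carrier G)) G"
proof (rule homI)
  fix X assume "X \<in> carrier (free_int (carrier G))"
  then obtain x where X: "X = word_class (carrier G) (real_word x)" "fst ` set x \<subseteq> carrier G"
    by (auto simp: carrier_free_int)
  show "free_proj G X \<in> carrier G" using X by (simp add: free_proj_word_class)
  fix Y assume "Y \<in> carrier (free_int (carrier G))"
  then obtain y where Y: "Y = word_class (carrier G) (real_word y)" "fst ` set y \<subseteq> carrier G"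
    by (auto simp: carrier_free_int)
  have "X \<otimes>\<^bsub>free_int (carrier G)\<^esub> Y = word_class (carrier G) (real_word (x @ y))"
    using X Y by (simp add: mult_word_class words_iff)
  moreover have "fst ` set (x @ y) \<subseteq> carrier G" using X Y by auto
  ultimately show "free_proj G (X \<otimes>\<^bsub>free_int (carrier G)\<^esub> Y) = free_proj G X \<otimes> free_proj G Y"
    using X Y by (simp only: free_proj_word_class eval_word_append)
qed

lemma (in group) free_proj_fbar: "g \<in> carrier G \<Longrightarrow> free_proj G (fbar (carrier G) g 1) = g"
  using free_proj_word_class[of "[(g, 1)]"] by (simp add: fbar_word_class real_word_def)

section \<open>The norm on the free product\<close>

text \<open>
  A product of conjugates of letters as a word, with the conjugators given by words. The sign in
  the definition of the norm is absorbed by the real exponent.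
\<close>

definition conj_word :: "(('i \<times> real) list \<times> 'i \<times> real) list \<Rightarrow> ('i \<times> real) list" where
  "conj_word l = concat (map (\<lambda>(h, g, r). h @ [(g, r)] @ inverse_word h) l)"

definition conj_cost :: "('i \<Rightarrow> real) \<Rightarrow> (('i \<times> real) list \<times> 'i \<times> real) list \<Rightarrow> real" where
  "conj_cost N l = (\<Sum>(h, g, r)\<leftarrow>l. \<bar>r\<bar> * N g)"

definition conj_costs :: "'i set \<Rightarrow> ('i \<Rightarrow> real) \<Rightarrow> ('i \<times> real) list set \<Rightarrow> real set" where
  "conj_costs I N x = {conj_cost N l | l. set l \<subseteq> words I \<times> I \<times> UNIV \<and> x = word_class I (conj_word l)}"

lemma conj_word_simps [simp]:
  "conj_word [] = []"
  "conj_word ((h, g, r) # l) = h @ [(g, r)] @ inverse_word h @ conj_word l"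
  "conj_word (l @ l') = conj_word l @ conj_word l'"
  by (simp_all add: conj_word_def)

lemma conj_cost_simps [simp]:
  "conj_cost N [] = 0"
  "conj_cost N ((h, g, r) # l) = \<bar>r\<bar> * N g + conj_cost N l"
  "conj_cost N (l @ l') = conj_cost N l + conj_cost N l'"
  by (simp_all add: conj_cost_def)

lemma conj_word_in_words [simp]: "set l \<subseteq> words I \<times> I \<times> UNIV \<Longrightarrow> conj_word l \<in> words I"
  by (induction l) auto

lemma free_real_norm_eq: "free_real_norm I N x = Inf (conj_costs I N x)"
proof -
  let ?F = "free_real I"
  let ?prod = "\<lambda>l. foldr (\<otimes>\<^bsub>?F\<^esub>) (map (\<lambda>(h, g, r, e). h \<otimes>\<^bsub>?F\<^esub> (fbar I g r [^]\<^bsub>?F\<^esub> (e::int)) \<otimes>\<^bsub>?F\<^esub> inv\<^bsub>?F\<^esub> h) l) \<one>\<^bsub>?F\<^esub>"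
  let ?cost = "\<lambda>l. \<Sum>(h, g, r, e)\<leftarrow>l. \<bar>r\<bar> * N g"
  let ?S = "carrier ?F \<times> I \<times> (UNIV :: real set) \<times> {1, - 1 :: int}"
  have letter: "word_class I u \<otimes>\<^bsub>?F\<^esub> (fbar I g r [^]\<^bsub>?F\<^esub> e) \<otimes>\<^bsub>?F\<^esub> inv\<^bsub>?F\<^esub> word_class I u
     = word_class I (u @ [(g, of_int e * r)] @ inverse_word u)" if "u \<in> words I" "g \<in> I" "e \<in> {1, - 1 :: int}" for u g r e
    using that by (auto simp: free_real.int_pow_neg inv_word_class mult_word_class fbar_word_class)
  have to_words: "\<exists>l'. set l' \<subseteq> words I \<times> I \<times> UNIV \<and> ?prod l = word_class I (conj_word l') \<and> ?cost l = conj_cost N l'"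
    if "set l \<subseteq> ?S" for l
    using that
  proof (induction l)
    case Nil
    show ?case by (intro exI[of _ "[]"]) (simp add: one_free_real)
  next
    case (Cons p l)
    obtain h g r e where p: "p = (h, g, r, e)" by (metis prod_cases4)
    then obtain u where u: "u \<in> words I" "h = word_class I u" "g \<in> I" "e \<in> {1, - 1}"
      using Cons.prems by (auto simp: carrier_free_real)
    obtain l' where l': "set l' \<subseteq> words I \<times> I \<times> UNIV" "?prod l = word_class I (conj_word l')" "?cost l = conj_cost N l'"
      using Cons by auto
    have "?prod (p # l) = word_class I (u @ [(g, of_int e * r)] @ inverse_word u) \<otimes>\<^bsub>?F\<^esub> word_class I (conj_word l')"
      using letter[OF u(1,3,4)] l'(2) by (simp add: p u(2))
    also have "\<dots> = word_class I (conj_word ((u, g, of_int e * r) # l'))"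
      using u l' by (subst mult_word_class) auto
    finally show ?case
      using u l' by (intro exI[of _ "(u, g, of_int e * r) # l'"]) (auto simp: p abs_mult)
  qed
  have from_words: "\<exists>l. set l \<subseteq> ?S \<and> ?prod l = word_class I (conj_word l') \<and> ?cost l = conj_cost N l'"
    if "set l' \<subseteq> words I \<times> I \<times> UNIV" for l'
    using that
  proof (induction l')
    case Nil
    show ?case by (intro exI[of _ "[]"]) (simp add: one_free_real)
  next
    case (Cons p l')
    obtain u g r where p: "p = (u, g, r)" by (metis prod_cases3)
    have u: "u \<in> words I" "g \<in> I" "set l' \<subseteq> words I \<times> I \<times> UNIV" using Cons.prems by (auto simp: p)
    then obtain l where l: "set l \<subseteq> ?S" "?prod l = word_class I (conj_word l')" "?cost l = conj_cost N l'"
      using Cons.IH by auto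
    have "?prod ((word_class I u, g, r, 1) # l)
        = word_class I (u @ [(g, of_int 1 * r)] @ inverse_word u) \<otimes>\<^bsub>?F\<^esub> word_class I (conj_word l')"
      using letter[OF u(1,2), of 1 r] l(2) by simp
    also have "\<dots> = word_class I (conj_word (p # l'))"
      using u by (subst mult_word_class) (auto simp: p)
    finally show ?case
      using u l by (intro exI[of _ "(word_class I u, g, r, 1) # l"]) (simp add: p)
  qed
  have "{?cost l | l. set l \<subseteq> ?S \<and> x = ?prod l} = conj_costs I N x"
  proof (intro equalityI subsetI)
    fix c assume "c \<in> {?cost l | l. set l \<subseteq> ?S \<and> x = ?prod l}"
    then obtain l where l: "c = ?cost l" "set l \<subseteq> ?S" "x = ?prod l" by blast
    show "c \<in> conj_costs I N x" unfolding conj_costs_def using to_words[OF l(2)] l(1,3) by auto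
  next
    fix c assume "c \<in> conj_costs I N x"
    then obtain l' where l': "c = conj_cost N l'" "set l' \<subseteq> words I \<times> I \<times> UNIV" "x = word_class I (conj_word l')"
      unfolding conj_costs_def by blast
    obtain l where l: "set l \<subseteq> ?S" "?prod l = word_class I (conj_word l')" "?cost l = conj_cost N l'"
      using from_words[OF l'(2)] by blast
    then have "c = ?cost l" "x = ?prod l" using l'(1,3) by (simp_all only:)
    then show "c \<in> {?cost l | l. set l \<subseteq> ?S \<and> x = ?prod l}" using l(1) by blast
  qed
  then show ?thesis unfolding free_real_norm_def by simp
qed

locale letter_weight =
  fixes I :: "'i set" and N :: "'i \<Rightarrow> real"
  assumes weight_nonneg: "i \<in> I \<Longrightarrow> 0 \<le> N i"
begin

abbreviation "F \<equiv> free_real I"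
abbreviation "nrm \<equiv> free_real_norm I N"

lemma conj_cost_nonneg: "set l \<subseteq> words I \<times> I \<times> UNIV \<Longrightarrow> 0 \<le> conj_cost N l"
  by (induction l) (auto simp: weight_nonneg)

lemma conj_costs_bdd: "bdd_below (conj_costs I N x)"
  by (rule bdd_belowI[of _ 0]) (auto simp: conj_costs_def conj_cost_nonneg)

lemma conj_costs_nonempty:
  assumes "x \<in> carrier F" shows "conj_costs I N x \<noteq> {}"
proof -
  obtain u where u: "u \<in> words I" "x = word_class I u" using assms by (auto simp: carrier_free_real)
  have "u = conj_word (map (\<lambda>(i, r). ([], i, r)) u)" by (induction u) auto
  moreover have "set (map (\<lambda>(i, r). ([], i, r)) u) \<subseteq> words I \<times> I \<times> UNIV" using u(1) by (auto simp: words_iff)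
  ultimately have "conj_cost N (map (\<lambda>(i, r). ([], i, r)) u) \<in> conj_costs I N x"
    unfolding conj_costs_def u(2) by (metis (mono_tags, lifting) mem_Collect_eq)
  then show ?thesis by blast
qed

lemma norm_le_cost: "set l \<subseteq> words I \<times> I \<times> UNIV \<Longrightarrow> nrm (word_class I (conj_word l)) \<le> conj_cost N l"
  unfolding free_real_norm_eq by (rule cInf_lower[OF _ conj_costs_bdd]) (auto simp: conj_costs_def)

lemma norm_greatest:
  assumes "x \<in> carrier F"
    and "\<And>l. \<lbrakk>set l \<subseteq> words I \<times> I \<times> UNIV; x = word_class I (conj_word l)\<rbrakk> \<Longrightarrow> c \<le> conj_cost N l"
  shows "c \<le> nrm x"
  unfolding free_real_norm_eq
  by (rule cInf_greatest[OF conj_costs_nonempty[OF assms(1)]]) (use assms(2) in \<open>auto simp: conj_costs_def\<close>)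

lemma pseudonormed_free_real: "pseudonormed_group F nrm"
proof (rule pseudonormed_groupI[OF group_free_real])
  fix x assume x: "x \<in> carrier F"
  show "0 \<le> nrm x" by (rule norm_greatest[OF x]) (rule conj_cost_nonneg)
  show "nrm (inv\<^bsub>F\<^esub> x) \<le> nrm x"
  proof (rule norm_greatest[OF x])
    fix l assume l: "set l \<subseteq> words I \<times> I \<times> UNIV" "x = word_class I (conj_word l)"
    define l' where "l' = rev (map (\<lambda>(h, g, r). (h, g, - r)) l)"
    have "conj_word l' = inverse_word (conj_word l)"
      unfolding l'_def by (induction l) (auto simp: inverse_word_def rev_map o_def split_def)
    moreover have "conj_cost N l' = conj_cost N l" unfolding l'_def by (induction l) auto
    moreover have "set l' \<subseteq> words I \<times> I \<times> UNIV" using l(1) by (auto simp: l'_def)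
    ultimately show "nrm (inv\<^bsub>F\<^esub> x) \<le> conj_cost N l"
      using norm_le_cost[of l'] l by (simp add: inv_word_class)
  qed
  fix h assume h: "h \<in> carrier F"
  then obtain u where u: "u \<in> words I" "h = word_class I u" by (auto simp: carrier_free_real)
  show "nrm (h \<otimes>\<^bsub>F\<^esub> x \<otimes>\<^bsub>F\<^esub> inv\<^bsub>F\<^esub> h) \<le> nrm x"
  proof (rule norm_greatest[OF x])
    fix l assume l: "set l \<subseteq> words I \<times> I \<times> UNIV" "x = word_class I (conj_word l)"
    define cj where "cj = map (\<lambda>(k, g, r). (u @ k, g, r)) l"
    have "word_class I (conj_word cj) = h \<otimes>\<^bsub>F\<^esub> word_class I (conj_word l) \<otimes>\<^bsub>F\<^esub> inv\<^bsub>F\<^esub> h"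
      unfolding cj_def using l(1)
    proof (induction l)
      case Nil
      then show ?case using h by (simp flip: one_free_real)
    next
      case (Cons p l)
      obtain k g r where p: "p = (k, g, r)" by (metis prod_cases3)
      define a where "a = word_class I (k @ [(g, r)] @ inverse_word k)"
      define b where "b = word_class I (conj_word l)"
      have in_words: "k \<in> words I" "g \<in> I" "conj_word l \<in> words I" using Cons.prems by (auto simp: p)
      have cl: "a \<in> carrier F" "b \<in> carrier F" using in_words by (simp_all add: a_def b_def)
      have sub: "set (map (\<lambda>(k, g, r). (u @ k, g, r)) l) \<subseteq> words I \<times> I \<times> UNIV"
        using Cons.prems u(1) by auto
      have "word_class I (conj_word (map (\<lambda>(k, g, r). (u @ k, g, r)) (p # l)))
          = word_class I ((u @ (k @ [(g, r)] @ inverse_word k) @ inverse_word u) @ conj_word (map (\<lambda>(k, g, r). (u @ k, g, r)) l))"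
        by (simp add: p)
      also have "\<dots> = word_class I (u @ (k @ [(g, r)] @ inverse_word k) @ inverse_word u)
            \<otimes>\<^bsub>F\<^esub> word_class I (conj_word (map (\<lambda>(k, g, r). (u @ k, g, r)) l))"
        by (rule mult_word_class[symmetric]) (use in_words u(1) conj_word_in_words[OF sub] in simp_all)
      also have "word_class I (u @ (k @ [(g, r)] @ inverse_word k) @ inverse_word u) = h \<otimes>\<^bsub>F\<^esub> a \<otimes>\<^bsub>F\<^esub> inv\<^bsub>F\<^esub> h"
        using in_words u by (simp add: a_def inv_word_class mult_word_class)
      also have "word_class I (conj_word (map (\<lambda>(k, g, r). (u @ k, g, r)) l)) = h \<otimes>\<^bsub>F\<^esub> b \<otimes>\<^bsub>F\<^esub> inv\<^bsub>F\<^esub> h"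
        unfolding b_def using Cons by simp
      also have "h \<otimes>\<^bsub>F\<^esub> a \<otimes>\<^bsub>F\<^esub> inv\<^bsub>F\<^esub> h \<otimes>\<^bsub>F\<^esub> (h \<otimes>\<^bsub>F\<^esub> b \<otimes>\<^bsub>F\<^esub> inv\<^bsub>F\<^esub> h) = h \<otimes>\<^bsub>F\<^esub> (a \<otimes>\<^bsub>F\<^esub> b) \<otimes>\<^bsub>F\<^esub> inv\<^bsub>F\<^esub> h"
      proof -
        have "inv\<^bsub>F\<^esub> h \<otimes>\<^bsub>F\<^esub> (h \<otimes>\<^bsub>F\<^esub> (b \<otimes>\<^bsub>F\<^esub> inv\<^bsub>F\<^esub> h)) = b \<otimes>\<^bsub>F\<^esub> inv\<^bsub>F\<^esub> h"
          using h cl by (simp flip: free_real.m_assoc)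
        then show ?thesis using h cl by (simp add: free_real.m_assoc)
      qed
      also have "a \<otimes>\<^bsub>F\<^esub> b = word_class I (conj_word (p # l))"
        unfolding a_def b_def using in_words by (simp add: mult_word_class p)
      finally show ?case .
    qed
    moreover have "conj_cost N cj = conj_cost N l" unfolding cj_def by (induction l) auto
    moreover have "set cj \<subseteq> words I \<times> I \<times> UNIV" using l(1) u(1) by (auto simp: cj_def)
    ultimately show "nrm (h \<otimes>\<^bsub>F\<^esub> x \<otimes>\<^bsub>F\<^esub> inv\<^bsub>F\<^esub> h) \<le> conj_cost N l"
      using norm_le_cost[of cj] l by simp
  qed
  fix y assume y: "y \<in> carrier F"
  have "nrm (x \<otimes>\<^bsub>F\<^esub> y) - nrm x \<le> nrm y"
  proof (rule norm_greatest[OF y])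
    fix l' assume l': "set l' \<subseteq> words I \<times> I \<times> UNIV" "y = word_class I (conj_word l')"
    have "nrm (x \<otimes>\<^bsub>F\<^esub> y) - conj_cost N l' \<le> nrm x"
    proof (rule norm_greatest[OF x])
      fix l assume l: "set l \<subseteq> words I \<times> I \<times> UNIV" "x = word_class I (conj_word l)"
      show "nrm (x \<otimes>\<^bsub>F\<^esub> y) - conj_cost N l' \<le> conj_cost N l"
        using norm_le_cost[of "l @ l'"] l l' by (simp add: mult_word_class)
    qed
    then show "nrm (x \<otimes>\<^bsub>F\<^esub> y) - nrm x \<le> conj_cost N l'" by simp
  qed
  then show "nrm (x \<otimes>\<^bsub>F\<^esub> y) \<le> nrm x + nrm y" by simp
next
  show "nrm \<one>\<^bsub>F\<^esub> \<le> 0" using norm_le_cost[of "[]"] by (simp add: one_free_real)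
qed

sublocale pseudonormed_group F nrm by (rule pseudonormed_free_real)

lemma norm_fbar_le: "g \<in> I \<Longrightarrow> nrm (fbar I g r) \<le> \<bar>r\<bar> * N g"
  using norm_le_cost[of "[([], g, r)]"] by (simp add: fbar_word_class)

text \<open>
  Changing the exponents letter by letter moves an element by at most the weighted sum of the
  changes. This bounds the error made when real exponents are rounded to integers.
\<close>

lemma norm_dist_words_le:
  assumes "set l \<subseteq> I \<times> UNIV \<times> UNIV"
  shows "norm_dist F nrm (word_class I (map (\<lambda>(g, r, s). (g, r)) l)) (word_class I (map (\<lambda>(g, r, s). (g, s)) l))
           \<le> (\<Sum>(g, r, s)\<leftarrow>l. \<bar>s - r\<bar> * N g)"
  using assms
proof (induction l)
  case Nil
  then show ?case using norm_one by (simp add: norm_dist_def flip: one_free_real)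
next
  case (Cons p l)
  obtain g r s where p: "p = (g, r, s)" by (metis prod_cases3)
  let ?u = "map (\<lambda>(g, r, s). (g, r)) l" and ?v = "map (\<lambda>(g, r, s). (g, s)) l"
  have g: "g \<in> I" and uv: "?u \<in> words I" "?v \<in> words I" using Cons.prems by (auto simp: p words_iff)
  have "norm_dist F nrm (fbar I g r \<otimes>\<^bsub>F\<^esub> word_class I ?u) (fbar I g s \<otimes>\<^bsub>F\<^esub> word_class I ?v)
      \<le> norm_dist F nrm (fbar I g r) (fbar I g s) + norm_dist F nrm (word_class I ?u) (word_class I ?v)"
    by (rule norm_dist_mult) (use g uv in auto)
  moreover have "norm_dist F nrm (fbar I g r) (fbar I g s) \<le> \<bar>s - r\<bar> * N g"
    using norm_fbar_le[OF g, of "s - r"] g by (simp add: norm_dist_def fbar_minus fbar_add)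
  ultimately show ?case
    using Cons g uv by (simp add: p word_class_Cons)
qed

lemma norm_psi_le:
  assumes "x \<in> carrier F" "0 < t"
  shows "nrm (psi I t x) \<le> t * nrm x"
proof -
  have "nrm (psi I t x) / t \<le> nrm x"
  proof (rule norm_greatest[OF assms(1)])
    fix l assume l: "set l \<subseteq> words I \<times> I \<times> UNIV" "x = word_class I (conj_word l)"
    define l' where "l' = map (\<lambda>(h, g, r). (scale_word t h, g, t * r)) l"
    have "conj_word l' = scale_word t (conj_word l)"
      unfolding l'_def by (induction l) (auto simp: scale_word_def inverse_word_def rev_map o_def split_def)
    moreover have "conj_cost N l' = t * conj_cost N l"
      unfolding l'_def using assms(2) by (induction l) (auto simp: abs_mult distrib_left)
    moreover have "set l' \<subseteq> words I \<times> I \<times> UNIV" using l(1) by (auto simp: l'_def)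
    ultimately have "nrm (psi I t x) \<le> t * conj_cost N l"
      using norm_le_cost[of l'] l by (simp add: psi_word_class)
    then show "nrm (psi I t x) / t \<le> conj_cost N l" using assms(2) by (simp add: divide_le_eq mult.commute)
  qed
  then show ?thesis using assms(2) by (simp add: divide_le_eq mult.commute)
qed

end

text \<open>
  On the free group the norm of the free product of real lines is not too small: allowing real
  exponents in the factorisations does not help, so the projection to \<open>G\<close> is still
  norm-decreasing.
\<close>

lemma (in pseudonormed_group) norm_free_proj_le:
  assumes "x \<in> carrier (free_int (carrier G))"
  shows "N (free_proj G x) \<le> free_real_norm (carrier G) N x"
proof -
  interpret W: letter_weight "carrier G" N by unfold_locales (rule norm_nonneg)
  obtain y where y: "x = word_class (carrier G) (real_word y)" "fst ` set y \<subseteq> carrier G"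
    using assms by (auto simp: carrier_free_int)
  have yw: "real_word y \<in> words (carrier G)" using y by (simp add: words_iff)
  show ?thesis
  proof (rule W.norm_greatest[OF free_int_subset[OF assms]])
    fix l assume l: "set l \<subseteq> words (carrier G) \<times> carrier G \<times> UNIV" "x = word_class (carrier G) (conj_word l)"
    have "word_class (carrier G) (conj_word l @ inverse_word (real_word y)) = x \<otimes>\<^bsub>W.F\<^esub> inv\<^bsub>W.F\<^esub> x"
      using l yw mult_word_class[of "conj_word l" "carrier G" "inverse_word (real_word y)"]
        inv_word_class[OF yw] y(1) by simp
    also have "\<dots> = word_class (carrier G) []"
      using free_int_subset[OF assms] by (simp add: one_free_real)
    finally have "normal_form (conj_word l @ inverse_word (real_word y)) = normal_form []"
      using l yw by (subst (asm) word_class_eq_iff) (auto intro: normal_form_cong)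
    then have nf: "normal_form (conj_word l @ inverse_word (real_word y)) = []"
      by (simp add: normal_form_def)
    have "N (eval_word G y) \<le> conj_cost N l"
      unfolding conj_cost_def
    proof (rule norm_eval_le)
      fix h g r assume "(h, g, r) \<in> set l"
      then show "fst ` set h \<subseteq> carrier G \<and> g \<in> carrier G"
        using subsetD[OF l(1), of "(h, g, r)"] by (simp add: words_iff)
    qed (use y nf in \<open>simp_all add: conj_word_def\<close>)
    then show "N (free_proj G x) \<le> conj_cost N l"
      using y by (simp add: free_proj_word_class)
  qed
qed

section \<open>Cauchy functions on scaling sets\<close>

lemma eventually_at_top_in:
  "eventually P (at_top_in T) \<longleftrightarrow> (\<exists>t0. \<forall>t\<in>T. t0 \<le> t \<longrightarrow> P t)"
  by (auto simp: eventually_inf_principal eventually_at_top_linorder)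

lemma at_top_in_nontrivial: "scaling_set T \<Longrightarrow> at_top_in T \<noteq> bot"
  by (auto simp: trivial_limit_def eventually_at_top_in scaling_set_def bdd_above_def)
    (metis linear)

lemma at_top_in_mono: "T \<subseteq> T' \<Longrightarrow> at_top_in T \<le> at_top_in T'"
  by (intro inf_mono) auto

lemma eventually_in_scaling_set: "eventually (\<lambda>t. t \<in> T) (at_top_in T)"
  by (auto simp: eventually_at_top_in)

lemma cauchy_at_top_convergent_real:
  fixes f :: "real \<Rightarrow> real"
  assumes "scaling_set T" and "\<And>\<epsilon>. 0 < \<epsilon> \<Longrightarrow> \<exists>t0. \<forall>t\<in>T. \<forall>t'\<in>T. t0 \<le> t \<and> t0 \<le> t' \<longrightarrow> \<bar>f t - f t'\<bar> < \<epsilon>"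
  shows "\<exists>l. (f \<longlongrightarrow> l) (at_top_in T)"
proof -
  let ?F = "filtermap f (at_top_in T)"
  have "cauchy_filter ?F"
    unfolding cauchy_filter_metric_filtermap
  proof (intro allI impI)
    fix e :: real assume "0 < e"
    then obtain t0 where t0: "\<forall>t\<in>T. \<forall>t'\<in>T. t0 \<le> t \<and> t0 \<le> t' \<longrightarrow> \<bar>f t - f t'\<bar> < e"
      using assms(2) by blast
    show "\<exists>P. eventually P (at_top_in T) \<and> (\<forall>x y. P x \<and> P y \<longrightarrow> dist (f x) (f y) < e)"
      by (rule exI[of _ "\<lambda>t. t \<in> T \<and> t0 \<le> t"]) (use t0 in \<open>auto simp: eventually_at_top_in dist_real_def\<close>)
  qed
  moreover have "complete (UNIV :: real set)"
    by (auto simp: complete_def dest!: real_Cauchy_convergent convergentD)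
  ultimately have "\<exists>c. ?F \<le> nhds c"
    using at_top_in_nontrivial[OF assms(1)] by (intro cauchy_filter_complete_converges) (auto simp: filtermap_bot_iff)
  then show ?thesis by (simp add: filterlim_def)
qed

context pseudonormed_group
begin

lemma cauchy_const: "x \<in> carrier G \<Longrightarrow> cauchy_at_top T (norm_dist G N) (\<lambda>t. x)"
  by (simp add: cauchy_at_top_def norm_dist_def norm_one)

lemma cauchy_mult:
  assumes "f \<in> T \<rightarrow> carrier G" "g \<in> T \<rightarrow> carrier G"
    and "cauchy_at_top T (norm_dist G N) f" "cauchy_at_top T (norm_dist G N) g"
  shows "cauchy_at_top T (norm_dist G N) (\<lambda>t. f t \<otimes> g t)"
  unfolding cauchy_at_top_def
proof (intro allI impI)
  fix e :: real assume "0 < e"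
  then have e2: "0 < e / 2" by simp
  obtain a where a: "\<forall>t\<in>T. \<forall>t'\<in>T. a \<le> t \<and> a \<le> t' \<longrightarrow> norm_dist G N (f t) (f t') < e / 2"
    using assms(3) e2 unfolding cauchy_at_top_def by blast
  obtain b where b: "\<forall>t\<in>T. \<forall>t'\<in>T. b \<le> t \<and> b \<le> t' \<longrightarrow> norm_dist G N (g t) (g t') < e / 2"
    using assms(4) e2 unfolding cauchy_at_top_def by blast
  show "\<exists>t0. \<forall>t\<in>T. \<forall>t'\<in>T. t0 \<le> t \<and> t0 \<le> t' \<longrightarrow> norm_dist G N (f t \<otimes> g t) (f t' \<otimes> g t') < e"
  proof (intro exI[of _ "max a b"] ballI impI)
    fix t t' assume t: "t \<in> T" "t' \<in> T" "max a b \<le> t \<and> max a b \<le> t'"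
    then have "norm_dist G N (f t) (f t') < e / 2" "norm_dist G N (g t) (g t') < e / 2"
      using a b by auto
    moreover have "norm_dist G N (f t \<otimes> g t) (f t' \<otimes> g t') \<le> norm_dist G N (f t) (f t') + norm_dist G N (g t) (g t')"
      by (rule norm_dist_mult) (use assms(1,2) t in auto)
    ultimately show "norm_dist G N (f t \<otimes> g t) (f t' \<otimes> g t') < e" by simp
  qed
qed

lemma cauchy_inv:
  assumes "f \<in> T \<rightarrow> carrier G" "cauchy_at_top T (norm_dist G N) f"
  shows "cauchy_at_top T (norm_dist G N) (\<lambda>t. inv (f t))"
proof -
  have "norm_dist G N (inv (f t)) (inv (f t')) = norm_dist G N (f t) (f t')" if "t \<in> T" "t' \<in> T" for t t'
    by (rule norm_dist_inv) (use assms(1) that in auto)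
  then show ?thesis using assms(2) unfolding cauchy_at_top_def by (metis (no_types, lifting))
qed

lemma cauchy_norm_convergent:
  assumes "scaling_set T" "f \<in> T \<rightarrow> carrier G" "cauchy_at_top T (norm_dist G N) f"
  shows "\<exists>l. ((\<lambda>t. N (f t)) \<longlongrightarrow> l) (at_top_in T)"
proof (rule cauchy_at_top_convergent_real[OF assms(1)])
  fix e :: real assume "0 < e"
  then obtain a where a: "\<forall>t\<in>T. \<forall>t'\<in>T. a \<le> t \<and> a \<le> t' \<longrightarrow> norm_dist G N (f t) (f t') < e"
    using assms(3) unfolding cauchy_at_top_def by blast
  show "\<exists>t0. \<forall>t\<in>T. \<forall>t'\<in>T. t0 \<le> t \<and> t0 \<le> t' \<longrightarrow> \<bar>N (f t) - N (f t')\<bar> < e"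
  proof (intro exI[of _ a] ballI impI)
    fix t t' assume t: "t \<in> T" "t' \<in> T" "a \<le> t \<and> a \<le> t'"
    then have "\<bar>N (f t) - N (f t')\<bar> \<le> norm_dist G N (f t) (f t')"
      using assms(2) by (intro norm_diff_le_dist) auto
    then show "\<bar>N (f t) - N (f t')\<bar> < e" using a t by force
  qed
qed

lemma cauchy_norm_tendsto_0:
  assumes "f \<in> T \<rightarrow> carrier G" "((\<lambda>t. N (f t)) \<longlongrightarrow> 0) (at_top_in T)"
  shows "cauchy_at_top T (norm_dist G N) f"
  unfolding cauchy_at_top_def
proof (intro allI impI)
  fix e :: real assume "0 < e"
  then have "eventually (\<lambda>t. N (f t) < e / 2) (at_top_in T)"
    using order_tendstoD(2)[OF assms(2), of "e / 2"] by simp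
  then obtain a where a: "\<forall>t\<in>T. a \<le> t \<longrightarrow> N (f t) < e / 2"
    by (auto simp: eventually_at_top_in)
  show "\<exists>t0. \<forall>t\<in>T. \<forall>t'\<in>T. t0 \<le> t \<and> t0 \<le> t' \<longrightarrow> norm_dist G N (f t) (f t') < e"
  proof (intro exI[of _ a] ballI impI)
    fix t t' assume t: "t \<in> T" "t' \<in> T" "a \<le> t \<and> a \<le> t'"
    have "norm_dist G N (f t) (f t') \<le> N (f t) + N (f t')"
      using norm_mult[of "inv (f t)" "f t'"] norm_inv[of "f t"] assms(1) t by (auto simp: norm_dist_def Pi_iff)
    moreover have "N (f t) < e / 2" "N (f t') < e / 2" using a t by auto
    ultimately show "norm_dist G N (f t) (f t') < e" by simp
  qed
qed

lemma image_norm_le: "x \<in> carrier G \<Longrightarrow> Inf (N ` {x' \<in> carrier G. \<phi> x' = \<phi> x}) \<le> N x"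
  by (rule cInf_lower) (auto intro!: bdd_belowI[of _ 0] simp: norm_nonneg)

lemma image_norm_greatest:
  assumes "y \<in> \<phi> ` carrier G" "\<And>x. \<lbrakk>x \<in> carrier G; \<phi> x = y\<rbrakk> \<Longrightarrow> c \<le> N x"
  shows "c \<le> Inf (N ` {x \<in> carrier G. \<phi> x = y})"
  by (rule cInf_greatest) (use assms in auto)

text \<open>
  This is how the projections in \<open>dir_C\<close> get their norm from the lifts in \<open>dir_D\<close>.
\<close>

lemma pseudonormed_image:
  assumes "\<phi> \<in> hom G B" "group B"
  shows "pseudonormed_group (B\<lparr>carrier := \<phi> ` carrier G\<rparr>) (\<lambda>y. Inf (N ` {x \<in> carrier G. \<phi> x = y}))"
    (is "pseudonormed_group ?C ?Q")
proof -
  interpret \<phi>: group_hom G B \<phi>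
    using assms by (simp add: group_hom_def group_hom_axioms_def group_axioms)
  have sub: "subgroup (\<phi> ` carrier G) B" by (rule \<phi>.img_is_subgroup)
  have inv_C: "inv\<^bsub>?C\<^esub> y = inv\<^bsub>B\<^esub> y" if "y \<in> \<phi> ` carrier G" for y
    by (rule \<phi>.H.m_inv_consistent[OF sub that])
  show ?thesis
  proof (rule pseudonormed_groupI)
    show "group ?C" by (rule \<phi>.H.subgroup_imp_group[OF sub])
    show "?Q \<one>\<^bsub>?C\<^esub> \<le> 0"
      using image_norm_le[of \<one> \<phi>] by (simp add: norm_one)
  next
    fix y assume "y \<in> carrier ?C"
    then have y: "y \<in> \<phi> ` carrier G" by simp
    show "0 \<le> ?Q y" by (rule image_norm_greatest[OF y norm_nonneg])
    show "?Q (inv\<^bsub>?C\<^esub> y) \<le> ?Q y"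
    proof (rule image_norm_greatest[OF y])
      fix x assume x: "x \<in> carrier G" "\<phi> x = y"
      then have "inv\<^bsub>?C\<^esub> y = \<phi> (inv x)" using inv_C[OF y] by simp
      then show "?Q (inv\<^bsub>?C\<^esub> y) \<le> N x"
        using image_norm_le[of "inv x" \<phi>] x by (simp add: norm_inv)
    qed
    fix z assume "z \<in> carrier ?C"
    then have z: "z \<in> \<phi> ` carrier G" by simp
    have "?Q (y \<otimes>\<^bsub>?C\<^esub> z) - ?Q y \<le> ?Q z"
    proof (rule image_norm_greatest[OF z])
      fix x' assume x': "x' \<in> carrier G" "\<phi> x' = z"
      have "?Q (y \<otimes>\<^bsub>?C\<^esub> z) - N x' \<le> ?Q y"
      proof (rule image_norm_greatest[OF y])
        fix x assume x: "x \<in> carrier G" "\<phi> x = y"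
        have "y \<otimes>\<^bsub>?C\<^esub> z = \<phi> (x \<otimes> x')" using x x' by simp
        then have "?Q (y \<otimes>\<^bsub>?C\<^esub> z) \<le> N (x \<otimes> x')" using image_norm_le[of "x \<otimes> x'" \<phi>] x x' by simp
        then show "?Q (y \<otimes>\<^bsub>?C\<^esub> z) - N x' \<le> N x" using norm_mult[of x x'] x x' by simp
      qed
      then show "?Q (y \<otimes>\<^bsub>?C\<^esub> z) - ?Q y \<le> N x'" by simp
    qed
    then show "?Q (y \<otimes>\<^bsub>?C\<^esub> z) \<le> ?Q y + ?Q z" by simp
    obtain h where h: "h \<in> carrier G" "z = \<phi> h" using z by auto
    show "?Q (z \<otimes>\<^bsub>?C\<^esub> y \<otimes>\<^bsub>?C\<^esub> inv\<^bsub>?C\<^esub> z) \<le> ?Q y"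
    proof (rule image_norm_greatest[OF y])
      fix x assume x: "x \<in> carrier G" "\<phi> x = y"
      have "z \<otimes>\<^bsub>?C\<^esub> y \<otimes>\<^bsub>?C\<^esub> inv\<^bsub>?C\<^esub> z = \<phi> (h \<otimes> x \<otimes> inv h)"
        using x h inv_C[OF z] by simp
      then show "?Q (z \<otimes>\<^bsub>?C\<^esub> y \<otimes>\<^bsub>?C\<^esub> inv\<^bsub>?C\<^esub> z) \<le> N x"
        using image_norm_le[of "h \<otimes> x \<otimes> inv h" \<phi>] x h by (simp add: norm_conj)
    qed
  qed
qed

section \<open>The groups of lifts and of their projections\<close>

abbreviation "FR \<equiv> free_real (carrier G)"
abbreviation "FZ \<equiv> free_int (carrier G)"
abbreviation "FN \<equiv> free_real_norm (carrier G) N"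
abbreviation "scaled w t \<equiv> psi (carrier G) (1 / t) (w t)"

lemma letter_weight: "letter_weight (carrier G) N"
  by unfold_locales (rule norm_nonneg)

lemma pseudonormed_FR: "pseudonormed_group FR FN"
  using letter_weight by (rule letter_weight.pseudonormed_free_real)

lemma carrier_dir_D:
  "w \<in> carrier (dir_D G N T) \<longleftrightarrow>
     w \<in> (\<Pi>\<^sub>E t\<in>T. carrier FZ) \<and> cauchy_at_top T (norm_dist FR FN) (scaled w)"
  by (simp add: dir_D_def)

lemma scaled_closed: "w \<in> (\<Pi>\<^sub>E t\<in>T. carrier FZ) \<Longrightarrow> scaled w \<in> T \<rightarrow> carrier FR"
  by (rule Pi_I, rule psi_closed, rule free_int_subset, rule PiE_mem)

lemma subgroup_dir_D: "subgroup (carrier (dir_D G N T)) (product_group T (\<lambda>_. FZ))"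
proof -
  interpret W: pseudonormed_group FR FN by (rule pseudonormed_FR)
  let ?P = "product_group T (\<lambda>_. FZ)"
  have grp: "group ?P" by (simp add: group_free_int)
  have cong: "cauchy_at_top T (norm_dist FR FN) f \<longleftrightarrow> cauchy_at_top T (norm_dist FR FN) g"
    if "\<And>t. t \<in> T \<Longrightarrow> f t = g t" for f g
    using that by (simp add: cauchy_at_top_def)
  show ?thesis
  proof (rule group.subgroupI[OF grp])
    show "carrier (dir_D G N T) \<subseteq> carrier ?P" by (rule subsetI) (simp add: carrier_dir_D)
    have "cauchy_at_top T (norm_dist FR FN) (scaled \<one>\<^bsub>?P\<^esub>)"
      by (subst cong[where g = "\<lambda>t. \<one>\<^bsub>FR\<^esub>"]) (auto simp: free_int_def intro: W.cauchy_const)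
    then have "\<one>\<^bsub>?P\<^esub> \<in> carrier (dir_D G N T)"
      using monoid.one_closed[OF group.is_monoid[OF grp]] by (simp add: carrier_dir_D)
    then show "carrier (dir_D G N T) \<noteq> {}" by blast
  next
    fix w assume w: "w \<in> carrier (dir_D G N T)"
    then have wP: "w \<in> (\<Pi>\<^sub>E t\<in>T. carrier FZ)" by (simp add: carrier_dir_D)
    have wF: "w t \<in> carrier FR" if "t \<in> T" for t
      by (rule free_int_subset[OF PiE_mem[OF wP that]])
    have "inv\<^bsub>?P\<^esub> w = (\<lambda>t\<in>T. inv\<^bsub>FZ\<^esub> w t)"
      by (rule inv_product_group[OF wP]) (rule group_free_int)
    also have "\<dots> = (\<lambda>t\<in>T. inv\<^bsub>FR\<^esub> w t)"
      by (intro restrict_ext inv_free_int PiE_mem[OF wP])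
    finally have inv: "inv\<^bsub>?P\<^esub> w = (\<lambda>t\<in>T. inv\<^bsub>FR\<^esub> w t)" .
    have "inv\<^bsub>?P\<^esub> w \<in> carrier ?P" using wP group.inv_closed[OF grp] by simp
    moreover have "cauchy_at_top T (norm_dist FR FN) (scaled (inv\<^bsub>?P\<^esub> w))"
      unfolding inv
    proof (subst cong[where g = "\<lambda>t. inv\<^bsub>FR\<^esub> scaled w t"])
      show "cauchy_at_top T (norm_dist FR FN) (\<lambda>t. inv\<^bsub>FR\<^esub> scaled w t)"
        by (rule W.cauchy_inv[OF scaled_closed[OF wP]]) (use w in \<open>simp add: carrier_dir_D\<close>)
    qed (simp_all add: psi.hom_inv wF)
    ultimately show "inv\<^bsub>?P\<^esub> w \<in> carrier (dir_D G N T)" by (simp add: carrier_dir_D)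
    fix v assume v: "v \<in> carrier (dir_D G N T)"
    then have vP: "v \<in> (\<Pi>\<^sub>E t\<in>T. carrier FZ)" by (simp add: carrier_dir_D)
    have "w \<otimes>\<^bsub>?P\<^esub> v \<in> carrier ?P"
      using wP vP monoid.m_closed[OF group.is_monoid[OF grp], of w v] by simp
    moreover have "cauchy_at_top T (norm_dist FR FN) (scaled (w \<otimes>\<^bsub>?P\<^esub> v))"
    proof (subst cong[where g = "\<lambda>t. scaled w t \<otimes>\<^bsub>FR\<^esub> scaled v t"])
      show "cauchy_at_top T (norm_dist FR FN) (\<lambda>t. scaled w t \<otimes>\<^bsub>FR\<^esub> scaled v t)"
        by (rule W.cauchy_mult[OF scaled_closed[OF wP] scaled_closed[OF vP]])
          (use w v in \<open>simp_all add: carrier_dir_D\<close>)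
    qed (simp_all add: psi_mult wF free_int_subset[OF PiE_mem[OF vP]])
    ultimately show "w \<otimes>\<^bsub>?P\<^esub> v \<in> carrier (dir_D G N T)" by (simp add: carrier_dir_D)
  qed
qed

lemma dir_D_eq: "dir_D G N T = (product_group T (\<lambda>_. FZ))\<lparr>carrier := carrier (dir_D G N T)\<rparr>"
  by (simp add: dir_D_def)

lemma dir_D_norm_tendsto:
  assumes "scaling_set T" "w \<in> carrier (dir_D G N T)"
  shows "((\<lambda>t. FN (scaled w t)) \<longlongrightarrow> dir_D_norm G N T w) (at_top_in T)"
proof -
  interpret W: pseudonormed_group FR FN by (rule pseudonormed_FR)
  have w: "w \<in> (\<Pi>\<^sub>E t\<in>T. carrier FZ)" "cauchy_at_top T (norm_dist FR FN) (scaled w)"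
    using assms(2) by (simp_all add: carrier_dir_D)
  obtain l where l: "((\<lambda>t. FN (scaled w t)) \<longlongrightarrow> l) (at_top_in T)"
    using W.cauchy_norm_convergent[OF assms(1) scaled_closed[OF w(1)] w(2)] by (rule exE)
  then show ?thesis
    using tendsto_Lim[OF at_top_in_nontrivial[OF assms(1)] l] by (simp add: dir_D_norm_def)
qed

lemma dir_D_norm_eqI:
  assumes "scaling_set T" "((\<lambda>t. FN (scaled w t)) \<longlongrightarrow> l) (at_top_in T)"
  shows "dir_D_norm G N T w = l"
  using tendsto_Lim[OF at_top_in_nontrivial[OF assms(1)] assms(2)] by (simp add: dir_D_norm_def)

lemma pseudonormed_dir_D:
  assumes T: "scaling_set T"
  shows "pseudonormed_group (dir_D G N T) (dir_D_norm G N T)"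
proof -
  interpret W: pseudonormed_group FR FN by (rule pseudonormed_FR)
  let ?P = "product_group T (\<lambda>_. FZ)" and ?D = "dir_D G N T"
  have grpP: "group ?P" by (simp add: group_free_int)
  have grp: "group ?D"
    using group.subgroup_imp_group[OF grpP subgroup_dir_D] by (subst dir_D_eq) 
  have mult: "(w \<otimes>\<^bsub>?D\<^esub> v) t = w t \<otimes>\<^bsub>FR\<^esub> v t" if "t \<in> T" for w v t
    using that by (simp add: dir_D_def)
  have inv: "(inv\<^bsub>?D\<^esub> w) t = inv\<^bsub>FR\<^esub> w t" if "t \<in> T" "w \<in> carrier ?D" for w t
  proof -
    have "inv\<^bsub>?D\<^esub> w = inv\<^bsub>?P\<^esub> w"
      using group.m_inv_consistent[OF grpP subgroup_dir_D that(2)] by (subst dir_D_eq)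
    moreover have w: "w \<in> (\<Pi>\<^sub>E t\<in>T. carrier FZ)" using that by (simp add: carrier_dir_D)
    ultimately show ?thesis
      using that PiE_mem[OF w that(1)] by (simp add: group_free_int inv_free_int)
  qed
  have cl: "w t \<in> carrier FR" "scaled w t \<in> carrier FR" if "t \<in> T" "w \<in> carrier ?D" for w t
  proof -
    have w: "w \<in> (\<Pi>\<^sub>E t\<in>T. carrier FZ)" using that by (simp add: carrier_dir_D)
    show "w t \<in> carrier FR" by (rule free_int_subset[OF PiE_mem[OF w that(1)]])
    then show "scaled w t \<in> carrier FR" by simp
  qed
  have le: "dir_D_norm G N T w \<le> c"
    if "w \<in> carrier ?D" "\<And>t. t \<in> T \<Longrightarrow> FN (scaled w t) \<le> f t" "(f \<longlongrightarrow> c) (at_top_in T)" for w f c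
    by (rule tendsto_le[OF at_top_in_nontrivial[OF T] that(3) dir_D_norm_tendsto[OF T that(1)]])
      (rule eventually_mono[OF eventually_in_scaling_set that(2)])
  interpret D: group ?D by (rule grp)
  show ?thesis
  proof (rule pseudonormed_groupI[OF grp])
    show "dir_D_norm G N T \<one>\<^bsub>?D\<^esub> \<le> 0"
    proof (rule le[where f = "\<lambda>_. 0"])
      fix t assume "t \<in> T"
      then have "\<one>\<^bsub>?D\<^esub> t = \<one>\<^bsub>FR\<^esub>" by (simp add: dir_D_def free_int_def)
      then show "FN (scaled \<one>\<^bsub>?D\<^esub> t) \<le> 0" by (simp add: W.norm_one)
    qed auto
  next
    fix w assume w: "w \<in> carrier ?D"
    show "0 \<le> dir_D_norm G N T w"
      by (rule tendsto_lowerbound[OF dir_D_norm_tendsto[OF T w] _ at_top_in_nontrivial[OF T]])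
        (rule eventually_mono[OF eventually_in_scaling_set], use cl w in \<open>auto intro: W.norm_nonneg\<close>)
    show "dir_D_norm G N T (inv\<^bsub>?D\<^esub> w) \<le> dir_D_norm G N T w"
      by (rule le[OF _ _ dir_D_norm_tendsto[OF T w]])
        (use w cl in \<open>auto simp: inv W.norm_inv\<close>)
    fix v assume v: "v \<in> carrier ?D"
    show "dir_D_norm G N T (w \<otimes>\<^bsub>?D\<^esub> v) \<le> dir_D_norm G N T w + dir_D_norm G N T v"
      by (rule le[OF _ _ tendsto_add[OF dir_D_norm_tendsto[OF T w] dir_D_norm_tendsto[OF T v]]])
        (use w v cl in \<open>auto simp: mult psi_mult W.norm_mult\<close>)
    show "dir_D_norm G N T (v \<otimes>\<^bsub>?D\<^esub> w \<otimes>\<^bsub>?D\<^esub> inv\<^bsub>?D\<^esub> v) \<le> dir_D_norm G N T w"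
      by (rule le[OF _ _ dir_D_norm_tendsto[OF T w]])
        (use w v cl in \<open>auto simp: mult inv psi_mult W.norm_conj\<close>)
  qed
qed

lemma compose_proj_hom:
  "compose T (free_proj G) \<in> hom (dir_D G N T) (product_group T (\<lambda>_. G))"
proof (rule homI)
  fix w assume "w \<in> carrier (dir_D G N T)"
  then have w: "w \<in> (\<Pi>\<^sub>E t\<in>T. carrier FZ)" by (simp add: carrier_dir_D)
  show "compose T (free_proj G) w \<in> carrier (product_group T (\<lambda>_. G))"
    using w hom_in_carrier[OF free_proj_hom] by (auto simp: compose_def)
  fix v assume "v \<in> carrier (dir_D G N T)"
  then have v: "v \<in> (\<Pi>\<^sub>E t\<in>T. carrier FZ)" by (simp add: carrier_dir_D)
  show "compose T (free_proj G) (w \<otimes>\<^bsub>dir_D G N T\<^esub> v) =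
      compose T (free_proj G) w \<otimes>\<^bsub>product_group T (\<lambda>_. G)\<^esub> compose T (free_proj G) v"
    using hom_mult[OF free_proj_hom PiE_mem[OF w] PiE_mem[OF v]]
    by (auto simp: compose_def dir_D_def intro!: restrict_ext)
qed

lemma pseudonormed_dir_C:
  assumes "scaling_set T"
  shows "pseudonormed_group (dir_C G N T) (dir_C_norm G N T)"
proof -
  interpret D: pseudonormed_group "dir_D G N T" "dir_D_norm G N T" by (rule pseudonormed_dir_D[OF assms])
  show ?thesis
    using D.pseudonormed_image[OF compose_proj_hom] 
    by (simp add: dir_C_def dir_C_norm_def[abs_def] group_axioms)
qed

lemma dir_C_norm_le:
  assumes "scaling_set T" "w \<in> carrier (dir_D G N T)" "compose T (free_proj G) w = g"
  shows "dir_C_norm G N T g \<le> dir_D_norm G N T w"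
proof -
  interpret D: pseudonormed_group "dir_D G N T" "dir_D_norm G N T" by (rule pseudonormed_dir_D[OF assms(1)])
  show ?thesis
    using D.image_norm_le[OF assms(2), of "compose T (free_proj G)"] assms(3) by (simp add: dir_C_norm_def)
qed

lemma carrier_dir_C: "carrier (dir_C G N T) = compose T (free_proj G) ` carrier (dir_D G N T)"
  by (simp add: dir_C_def)

lemma dir_C_norm_greatest:
  assumes "scaling_set T" "g \<in> carrier (dir_C G N T)"
    and "\<And>w. \<lbrakk>w \<in> carrier (dir_D G N T); compose T (free_proj G) w = g\<rbrakk> \<Longrightarrow> c \<le> dir_D_norm G N T w"
  shows "c \<le> dir_C_norm G N T g"
proof -
  interpret D: pseudonormed_group "dir_D G N T" "dir_D_norm G N T" by (rule pseudonormed_dir_D[OF assms(1)])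
  show ?thesis
    unfolding dir_C_norm_def
    by (rule D.image_norm_greatest) (use assms(2,3) in \<open>auto simp: carrier_dir_C\<close>)
qed

lemma dir_C_subset: "g \<in> carrier (dir_C G N T) \<Longrightarrow> g \<in> (\<Pi>\<^sub>E t\<in>T. carrier G)"
  using hom_in_carrier[OF compose_proj_hom] by (auto simp: carrier_dir_C)

lemma subgroup_dir_C:
  assumes "scaling_set T"
  shows "subgroup (carrier (dir_C G N T)) (product_group T (\<lambda>_. G))"
proof -
  interpret D: pseudonormed_group "dir_D G N T" "dir_D_norm G N T" by (rule pseudonormed_dir_D[OF assms(1)])
  interpret group_hom "dir_D G N T" "product_group T (\<lambda>_. G)" "compose T (free_proj G)"
    using compose_proj_hom group_axioms D.group_axioms by (simp add: group_hom_def group_hom_axioms_def)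
  show ?thesis unfolding carrier_dir_C by (rule img_is_subgroup)
qed

lemma inv_mult_dir_C:
  assumes "scaling_set T" "g \<in> carrier (dir_C G N T)" "h \<in> carrier (dir_C G N T)"
  shows "inv\<^bsub>dir_C G N T\<^esub> g \<otimes>\<^bsub>dir_C G N T\<^esub> h = (\<lambda>t\<in>T. inv (g t) \<otimes> h t)"
proof -
  let ?P = "product_group T (\<lambda>_. G)"
  have eq: "dir_C G N T = ?P\<lparr>carrier := carrier (dir_C G N T)\<rparr>" by (simp add: dir_C_def)
  have "inv\<^bsub>dir_C G N T\<^esub> g = inv\<^bsub>?P\<^esub> g"
    using group.m_inv_consistent[OF _ subgroup_dir_C[OF assms(1)] assms(2)] group_axioms eq by simp
  then show ?thesis
    using dir_C_subset[OF assms(2)] group_axioms by (auto simp: dir_C_def intro!: restrict_ext)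
qed

end

context pseudonormed_group
begin

text \<open>
  Rescaling by \<open>1 / t\<close> and back turns the comparison on the free group into a bound for the
  growth of the projection.
\<close>

lemma norm_proj_le_scaled:
  assumes "w \<in> carrier FZ" "0 < t"
  shows "N (free_proj G w) / t \<le> FN (psi (carrier G) (1 / t) w)"
proof -
  interpret W: letter_weight "carrier G" N by (rule letter_weight)
  have w: "w \<in> carrier FR" using assms(1) by (rule free_int_subset)
  have "psi (carrier G) t (psi (carrier G) (1 / t) w) = w"
    using assms(2) w by (simp add: psi_psi psi_1)
  then have "FN w \<le> t * FN (psi (carrier G) (1 / t) w)"
    using W.norm_psi_le[of "psi (carrier G) (1 / t) w" t] assms(2) w by simp
  then have "N (free_proj G w) \<le> t * FN (psi (carrier G) (1 / t) w)"
    using norm_free_proj_le[OF assms(1)] by linarith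
  then show ?thesis using assms(2) by (simp add: divide_le_eq mult.commute)
qed

lemma dir_C_growth:
  assumes T: "scaling_set T" and g: "g \<in> carrier (dir_C G N T)" and c: "dir_C_norm G N T g < c"
  shows "eventually (\<lambda>t. N (g t) / t < c) (at_top_in T)"
proof -
  obtain w where w: "w \<in> carrier (dir_D G N T)" "compose T (free_proj G) w = g" "dir_D_norm G N T w < c"
    using dir_C_norm_greatest[OF T g, of c] c by force
  have wP: "w \<in> (\<Pi>\<^sub>E t\<in>T. carrier FZ)" using w(1) by (simp add: carrier_dir_D)
  have "N (g t) / t < c" if "t \<in> T" "FN (scaled w t) < c" for t
  proof -
    have "0 < t" using T that(1) by (auto simp: scaling_set_def)
    moreover have "g t = free_proj G (w t)" using w(2) that(1) by (auto simp: compose_def)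
    ultimately show ?thesis
      using norm_proj_le_scaled[OF PiE_mem[OF wP that(1)]] that(2) by fastforce
  qed
  moreover have "eventually (\<lambda>t. t \<in> T \<and> FN (scaled w t) < c) (at_top_in T)"
    using order_tendstoD(2)[OF dir_D_norm_tendsto[OF T w(1)] w(3)] eventually_in_scaling_set
    by (rule eventually_conj[rotated])
  ultimately show ?thesis by (auto elim: eventually_mono)
qed

text \<open>
  A sublinear function \<open>g\<close> is lifted by the letters with generator \<open>g t\<close> and exponent 1. After
  rescaling they have norm at most \<open>N (g t) / t\<close>, so this lift converges to the identity.
\<close>

lemma dir_C_null_if_sublinear:
  assumes T: "scaling_set T" and g: "g \<in> (\<Pi>\<^sub>E t\<in>T. carrier G)"
    and lim: "((\<lambda>t. N (g t) / t) \<longlongrightarrow> 0) (at_top_in T)"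
  shows "g \<in> carrier (dir_C G N T) \<and> dir_C_norm G N T g = 0"
proof -
  interpret W: letter_weight "carrier G" N by (rule letter_weight)
  define w where "w = (\<lambda>t\<in>T. fbar (carrier G) (g t) 1)"
  have wP: "w \<in> (\<Pi>\<^sub>E t\<in>T. carrier FZ)"
    using g by (auto simp: w_def intro!: fbar_1_free_int)
  have bound: "0 \<le> FN (scaled w t) \<and> FN (scaled w t) \<le> N (g t) / t" if "t \<in> T" for t
  proof -
    have "0 < t" "g t \<in> carrier G" using T that g by (auto simp: scaling_set_def)
    then show ?thesis
      using W.norm_fbar_le[of "g t" "1 / t"] W.norm_nonneg that
      by (simp add: w_def psi_fbar)
  qed
  have w0: "((\<lambda>t. FN (scaled w t)) \<longlongrightarrow> 0) (at_top_in T)"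
    by (rule tendsto_sandwich[OF _ _ tendsto_const lim])
      (rule eventually_mono[OF eventually_in_scaling_set], use bound in blast)+
  have wD: "w \<in> carrier (dir_D G N T)"
    using W.cauchy_norm_tendsto_0[OF scaled_closed[OF wP] w0] wP by (simp add: carrier_dir_D)
  have wg: "compose T (free_proj G) w = g"
    using g by (auto simp: compose_def w_def free_proj_fbar fun_eq_iff PiE_iff extensional_def)
  have gC: "g \<in> carrier (dir_C G N T)" using wD wg by (auto simp: carrier_dir_C)
  interpret C: pseudonormed_group "dir_C G N T" "dir_C_norm G N T" by (rule pseudonormed_dir_C[OF T])
  have "dir_C_norm G N T g \<le> 0"
    using dir_C_norm_le[OF T wD wg] dir_D_norm_eqI[OF T w0] by simp
  then show ?thesis using gC C.norm_nonneg[OF gC] by simp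
qed

section \<open>Changing the scaling set\<close>

text \<open>
  The norm of a lift is a limit that can be computed along any smaller scaling set.
\<close>

lemma dir_D_restrict:
  assumes "scaling_set T" "scaling_set T'" "T \<subseteq> T'" "w \<in> carrier (dir_D G N T')"
  shows "restrict w T \<in> carrier (dir_D G N T)" "dir_D_norm G N T (restrict w T) = dir_D_norm G N T' w"
proof -
  have w: "w \<in> (\<Pi>\<^sub>E t\<in>T'. carrier FZ)" "cauchy_at_top T' (norm_dist FR FN) (scaled w)"
    using assms(4) by (simp_all add: carrier_dir_D)
  have "cauchy_at_top T (norm_dist FR FN) (scaled (restrict w T))"
    using w(2) assms(3) unfolding cauchy_at_top_def by (metis restrict_apply' subsetD)
  moreover have "restrict w T \<in> (\<Pi>\<^sub>E t\<in>T. carrier FZ)"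
    by (rule restrict_PiE_iff[THEN iffD2]) (use PiE_mem[OF w(1)] assms(3) in blast)
  ultimately show "restrict w T \<in> carrier (dir_D G N T)" by (simp add: carrier_dir_D)
  have "((\<lambda>t. FN (scaled w t)) \<longlongrightarrow> dir_D_norm G N T' w) (at_top_in T)"
    by (rule tendsto_mono[OF at_top_in_mono[OF assms(3)] dir_D_norm_tendsto[OF assms(2,4)]])
  then have "((\<lambda>t. FN (scaled (restrict w T) t)) \<longlongrightarrow> dir_D_norm G N T' w) (at_top_in T)"
    by (rule Lim_transform_eventually)
      (rule eventually_mono[OF eventually_in_scaling_set], simp)
  then show "dir_D_norm G N T (restrict w T) = dir_D_norm G N T' w"
    by (rule dir_D_norm_eqI[OF assms(1)])
qed

lemma restrict_compose: "T \<subseteq> T' \<Longrightarrow> restrict (compose T' f w) T = compose T f (restrict w T)"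
  by (auto simp: compose_def fun_eq_iff)

lemma dir_C_restrict:
  assumes "scaling_set T" "scaling_set T'" "T \<subseteq> T'" "g \<in> carrier (dir_C G N T')"
  shows "restrict g T \<in> carrier (dir_C G N T)" "dir_C_norm G N T (restrict g T) \<le> dir_C_norm G N T' g"
proof -
  show "restrict g T \<in> carrier (dir_C G N T)"
    using assms(4) dir_D_restrict(1)[OF assms(1-3)] restrict_compose[OF assms(3)]
    by (auto simp: carrier_dir_C)
  show "dir_C_norm G N T (restrict g T) \<le> dir_C_norm G N T' g"
  proof (rule dir_C_norm_greatest[OF assms(2,4)])
    fix w assume w: "w \<in> carrier (dir_D G N T')" "compose T' (free_proj G) w = g"
    then show "dir_C_norm G N T (restrict g T) \<le> dir_D_norm G N T' w"
      using dir_C_norm_le[OF assms(1) dir_D_restrict(1)[OF assms(1-3) w(1)]]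
        dir_D_restrict(2)[OF assms(1-3) w(1)] restrict_compose[OF assms(3)] by metis
  qed
qed

text \<open>
  Let \<open>t\<close> be a new scale. Take an old scale \<open>s\<close> that is large, but so small compared to
  \<open>t\<close> that the fixed word for \<open>w s\<close> can be dilated by \<open>t / s\<close> and rounded to integral
  exponents with a total error of \<open>o(t)\<close>. After rescaling by \<open>1 / t\<close> the rounded word is then
  close to the rescaled value of \<open>w\<close> at \<open>s\<close>, and the extension inherits the Cauchy property.
\<close>

lemma dir_D_extend:
  assumes T: "scaling_set T" and T': "scaling_set T'" and sub: "T \<subseteq> T'"
    and w: "w \<in> carrier (dir_D G N T)"
  shows "\<exists>w'\<in>carrier (dir_D G N T'). restrict w' T = w"
proof -
  interpret W: letter_weight "carrier G" N by (rule letter_weight)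
  let ?I = "carrier G"
  have wP: "w \<in> (\<Pi>\<^sub>E t\<in>T. carrier FZ)" and wc: "cauchy_at_top T (norm_dist FR FN) (scaled w)"
    using w by (simp_all add: carrier_dir_D)
  have pos: "0 < t" if "t \<in> T'" for t using T' that by (auto simp: scaling_set_def)
  have "\<exists>s\<in>T. real n \<le> s" for n
    using T unfolding scaling_set_def bdd_above_def by (meson linear)
  then obtain s where s: "\<And>n. s n \<in> T" "\<And>n. real n \<le> s n" by metis
  have "\<exists>y. w (s n) = word_class ?I (real_word y) \<and> fst ` set y \<subseteq> ?I" for n
    using PiE_mem[OF wP s(1)[of n]] by (auto simp: carrier_free_int)
  then obtain y where y: "\<And>n. w (s n) = word_class ?I (real_word (y n))" "\<And>n. fst ` set (y n) \<subseteq> ?I"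
    by metis
  define C where "C = (\<lambda>n. \<Sum>(g, k)\<leftarrow>y n. N g)"
  \<comment> \<open>The index of the old scale used at \<open>t\<close>. It tends to infinity, but so slowly that the
    rounding error \<open>C (m t)\<close> is at most \<open>t / m t\<close>.\<close>
  define m where "m = (\<lambda>t. Max {n. real n \<le> t \<and> real n * C n \<le> t})"
  have fin: "finite {n. real n \<le> t \<and> real n * C n \<le> t}" for t
    by (rule finite_subset[of _ "{.. nat \<lfloor>t\<rfloor>}"]) (auto simp: le_nat_floor)
  have m_bound: "real (m t) * C (m t) \<le> t" if "0 < t" for t
  proof -
    have "0 \<in> {n. real n \<le> t \<and> real n * C n \<le> t}" using that by simp
    then have "m t \<in> {n. real n \<le> t \<and> real n * C n \<le> t}"
      unfolding m_def using fin[of t] by (intro Max_in) blast+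
    then show ?thesis by simp
  qed
  have m_ge: "n \<le> m t" if "real n \<le> t" "real n * C n \<le> t" for n t
    unfolding m_def by (rule Max_ge[OF fin]) (use that in simp)
  define rounded where "rounded = (\<lambda>t n. map (\<lambda>(g, k). (g, \<lfloor>t * real_of_int k / s n\<rfloor>)) (y n))"
  define w' where "w' = (\<lambda>t\<in>T'. if t \<in> T then w t else word_class ?I (real_word (rounded t (m t))))"
  \<comment> \<open>The old scale at which the extension imitates \<open>w\<close>.\<close>
  define \<sigma> where "\<sigma> = (\<lambda>t. if t \<in> T then t else s (m t))"
  have \<sigma>T: "\<sigma> t \<in> T" for t using s by (simp add: \<sigma>_def)
  have rounded_gen: "fst ` set (rounded t n) \<subseteq> ?I" for t n
    using y(2)[of n] by (auto simp: rounded_def)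
  have w'P: "w' \<in> (\<Pi>\<^sub>E t\<in>T'. carrier FZ)"
    unfolding w'_def restrict_PiE_iff
  proof
    fix t
    have "word_class ?I (real_word (rounded t (m t))) \<in> carrier FZ"
      unfolding carrier_free_int using rounded_gen by blast
    then show "(if t \<in> T then w t else word_class ?I (real_word (rounded t (m t)))) \<in> carrier FZ"
      using PiE_mem[OF wP] by simp
  qed
  have cl: "scaled w' t \<in> carrier FR" if "t \<in> T'" for t
    using scaled_closed[OF w'P] that by blast
  have cl\<sigma>: "scaled w (\<sigma> t) \<in> carrier FR" for t
    using scaled_closed[OF wP] \<sigma>T by blast
  have near: "norm_dist FR FN (scaled w' t) (scaled w (\<sigma> t)) \<le> 1 / real (m t)" if t: "t \<in> T'" "0 < m t" for t
  proof (cases "t \<in> T")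
    case True
    then show ?thesis
      using t cl[OF t(1)] W.norm_one by (simp add: w'_def \<sigma>_def norm_dist_def)
  next
    case False
    define n where "n = m t"
    have t0: "0 < t" "0 < s n" using pos t(1) s(1) sub by auto
    define l where "l = map (\<lambda>(g, k). (g, real_of_int \<lfloor>t * real_of_int k / s n\<rfloor> / t, real_of_int k / s n)) (y n)"
    have lI: "set l \<subseteq> ?I \<times> UNIV \<times> UNIV" using y(2)[of n] by (auto simp: l_def)
    have "scaled w' t = word_class ?I (scale_word (1 / t) (real_word (rounded t n)))"
      using False t(1) rounded_gen by (simp add: w'_def n_def psi_word_class words_iff)
    also have "scale_word (1 / t) (real_word (rounded t n)) = map (\<lambda>(g, r, s). (g, r)) l"
      by (simp add: scale_word_def real_word_def rounded_def l_def split_def)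
    finally have 1: "scaled w' t = word_class ?I (map (\<lambda>(g, r, s). (g, r)) l)" .
    have "scaled w (\<sigma> t) = word_class ?I (scale_word (1 / s n) (real_word (y n)))"
      using False y by (simp add: \<sigma>_def n_def psi_word_class words_iff)
    also have "scale_word (1 / s n) (real_word (y n)) = map (\<lambda>(g, r, s). (g, s)) l"
      by (simp add: scale_word_def real_word_def l_def split_def)
    finally have 2: "scaled w (\<sigma> t) = word_class ?I (map (\<lambda>(g, r, s). (g, s)) l)" .
    have "norm_dist FR FN (scaled w' t) (scaled w (\<sigma> t)) \<le> (\<Sum>(g, r, s)\<leftarrow>l. \<bar>s - r\<bar> * N g)"
      unfolding 1 2 by (rule W.norm_dist_words_le[OF lI])
    also have "\<dots> = (\<Sum>(g, k)\<leftarrow>y n. \<bar>real_of_int k / s n - real_of_int \<lfloor>t * real_of_int k / s n\<rfloor> / t\<bar> * N g)"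
      by (simp add: l_def o_def split_def)
    also have "\<dots> \<le> (\<Sum>(g, k)\<leftarrow>y n. (1 / t) * N g)"
    proof (rule sum_list_mono)
      fix p assume "p \<in> set (y n)"
      then have g: "fst p \<in> ?I" using y(2)[of n] by auto
      let ?a = "t * real_of_int (snd p) / s n"
      have "real_of_int (snd p) / s n - real_of_int \<lfloor>?a\<rfloor> / t = (?a - real_of_int \<lfloor>?a\<rfloor>) / t"
        using t0 by (simp add: field_simps)
      also have "\<bar>\<dots>\<bar> \<le> 1 / t"
      proof -
        have "\<bar>?a - real_of_int \<lfloor>?a\<rfloor>\<bar> \<le> 1" by linarith
        then have "\<bar>?a - real_of_int \<lfloor>?a\<rfloor>\<bar> / t \<le> 1 / t" using t0 by (intro divide_right_mono) auto
        then show ?thesis using t0 by (simp only: abs_divide abs_of_pos)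
      qed
      finally have "\<bar>real_of_int (snd p) / s n - real_of_int \<lfloor>?a\<rfloor> / t\<bar> \<le> 1 / t" .
      from mult_right_mono[OF this norm_nonneg[OF g]] show "(case p of (g, k) \<Rightarrow> \<bar>real_of_int k / s n - real_of_int \<lfloor>t * real_of_int k / s n\<rfloor> / t\<bar> * N g)
         \<le> (case p of (g, k) \<Rightarrow> (1 / t) * N g)"
        by (simp add: split_def)
    qed
    also have "\<dots> = C n / t"
      unfolding C_def split_def sum_list_const_mult by simp
    also have "\<dots> \<le> 1 / real n"
      using m_bound[OF t0(1)] t(2) t0 by (simp add: n_def field_simps)
    finally show ?thesis by (simp add: n_def)
  qed
  have "cauchy_at_top T' (norm_dist FR FN) (scaled w')"
    unfolding cauchy_at_top_def
  proof (intro allI impI)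
    fix e :: real assume "0 < e"
    then have e3: "0 < e / 3" by simp
    obtain a where a: "\<forall>t\<in>T. \<forall>t'\<in>T. a \<le> t \<and> a \<le> t' \<longrightarrow> norm_dist FR FN (scaled w t) (scaled w t') < e / 3"
      using wc e3 unfolding cauchy_at_top_def by blast
    define K where "K = nat \<lceil>max a (3 / e)\<rceil> + 1"
    have K: "a \<le> real K" "3 / e < real K" "0 < K"
      unfolding K_def by linarith+
    define t0 where "t0 = max a (max (real K) (real K * C K))"
    have step: "norm_dist FR FN (scaled w' t) (scaled w (\<sigma> t)) < e / 3 \<and> a \<le> \<sigma> t" if "t \<in> T'" "t0 \<le> t" for t
    proof -
      have mK: "K \<le> m t" by (rule m_ge) (use that in \<open>auto simp: t0_def\<close>)
      then have "1 / real (m t) \<le> 1 / real K" using K(3) by (simp add: frac_le)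
      also have "\<dots> < e / 3" using K \<open>0 < e\<close> by (simp add: field_simps)
      finally have "norm_dist FR FN (scaled w' t) (scaled w (\<sigma> t)) < e / 3"
        using near[OF that(1)] mK K(3) by simp
      moreover have "a \<le> \<sigma> t"
        using K(1) mK s(2)[of "m t"] that(2) by (auto simp: \<sigma>_def t0_def)
      ultimately show ?thesis ..
    qed
    show "\<exists>t0. \<forall>t\<in>T'. \<forall>t'\<in>T'. t0 \<le> t \<and> t0 \<le> t' \<longrightarrow> norm_dist FR FN (scaled w' t) (scaled w' t') < e"
    proof (intro exI[of _ t0] ballI impI)
      fix t t' assume t: "t \<in> T'" "t' \<in> T'" "t0 \<le> t \<and> t0 \<le> t'"
      have "norm_dist FR FN (scaled w (\<sigma> t)) (scaled w (\<sigma> t')) < e / 3"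
        using a \<sigma>T step t by blast
      moreover have "norm_dist FR FN (scaled w' t) (scaled w' t')
          \<le> norm_dist FR FN (scaled w' t) (scaled w (\<sigma> t)) + norm_dist FR FN (scaled w (\<sigma> t)) (scaled w' t')"
        by (rule W.norm_dist_triangle[OF cl[OF t(1)] cl\<sigma> cl[OF t(2)]])
      moreover have "norm_dist FR FN (scaled w (\<sigma> t)) (scaled w' t')
          \<le> norm_dist FR FN (scaled w (\<sigma> t)) (scaled w (\<sigma> t')) + norm_dist FR FN (scaled w (\<sigma> t')) (scaled w' t')"
        by (rule W.norm_dist_triangle[OF cl\<sigma> cl\<sigma> cl[OF t(2)]])
      moreover have "norm_dist FR FN (scaled w (\<sigma> t')) (scaled w' t') = norm_dist FR FN (scaled w' t') (scaled w (\<sigma> t'))"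
        by (rule W.norm_dist_sym[OF cl\<sigma> cl[OF t(2)]])
      ultimately show "norm_dist FR FN (scaled w' t) (scaled w' t') < e"
        using step[OF t(1)] step[OF t(2)] t(3) by linarith
    qed
  qed
  then have "w' \<in> carrier (dir_D G N T')" using w'P by (simp add: carrier_dir_D)
  moreover have "restrict w' T = w"
  proof (rule extensionalityI[of _ T])
    show "w \<in> extensional T" using wP by (simp add: PiE_def)
  qed (use sub in \<open>auto simp: w'_def\<close>)
  ultimately show ?thesis by blast
qed

section \<open>Directional cones and independence of scaling\<close>

lemma dir_null_eq:
  assumes "scaling_set T"
  shows "dir_null G N T = pseudonormed_group.null (dir_C G N T) (dir_C_norm G N T)"
  using pseudonormed_group.null_def[OF pseudonormed_dir_C[OF assms]] by (simp add: dir_null_def)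

lemma carrier_dir_cone: "carrier (dir_cone G N T) = dir_class G N T ` carrier (dir_C G N T)"
  by (simp add: dir_cone_def carrier_FactGroup dir_class_def[abs_def])

lemma dir_cone_norm_class:
  assumes "scaling_set T" "g \<in> carrier (dir_C G N T)"
  shows "dir_cone_norm G N T (dir_class G N T g) = dir_C_norm G N T g"
proof -
  interpret C: pseudonormed_group "dir_C G N T" "dir_C_norm G N T" by (rule pseudonormed_dir_C[OF assms(1)])
  show ?thesis
    unfolding dir_cone_norm_def dir_class_def dir_null_eq[OF assms(1)] by (rule C.norm_coset[OF assms(2)])
qed

lemma dir_class_eq_iff:
  assumes "scaling_set T" "g \<in> carrier (dir_C G N T)" "h \<in> carrier (dir_C G N T)"
  shows "dir_class G N T g = dir_class G N T h \<longleftrightarrow> dir_C_norm G N T (\<lambda>t\<in>T. inv (g t) \<otimes> h t) = 0"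
proof -
  interpret C: pseudonormed_group "dir_C G N T" "dir_C_norm G N T" by (rule pseudonormed_dir_C[OF assms(1)])
  show ?thesis
    unfolding dir_class_def dir_null_eq[OF assms(1)]
    using C.coset_eq_iff[OF assms(2,3)] by (simp add: inv_mult_dir_C[OF assms])
qed

lemma quotient_in_dir_C:
  assumes "scaling_set T" "g \<in> carrier (dir_C G N T)" "h \<in> carrier (dir_C G N T)"
  shows "(\<lambda>t\<in>T. inv (g t) \<otimes> h t) \<in> carrier (dir_C G N T)"
proof -
  interpret C: pseudonormed_group "dir_C G N T" "dir_C_norm G N T" by (rule pseudonormed_dir_C[OF assms(1)])
  show ?thesis using inv_mult_dir_C[OF assms] C.m_closed[OF C.inv_closed[OF assms(2)] assms(3)] by simp
qed

lemma norm_dist_dir_cone: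
  assumes "scaling_set T" "g \<in> carrier (dir_C G N T)" "h \<in> carrier (dir_C G N T)"
  shows "norm_dist (dir_cone G N T) (dir_cone_norm G N T) (dir_class G N T g) (dir_class G N T h)
           = dir_C_norm G N T (\<lambda>t\<in>T. inv (g t) \<otimes> h t)"
proof -
  interpret C: pseudonormed_group "dir_C G N T" "dir_C_norm G N T" by (rule pseudonormed_dir_C[OF assms(1)])
  have "inv\<^bsub>dir_cone G N T\<^esub> (dir_class G N T g) \<otimes>\<^bsub>dir_cone G N T\<^esub> dir_class G N T h
      = dir_class G N T (\<lambda>t\<in>T. inv (g t) \<otimes> h t)"
    unfolding dir_cone_def dir_class_def dir_null_eq[OF assms(1)] C.inv_mult_Mod_null[OF assms(2,3)]
    by (simp add: inv_mult_dir_C[OF assms])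
  then show ?thesis
    by (simp add: norm_dist_def dir_cone_norm_class[OF assms(1) quotient_in_dir_C[OF assms]])
qed

lemma on_dir_class:
  assumes "scaling_set T" "g \<in> carrier (dir_C G N T)"
    and "\<And>h. \<lbrakk>h \<in> carrier (dir_C G N T); dir_C_norm G N T (\<lambda>t\<in>T. inv (g t) \<otimes> h t) = 0\<rbrakk> \<Longrightarrow> f h = f g"
  shows "the_elem (f ` dir_class G N T g) = f g"
proof -
  interpret C: pseudonormed_group "dir_C G N T" "dir_C_norm G N T" by (rule pseudonormed_dir_C[OF assms(1)])
  show ?thesis
    unfolding dir_class_def dir_null_eq[OF assms(1)]
    by (rule C.the_elem_image_coset[OF assms(2)]) (use assms in \<open>simp add: inv_mult_dir_C\<close>)
qed

lemma restrict_quotient: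
  "T \<subseteq> T' \<Longrightarrow> (\<lambda>t\<in>T. inv (restrict g T t) \<otimes> restrict h T t) = restrict (\<lambda>t\<in>T'. inv (g t) \<otimes> h t) T"
  by (auto simp: fun_eq_iff)

lemma dir_restrict_class:
  assumes "scaling_set T" "scaling_set T'" "T \<subseteq> T'" "g \<in> carrier (dir_C G N T')"
  shows "dir_restrict G N T (dir_class G N T' g) = dir_class G N T (restrict g T)"
  unfolding dir_restrict_def
proof (rule on_dir_class[OF assms(2,4)])
  fix h assume h: "h \<in> carrier (dir_C G N T')" "dir_C_norm G N T' (\<lambda>t\<in>T'. inv (g t) \<otimes> h t) = 0"
  interpret C: pseudonormed_group "dir_C G N T" "dir_C_norm G N T" by (rule pseudonormed_dir_C[OF assms(1)])
  let ?k = "\<lambda>t\<in>T'. inv (g t) \<otimes> h t"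
  have k: "?k \<in> carrier (dir_C G N T')" by (rule quotient_in_dir_C[OF assms(2,4) h(1)])
  have "dir_C_norm G N T (restrict ?k T) = 0"
    using dir_C_restrict[OF assms(1-3) k] h(2) C.norm_nonneg[of "restrict ?k T"] by simp
  then have "dir_class G N T (restrict g T) = dir_class G N T (restrict h T)"
    using dir_class_eq_iff[OF assms(1) dir_C_restrict(1)[OF assms] dir_C_restrict(1)[OF assms(1-3) h(1)]]
      restrict_quotient[OF assms(3), of g h] by simp
  then show "dir_class G N T (restrict h T) = dir_class G N T (restrict g T)" by simp
qed

text \<open>
  Restriction is onto for any two scaling sets because lifts extend. Thus an isometry amounts to
  restriction preserving the pseudonorm.
\<close>

lemma independent_of_scaling_iff:
  "independent_of_scaling G N \<longleftrightarrow>
     (\<forall>T T'. scaling_set T \<and> scaling_set T' \<and> T \<subseteq> T' \<longrightarrow>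
        (\<forall>g\<in>carrier (dir_C G N T'). dir_C_norm G N T (restrict g T) = dir_C_norm G N T' g))"
proof -
  have "isometry (dir_cone G N T') (dir_cone_norm G N T') (dir_cone G N T) (dir_cone_norm G N T) (dir_restrict G N T)
      \<longleftrightarrow> (\<forall>g\<in>carrier (dir_C G N T'). dir_C_norm G N T (restrict g T) = dir_C_norm G N T' g)"
    if T: "scaling_set T" "scaling_set T'" "T \<subseteq> T'" for T T'
  proof -
    let ?R = "dir_restrict G N T" and ?C = "dir_C G N T" and ?C' = "dir_C G N T'"
    have dist: "norm_dist (dir_cone G N T) (dir_cone_norm G N T) (?R (dir_class G N T' g)) (?R (dir_class G N T' h))
          = dir_C_norm G N T (restrict (\<lambda>t\<in>T'. inv (g t) \<otimes> h t) T)"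
      if "g \<in> carrier ?C'" "h \<in> carrier ?C'" for g h
      using norm_dist_dir_cone[OF T(1) dir_C_restrict(1)[OF T that(1)] dir_C_restrict(1)[OF T that(2)]]
        dir_restrict_class[OF T] that restrict_quotient[OF T(3), of g h] by simp
    have closed: "?R \<in> carrier (dir_cone G N T') \<rightarrow> carrier (dir_cone G N T)"
      using dir_restrict_class[OF T] dir_C_restrict(1)[OF T] by (auto simp: carrier_dir_cone)
    have surj: "?R ` carrier (dir_cone G N T') = carrier (dir_cone G N T)"
    proof
      show "carrier (dir_cone G N T) \<subseteq> ?R ` carrier (dir_cone G N T')"
      proof
        fix X assume "X \<in> carrier (dir_cone G N T)"
        then obtain w where w: "w \<in> carrier (dir_D G N T)" "X = dir_class G N T (compose T (free_proj G) w)"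
          by (auto simp: carrier_dir_cone carrier_dir_C)
        obtain w' where w': "w' \<in> carrier (dir_D G N T')" "restrict w' T = w"
          using dir_D_extend[OF T w(1)] by blast
        let ?g = "compose T' (free_proj G) w'"
        have "?g \<in> carrier ?C'" using w'(1) by (simp add: carrier_dir_C)
        moreover have "X = ?R (dir_class G N T' ?g)"
          using dir_restrict_class[OF T] calculation w(2) w'(2) restrict_compose[OF T(3)] by metis
        ultimately show "X \<in> ?R ` carrier (dir_cone G N T')" by (auto simp: carrier_dir_cone)
      qed
    qed (use closed in blast)
    show ?thesis
    proof
      assume iso: "isometry (dir_cone G N T') (dir_cone_norm G N T') (dir_cone G N T) (dir_cone_norm G N T) ?R"
      show "\<forall>g\<in>carrier ?C'. dir_C_norm G N T (restrict g T) = dir_C_norm G N T' g"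
      proof
        fix g assume g: "g \<in> carrier ?C'"
        interpret C': pseudonormed_group ?C' "dir_C_norm G N T'" by (rule pseudonormed_dir_C[OF T(2)])
        have one: "\<one>\<^bsub>?C'\<^esub> \<in> carrier ?C'" by (rule C'.one_closed)
        have q: "(\<lambda>t\<in>T'. inv (\<one>\<^bsub>?C'\<^esub> t) \<otimes> g t) = g"
          using inv_mult_dir_C[OF T(2) one g] g by simp
        have "norm_dist (dir_cone G N T) (dir_cone_norm G N T) (?R (dir_class G N T' \<one>\<^bsub>?C'\<^esub>)) (?R (dir_class G N T' g))
            = norm_dist (dir_cone G N T') (dir_cone_norm G N T') (dir_class G N T' \<one>\<^bsub>?C'\<^esub>) (dir_class G N T' g)"
          using iso one g unfolding isometry_def isometric_embedding_def carrier_dir_cone by blast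
        then show "dir_C_norm G N T (restrict g T) = dir_C_norm G N T' g"
          unfolding dist[OF one g] norm_dist_dir_cone[OF T(2) one g] q .
      qed
    next
      assume eq: "\<forall>g\<in>carrier ?C'. dir_C_norm G N T (restrict g T) = dir_C_norm G N T' g"
      have isom: "norm_dist (dir_cone G N T) (dir_cone_norm G N T) (?R (dir_class G N T' g)) (?R (dir_class G N T' h))
          = norm_dist (dir_cone G N T') (dir_cone_norm G N T') (dir_class G N T' g) (dir_class G N T' h)"
        if "g \<in> carrier ?C'" "h \<in> carrier ?C'" for g h
        unfolding dist[OF that] norm_dist_dir_cone[OF T(2) that]
        using eq quotient_in_dir_C[OF T(2) that] by blast
      show "isometry (dir_cone G N T') (dir_cone_norm G N T') (dir_cone G N T) (dir_cone_norm G N T) ?R"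
        unfolding isometry_def isometric_embedding_def
      proof (intro conjI ballI closed surj)
        fix X Y assume "X \<in> carrier (dir_cone G N T')" "Y \<in> carrier (dir_cone G N T')"
        then obtain g h where gh: "g \<in> carrier ?C'" "h \<in> carrier ?C'"
          and XY: "X = dir_class G N T' g" "Y = dir_class G N T' h"
          unfolding carrier_dir_cone by blast
        show "norm_dist (dir_cone G N T) (dir_cone_norm G N T) (?R X) (?R Y)
            = norm_dist (dir_cone G N T') (dir_cone_norm G N T') X Y"
          unfolding XY by (rule isom[OF gh])
      qed
    qed
  qed
  then show ?thesis unfolding independent_of_scaling_def by (simp cong: imp_cong)
qed

end

section \<open>Ultrafilters on the natural numbers\<close>

lemma ultrafilter_le_sequentially:
  assumes "nonprincipal_ultrafilter \<omega>"
  shows "\<omega> \<le> sequentially"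
proof -
  have proper: "\<omega> \<noteq> bot" and ultra: "\<And>P. eventually P \<omega> \<or> eventually (\<lambda>n. \<not> P n) \<omega>"
    and free: "\<And>n. \<omega> \<noteq> principal {n}"
    using assms by (auto simp: nonprincipal_ultrafilter_def)
  have neq: "eventually (\<lambda>k. k \<noteq> n) \<omega>" for n
  proof (rule ccontr)
    assume "\<not> eventually (\<lambda>k. k \<noteq> n) \<omega>"
    then have n: "eventually (\<lambda>k. k = n) \<omega>" using ultra[of "\<lambda>k. k = n"] by blast
    have "eventually P \<omega> \<longleftrightarrow> P n" for P
    proof
      assume "eventually P \<omega>"
      with n have "eventually (\<lambda>k. k = n \<and> P k) \<omega>" by (rule eventually_conj)
      then show "P n" using eventually_happens'[OF proper] by fastforce
    qed (use n in \<open>auto elim: eventually_mono\<close>)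
    then have "\<omega> = principal {n}" by (simp add: filter_eq_iff eventually_principal)
    then show False using free by blast
  qed
  have ge: "eventually (\<lambda>k. m \<le> k) \<omega>" for m
  proof -
    have "eventually (\<lambda>k. \<forall>n\<in>{..<m}. k \<noteq> n) \<omega>"
      by (rule eventually_ball_finite) (use neq in auto)
    then show ?thesis by (rule eventually_mono) (auto simp: not_less[symmetric])
  qed
  show ?thesis
  proof (rule filter_leI)
    fix P assume "eventually P sequentially"
    then obtain m where "\<forall>k\<ge>m. P k" by (auto simp: eventually_sequentially)
    then show "eventually P \<omega>" using ge[of m] by (auto elim: eventually_mono)
  qed
qed

text \<open>
  A proper filter that is minimal below the cofinite filter decides every predicate, since
  otherwise it could be refined by one.
\<close>

lemma nonprincipal_ultrafilter_exists: "\<exists>\<omega>. nonprincipal_ultrafilter \<omega>"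
proof -
  define A where "A = {F :: nat filter. F \<noteq> bot \<and> F \<le> sequentially}"
  have "\<exists>M\<in>A. \<forall>F\<in>A. F \<le> M \<longrightarrow> F = M"
  proof (rule predicate_Zorn)
    show "partial_order_on A (relation_of (\<lambda>F F'. F' \<le> F) A)"
      by (rule partial_order_on_relation_ofI) auto
  next
    fix C assume "C \<in> Chains (relation_of (\<lambda>F F'. F' \<le> F) A)"
    then have C: "C \<subseteq> A" "\<And>F F'. \<lbrakk>F \<in> C; F' \<in> C\<rbrakk> \<Longrightarrow> F' \<le> F \<or> F \<le> F'"
      by (auto simp: Chains_def relation_of_def)
    show "\<exists>u\<in>A. \<forall>a\<in>C. u \<le> a"
    proof (cases "C = {}")
      case True
      then show ?thesis by (intro bexI[of _ sequentially]) (auto simp: A_def)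
    next
      case False
      have "Inf C \<noteq> bot"
        unfolding trivial_limit_def
      proof (subst eventually_Inf_base[OF False])
        fix F F' assume "F \<in> C" "F' \<in> C"
        then show "\<exists>x\<in>C. x \<le> inf F F'" using C(2)[of F F'] by (auto intro: bexI)
      qed (use C(1) in \<open>auto simp: A_def trivial_limit_def\<close>)
      moreover have "Inf C \<le> sequentially"
        using False C(1) by (auto simp: A_def intro: Inf_lower2)
      ultimately show ?thesis by (intro bexI[of _ "Inf C"]) (auto simp: A_def Inf_lower)
    qed
  qed
  then obtain M where M: "M \<noteq> bot" "M \<le> sequentially"
    and max: "\<And>F. \<lbrakk>F \<noteq> bot; F \<le> sequentially; F \<le> M\<rbrakk> \<Longrightarrow> F = M"
    by (auto simp: A_def)
  have "eventually P M \<or> eventually (\<lambda>n. \<not> P n) M" for P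
  proof (rule disjCI)
    assume "\<not> eventually (\<lambda>n. \<not> P n) M"
    then have "inf M (principal {n. P n}) \<noteq> bot"
      by (simp add: trivial_limit_def eventually_inf_principal)
    then have "inf M (principal {n. P n}) = M"
      using M(2) by (intro max) (auto intro: le_infI1)
    moreover have "eventually P (inf M (principal {n. P n}))"
      by (simp add: eventually_inf_principal)
    ultimately show "eventually P M" by simp
  qed
  moreover have "M \<noteq> principal {n}" for n
  proof
    assume "M = principal {n}"
    then have "eventually (\<lambda>k. Suc n \<le> k) (principal {n})"
      using M(2) eventually_ge_at_top[of "Suc n"] by (metis filter_leD)
    then show False by (simp add: eventually_principal)
  qed
  ultimately show ?thesis using M(1) by (auto simp: nonprincipal_ultrafilter_def)
qed

text \<open>
  The limit is the supremum of the numbers that are eventually below the function.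
\<close>

lemma ultrafilter_convergent:
  fixes f :: "nat \<Rightarrow> real"
  assumes "nonprincipal_ultrafilter \<omega>" "eventually (\<lambda>n. a \<le> f n) \<omega>" "eventually (\<lambda>n. f n \<le> b) \<omega>"
  shows "\<exists>l. (f \<longlongrightarrow> l) \<omega>"
proof -
  have proper: "\<omega> \<noteq> bot" and ultra: "\<And>P. eventually P \<omega> \<or> eventually (\<lambda>n. \<not> P n) \<omega>"
    using assms by (auto simp: nonprincipal_ultrafilter_def)
  define S where "S = {x. eventually (\<lambda>n. x \<le> f n) \<omega>}"
  have aS: "a \<in> S" using assms(2) by (simp add: S_def)
  have ub: "x \<le> b" if "x \<in> S" for x
  proof -
    have "eventually (\<lambda>n. x \<le> f n \<and> f n \<le> b) \<omega>"
      using that assms(3) by (auto simp: S_def intro: eventually_conj)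
    then show ?thesis using eventually_happens'[OF proper] by fastforce
  qed
  then have bdd: "bdd_above S" by (rule bdd_aboveI)
  have "(f \<longlongrightarrow> Sup S) \<omega>"
  proof (rule order_tendstoI)
    fix y assume "y < Sup S"
    then obtain x where "x \<in> S" "y < x" using less_cSup_iff[OF _ bdd] aS by blast
    then show "eventually (\<lambda>n. y < f n) \<omega>" by (auto simp: S_def elim: eventually_mono)
  next
    fix y assume "Sup S < y"
    then have "y \<notin> S" using cSup_upper[OF _ bdd] by force
    then have "eventually (\<lambda>n. \<not> y \<le> f n) \<omega>" using ultra[of "\<lambda>n. y \<le> f n"] by (simp add: S_def)
    then show "eventually (\<lambda>n. f n < y) \<omega>" by (simp add: not_le)
  qed
  then show ?thesis by blast
qed

context pseudonormed_group
begin

section \<open>Ultrafilter cones\<close>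

context
  fixes \<omega> :: "nat filter" and d :: "nat \<Rightarrow> real"
  assumes \<omega>: "nonprincipal_ultrafilter \<omega>" and d: "scaling_sequence d"
begin

abbreviation "bseqs \<equiv> bounded_seqs G N d"

definition ultra_norm :: "(nat \<Rightarrow> 'a) \<Rightarrow> real" where
  "ultra_norm g = Lim \<omega> (\<lambda>n. N (g n) / d n)"

lemma \<omega>_proper: "\<omega> \<noteq> bot"
  using \<omega> by (simp add: nonprincipal_ultrafilter_def)

lemma d_pos: "0 < d n"
  using d by (simp add: scaling_sequence_def)

lemma carrier_bseqs:
  "g \<in> carrier bseqs \<longleftrightarrow> (\<forall>n. g n \<in> carrier G) \<and> (\<exists>c. eventually (\<lambda>n. N (g n) / d n \<le> c) sequentially)"
proof -
  have "limsup (\<lambda>n. ereal (N (g n) / d n)) < \<infinity> \<longleftrightarrow> (\<exists>c. eventually (\<lambda>n. N (g n) / d n \<le> c) sequentially)"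
  proof
    assume "limsup (\<lambda>n. ereal (N (g n) / d n)) < \<infinity>"
    then obtain c where "limsup (\<lambda>n. ereal (N (g n) / d n)) < ereal c"
      using less_PInf_Ex_of_nat[of "limsup (\<lambda>n. ereal (N (g n) / d n))"] by auto
    then have "eventually (\<lambda>n. ereal (N (g n) / d n) < ereal c) sequentially"
      by (rule Limsup_lessD)
    then show "\<exists>c. eventually (\<lambda>n. N (g n) / d n \<le> c) sequentially"
      by (auto intro!: exI[of _ c] elim: eventually_mono)
  next
    assume "\<exists>c. eventually (\<lambda>n. N (g n) / d n \<le> c) sequentially"
    then obtain c where "eventually (\<lambda>n. ereal (N (g n) / d n) \<le> ereal c) sequentially" by auto
    then have "limsup (\<lambda>n. ereal (N (g n) / d n)) \<le> ereal c" by (rule Limsup_bounded)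
    then show "limsup (\<lambda>n. ereal (N (g n) / d n)) < \<infinity>" by (rule le_less_trans) simp
  qed
  then show ?thesis by (auto simp: bounded_seqs_def)
qed

lemma ultra_norm_tendsto:
  assumes "g \<in> carrier bseqs"
  shows "((\<lambda>n. N (g n) / d n) \<longlongrightarrow> ultra_norm g) \<omega>"
proof -
  obtain c where c: "eventually (\<lambda>n. N (g n) / d n \<le> c) sequentially" and g: "\<And>n. g n \<in> carrier G"
    using assms by (auto simp: carrier_bseqs)
  have "\<exists>l. ((\<lambda>n. N (g n) / d n) \<longlongrightarrow> l) \<omega>"
    by (rule ultrafilter_convergent[OF \<omega> _ filter_leD[OF ultrafilter_le_sequentially[OF \<omega>] c], of 0])
      (simp add: g norm_nonneg d_pos less_imp_le)
  then obtain l where "((\<lambda>n. N (g n) / d n) \<longlongrightarrow> l) \<omega>" ..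
  then show ?thesis using tendsto_Lim[OF \<omega>_proper, of "\<lambda>n. N (g n) / d n" l] by (simp add: ultra_norm_def)
qed

lemma ultra_norm_eqI: "((\<lambda>n. N (g n) / d n) \<longlongrightarrow> l) \<omega> \<Longrightarrow> ultra_norm g = l"
  unfolding ultra_norm_def by (rule tendsto_Lim[OF \<omega>_proper])

lemma subgroup_bseqs: "subgroup (carrier bseqs) (product_group UNIV (\<lambda>_. G))"
proof -
  have grp: "group (product_group UNIV (\<lambda>_. G))" by (simp add: group_axioms)
  show ?thesis
  proof (rule group.subgroupI[OF grp])
    show "carrier bseqs \<subseteq> carrier (product_group UNIV (\<lambda>_. G))"
      by (auto simp: carrier_bseqs)
    have "(\<lambda>_. \<one>) \<in> carrier bseqs"
      by (auto simp: carrier_bseqs norm_one)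
    then show "carrier bseqs \<noteq> {}" by blast
  next
    fix g assume g: "g \<in> carrier bseqs"
    then show "inv\<^bsub>product_group UNIV (\<lambda>_. G)\<^esub> g \<in> carrier bseqs"
      by (subst inv_product_group) (auto simp: carrier_bseqs norm_inv group_axioms)
    fix h assume h: "h \<in> carrier bseqs"
    obtain b c where b: "eventually (\<lambda>n. N (g n) / d n \<le> b) sequentially"
      and c: "eventually (\<lambda>n. N (h n) / d n \<le> c) sequentially"
      using g h by (auto simp: carrier_bseqs)
    have cl: "g n \<in> carrier G" "h n \<in> carrier G" for n using g h by (auto simp: carrier_bseqs)
    have le: "N (g n \<otimes> h n) / d n \<le> N (g n) / d n + N (h n) / d n" for n
      using norm_mult[OF cl(1)[of n] cl(2)[of n]] d_pos[of n]
      by (simp add: divide_right_mono flip: add_divide_distrib)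
    have "eventually (\<lambda>n. N (g n \<otimes> h n) / d n \<le> b + c) sequentially"
      using b c
    proof eventually_elim
      case (elim n)
      then show ?case using le[of n] by linarith
    qed
    then show "g \<otimes>\<^bsub>product_group UNIV (\<lambda>_. G)\<^esub> h \<in> carrier bseqs"
      using cl by (auto simp: carrier_bseqs)
  qed
qed

lemma bseqs_eq: "bseqs = (product_group UNIV (\<lambda>_. G))\<lparr>carrier := carrier bseqs\<rparr>"
  by (simp add: bounded_seqs_def)

lemma mult_bseqs: "g \<otimes>\<^bsub>bseqs\<^esub> h = (\<lambda>n. g n \<otimes> h n)"
  by (simp add: bounded_seqs_def restrict_def)

lemma inv_bseqs: "g \<in> carrier bseqs \<Longrightarrow> inv\<^bsub>bseqs\<^esub> g = (\<lambda>n. inv (g n))"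
proof -
  assume g: "g \<in> carrier bseqs"
  have grp: "group (product_group UNIV (\<lambda>_. G))" by (simp add: group_axioms)
  have "inv\<^bsub>bseqs\<^esub> g = inv\<^bsub>product_group UNIV (\<lambda>_. G)\<^esub> g"
    using group.m_inv_consistent[OF grp subgroup_bseqs g] by (subst bseqs_eq)
  also have "\<dots> = (\<lambda>n. inv (g n))"
    using g by (subst inv_product_group) (auto simp: carrier_bseqs group_axioms)
  finally show ?thesis .
qed

lemma pseudonormed_bseqs: "pseudonormed_group bseqs ultra_norm"
proof -
  have grp: "group bseqs"
    using group.subgroup_imp_group[OF _ subgroup_bseqs] group_axioms by (subst bseqs_eq) simp
  interpret B: group bseqs by (rule grp)
  have le: "ultra_norm g \<le> c"
    if "g \<in> carrier bseqs" "\<And>n. N (g n) / d n \<le> f n" "(f \<longlongrightarrow> c) \<omega>" for g f c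
    by (rule tendsto_le[OF \<omega>_proper that(3) ultra_norm_tendsto[OF that(1)]]) (simp add: that(2))
  have cl: "g n \<in> carrier G" if "g \<in> carrier bseqs" for g n using that by (auto simp: carrier_bseqs)
  show ?thesis
  proof (rule pseudonormed_groupI[OF grp])
    have "\<one>\<^bsub>bseqs\<^esub> = (\<lambda>_. \<one>)" by (simp add: bounded_seqs_def restrict_def)
    then show "ultra_norm \<one>\<^bsub>bseqs\<^esub> \<le> 0"
      using ultra_norm_eqI[of "\<lambda>_. \<one>" 0] by (simp add: norm_one)
  next
    fix g assume g: "g \<in> carrier bseqs"
    show "0 \<le> ultra_norm g"
      by (rule tendsto_lowerbound[OF ultra_norm_tendsto[OF g] _ \<omega>_proper])
        (simp add: cl[OF g] norm_nonneg d_pos less_imp_le)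
    show "ultra_norm (inv\<^bsub>bseqs\<^esub> g) \<le> ultra_norm g"
      by (rule le[OF _ _ ultra_norm_tendsto[OF g]]) (use B.inv_closed[OF g] in \<open>simp_all add: g inv_bseqs norm_inv cl\<close>)
    fix h assume h: "h \<in> carrier bseqs"
    show "ultra_norm (g \<otimes>\<^bsub>bseqs\<^esub> h) \<le> ultra_norm g + ultra_norm h"
    proof (rule le[OF _ _ tendsto_add[OF ultra_norm_tendsto[OF g] ultra_norm_tendsto[OF h]]])
      fix n
      show "N ((g \<otimes>\<^bsub>bseqs\<^esub> h) n) / d n \<le> N (g n) / d n + N (h n) / d n"
        using norm_mult[OF cl[OF g, of n] cl[OF h, of n]] d_pos[of n]
        by (simp add: mult_bseqs divide_right_mono flip: add_divide_distrib)
    qed (simp add: g h)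
    show "ultra_norm (h \<otimes>\<^bsub>bseqs\<^esub> g \<otimes>\<^bsub>bseqs\<^esub> inv\<^bsub>bseqs\<^esub> h) \<le> ultra_norm g"
      by (rule le[OF _ _ ultra_norm_tendsto[OF g]])
        (use B.m_closed[OF B.m_closed[OF h g] B.inv_closed[OF h]] in
          \<open>simp_all add: g h inv_bseqs mult_bseqs norm_conj cl\<close>)
  qed
qed

lemma ultra_class_eq_coset:
  assumes "g \<in> carrier bseqs"
  shows "ultra_rel G N \<omega> d `` {g} = pseudonormed_group.null bseqs ultra_norm #>\<^bsub>bseqs\<^esub> g"
proof -
  interpret B: pseudonormed_group bseqs ultra_norm by (rule pseudonormed_bseqs)
  show ?thesis
    using assms by (auto simp: ultra_rel_def B.mem_coset_iff ultra_norm_def mult_bseqs inv_bseqs)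
qed

text \<open>
  The ultrafilter cone is defined by an equivalence relation; its classes are the cosets of the
  sequences of norm zero, which makes the facts on quotients of pseudonormed groups applicable.
\<close>

lemma ultra_cone_eq_Mod: "ultra_cone G N \<omega> d = bseqs Mod pseudonormed_group.null bseqs ultra_norm"
proof -
  interpret B: pseudonormed_group bseqs ultra_norm by (rule pseudonormed_bseqs)
  have "carrier bseqs // ultra_rel G N \<omega> d = rcosets\<^bsub>bseqs\<^esub> B.null"
    by (simp add: quotient_def RCOSETS_def ultra_class_eq_coset)
  moreover have "ultra_rel G N \<omega> d `` {\<one>\<^bsub>bseqs\<^esub>} = B.null"
    using B.coset_mult_one[of B.null] by (simp add: ultra_class_eq_coset B.null_def subset_iff)
  ultimately show ?thesis by (simp add: ultra_cone_def FactGroup_def)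
qed

lemma ultra_class_eq_iff:
  assumes "g \<in> carrier bseqs" "h \<in> carrier bseqs"
  shows "ultra_rel G N \<omega> d `` {g} = ultra_rel G N \<omega> d `` {h} \<longleftrightarrow>
    ((\<lambda>n. N (inv (g n) \<otimes> h n) / d n) \<longlongrightarrow> 0) \<omega>"
proof -
  interpret B: pseudonormed_group bseqs ultra_norm by (rule pseudonormed_bseqs)
  let ?k = "\<lambda>n. inv (g n) \<otimes> h n"
  have k: "inv\<^bsub>bseqs\<^esub> g \<otimes>\<^bsub>bseqs\<^esub> h = ?k" using assms(1) by (simp add: inv_bseqs mult_bseqs)
  then have kB: "?k \<in> carrier bseqs" using assms by (metis B.inv_closed B.m_closed)
  have "ultra_rel G N \<omega> d `` {g} = ultra_rel G N \<omega> d `` {h} \<longleftrightarrow> ultra_norm ?k = 0"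
    using B.coset_eq_iff[OF assms] by (simp add: ultra_class_eq_coset[OF assms(1)] ultra_class_eq_coset[OF assms(2)] k)
  also have "\<dots> \<longleftrightarrow> ((\<lambda>n. N (?k n) / d n) \<longlongrightarrow> 0) \<omega>"
    using ultra_norm_tendsto[OF kB] ultra_norm_eqI[of ?k 0] by auto
  finally show ?thesis .
qed

lemma norm_dist_ultra_cone:
  assumes "g \<in> carrier bseqs" "h \<in> carrier bseqs"
  shows "norm_dist (ultra_cone G N \<omega> d) (ultra_cone_norm G N \<omega> d) (ultra_rel G N \<omega> d `` {g}) (ultra_rel G N \<omega> d `` {h})
    = ultra_norm (\<lambda>n. inv (g n) \<otimes> h n)"
proof -
  interpret B: pseudonormed_group bseqs ultra_norm by (rule pseudonormed_bseqs)
  let ?k = "\<lambda>n. inv (g n) \<otimes> h n"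
  have k: "inv\<^bsub>bseqs\<^esub> g \<otimes>\<^bsub>bseqs\<^esub> h = ?k" using assms(1) by (simp add: inv_bseqs mult_bseqs)
  then have kB: "?k \<in> carrier bseqs" using assms by (metis B.inv_closed B.m_closed)
  have "inv\<^bsub>ultra_cone G N \<omega> d\<^esub> (ultra_rel G N \<omega> d `` {g}) \<otimes>\<^bsub>ultra_cone G N \<omega> d\<^esub> (ultra_rel G N \<omega> d `` {h})
      = B.null #>\<^bsub>bseqs\<^esub> ?k"
    unfolding ultra_cone_eq_Mod ultra_class_eq_coset[OF assms(1)] ultra_class_eq_coset[OF assms(2)]
      B.inv_mult_Mod_null[OF assms] k ..
  moreover have "ultra_cone_norm G N \<omega> d (B.null #>\<^bsub>bseqs\<^esub> ?k) = ultra_norm ?k"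
    using B.norm_coset[OF kB] by (simp add: ultra_cone_norm_def ultra_norm_def[abs_def])
  ultimately show ?thesis by (simp add: norm_dist_def)
qed

lemma filterlim_scaling_sequence: "filterlim d (at_top_in {0<..}) sequentially"
  using d by (auto simp: scaling_sequence_def filterlim_inf filterlim_principal)

lemma filterlim_scaling_ultra: "filterlim d (at_top_in {0<..}) \<omega>"
  by (rule filterlim_mono[OF filterlim_scaling_sequence order_refl ultrafilter_le_sequentially[OF \<omega>]])

end

section \<open>From the directional cone to the ultrafilter cone\<close>

lemma scaling_set_positive: "scaling_set {0<..}"
proof -
  have "\<not> (\<forall>x\<in>{0<..}. x \<le> M)" for M :: real
    by (auto intro!: bexI[of _ "max 1 (M + 1)"])
  then show ?thesis by (auto simp: scaling_set_def bdd_above_def)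
qed

text \<open>
  The converse of \<open>dir_C_null_if_sublinear\<close>. Together they say that the elements of norm zero
  are the functions of sublinear growth.
\<close>

lemma dir_C_sublinear_if_null:
  assumes T: "scaling_set T" and g: "g \<in> carrier (dir_C G N T)" "dir_C_norm G N T g = 0"
  shows "((\<lambda>t. N (g t) / t) \<longlongrightarrow> 0) (at_top_in T)"
proof (rule order_tendstoI)
  fix a :: real assume "a < 0"
  have "0 \<le> N (g t) / t" if "t \<in> T" for t
    using T that PiE_mem[OF dir_C_subset[OF g(1)] that] by (auto simp: scaling_set_def norm_nonneg)
  then show "eventually (\<lambda>t. a < N (g t) / t) (at_top_in T)"
    using \<open>a < 0\<close> by (intro eventually_mono[OF eventually_in_scaling_set]) force
next
  fix a :: real assume "0 < a"
  then show "eventually (\<lambda>t. N (g t) / t < a) (at_top_in T)"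
    using dir_C_growth[OF T g(1), of a] g(2) by simp
qed

lemma sample_in_bseqs:
  assumes "nonprincipal_ultrafilter \<omega>" and d: "scaling_sequence d" and g: "g \<in> carrier (dir_C G N {0<..})"
  shows "(\<lambda>n. g (d n)) \<in> carrier (bounded_seqs G N d)"
proof -
  have "eventually (\<lambda>t. N (g t) / t < dir_C_norm G N {0<..} g + 1) (at_top_in {0<..})"
    by (rule dir_C_growth[OF scaling_set_positive g]) simp
  then have "eventually (\<lambda>n. N (g (d n)) / d n < dir_C_norm G N {0<..} g + 1) sequentially"
    using filterlim_scaling_sequence[OF assms(1) d] by (rule eventually_compose_filterlim)
  moreover have "g (d n) \<in> carrier G" for n
    using PiE_mem[OF dir_C_subset[OF g], of "d n"] d by (simp add: scaling_sequence_def)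
  ultimately show ?thesis
    unfolding carrier_bseqs[OF assms(1) d] by (auto elim: eventually_mono intro!: exI[of _ "dir_C_norm G N {0<..} g + 1"])
qed

text \<open>
  The sampled sequences of two representatives are equivalent because the quotient of the
  representatives grows sublinearly.
\<close>

lemma rho_class:
  assumes \<omega>: "nonprincipal_ultrafilter \<omega>" and d: "scaling_sequence d" and g: "g \<in> carrier (dir_C G N {0<..})"
  shows "rho G N \<omega> d (dir_class G N {0<..} g) = ultra_rel G N \<omega> d `` {\<lambda>n. g (d n)}"
  unfolding rho_def
proof (rule on_dir_class[OF scaling_set_positive g])
  let ?T = "{0::real<..}"
  fix h assume h: "h \<in> carrier (dir_C G N ?T)" "dir_C_norm G N ?T (\<lambda>t\<in>?T. inv (g t) \<otimes> h t) = 0"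
  have "((\<lambda>t. N ((\<lambda>t\<in>?T. inv (g t) \<otimes> h t) t) / t) \<longlongrightarrow> 0) (at_top_in ?T)"
    by (rule dir_C_sublinear_if_null[OF scaling_set_positive quotient_in_dir_C[OF scaling_set_positive g h(1)] h(2)])
  from filterlim_compose[OF this filterlim_scaling_ultra[OF \<omega> d]]
  have "((\<lambda>n. N (inv (g (d n)) \<otimes> h (d n)) / d n) \<longlongrightarrow> 0) \<omega>"
    using d by (simp add: scaling_sequence_def)
  then have "ultra_rel G N \<omega> d `` {\<lambda>n. g (d n)} = ultra_rel G N \<omega> d `` {\<lambda>n. h (d n)}"
    using ultra_class_eq_iff[OF \<omega> d sample_in_bseqs[OF \<omega> d g] sample_in_bseqs[OF \<omega> d h(1)]] by simp
  then show "ultra_rel G N \<omega> d `` {\<lambda>n. h (d n)} = ultra_rel G N \<omega> d `` {\<lambda>n. g (d n)}" by simp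
qed

end

context pseudonormed_group
begin

section \<open>Independence of scaling and injectivity\<close>

lemma sample_tendsto:
  assumes "nonprincipal_ultrafilter \<omega>" "scaling_sequence d"
    and "g \<in> carrier (dir_C G N {0<..})" "h \<in> carrier (dir_C G N {0<..})"
    and "rho G N \<omega> d (dir_class G N {0<..} g) = rho G N \<omega> d (dir_class G N {0<..} h)"
  shows "((\<lambda>n. N (inv (g (d n)) \<otimes> h (d n)) / d n) \<longlongrightarrow> 0) \<omega>"
  using assms(5) ultra_class_eq_iff[OF assms(1,2) sample_in_bseqs[OF assms(1-3)] sample_in_bseqs[OF assms(1,2,4)]]
  by (simp add: rho_class[OF assms(1,2)] assms(3,4))

text \<open>
  A limit along the ultrafilter is a limit along some unbounded set of sampling points: pick points
  at which the values are smaller and smaller.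
\<close>

lemma sublinear_along_scaling_set:
  assumes \<omega>: "nonprincipal_ultrafilter \<omega>" and d: "scaling_sequence d"
    and lim: "((\<lambda>n. f (d n)) \<longlongrightarrow> (0::real)) \<omega>"
  shows "\<exists>T\<subseteq>{0<..}. scaling_set T \<and> (f \<longlongrightarrow> 0) (at_top_in T)"
proof -
  have "\<exists>n\<ge>m. \<bar>f (d n)\<bar> < 1 / real (Suc m)" for m
  proof -
    have "eventually (\<lambda>n. \<bar>f (d n)\<bar> < 1 / real (Suc m)) \<omega>"
      using tendstoD[OF lim, of "1 / real (Suc m)"] by (simp add: dist_real_def)
    moreover have "eventually (\<lambda>n. m \<le> n) \<omega>"
      by (rule filter_leD[OF ultrafilter_le_sequentially[OF \<omega>] eventually_ge_at_top])
    ultimately have "eventually (\<lambda>n. m \<le> n \<and> \<bar>f (d n)\<bar> < 1 / real (Suc m)) \<omega>"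
      by (simp add: eventually_conj_iff)
    then show ?thesis using eventually_happens' \<omega> unfolding nonprincipal_ultrafilter_def by blast
  qed
  then obtain n where n: "\<And>m. m \<le> n m" "\<And>m. \<bar>f (d (n m))\<bar> < 1 / real (Suc m)" by metis
  have lim_n: "filterlim (\<lambda>m. d (n m)) at_top sequentially"
  proof (rule filterlim_compose[where g = d and f = n])
    show "filterlim d at_top sequentially" using d by (simp add: scaling_sequence_def)
    show "filterlim n sequentially sequentially"
      by (rule filterlim_at_top_mono[OF filterlim_ident]) (simp add: n(1))
  qed
  define T where "T = range (\<lambda>m. d (n m))"
  have pos: "T \<subseteq> {0<..}" using d by (auto simp: T_def scaling_sequence_def)
  have "\<not> (\<forall>t\<in>T. t \<le> M)" for M
  proof -
    have "eventually (\<lambda>m. M < d (n m)) sequentially"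
      using lim_n by (simp add: filterlim_at_top_dense)
    then obtain m where "M < d (n m)" using eventually_happens' sequentially_bot by blast
    then show ?thesis by (auto simp: T_def intro!: exI[of _ m])
  qed
  then have sc: "scaling_set T" using pos by (auto simp: scaling_set_def bdd_above_def)
  have "(f \<longlongrightarrow> 0) (at_top_in T)"
  proof (rule tendstoI)
    fix e :: real assume "0 < e"
    then obtain M where M: "1 / real (Suc M) < e" using nat_approx_posE by metis
    \<comment> \<open>Beyond \<open>t0\<close> only points with index at least \<open>M\<close> remain.\<close>
    define t0 where "t0 = Max (insert 0 ((\<lambda>m. d (n m)) ` {..<M})) + 1"
    have "dist (f t) 0 < e" if t: "t \<in> T" "t0 \<le> t" for t
    proof -
      obtain m where m: "t = d (n m)" using t(1) by (auto simp: T_def)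
      have "M \<le> m"
      proof (rule ccontr)
        assume "\<not> M \<le> m"
        then have "t \<le> Max (insert 0 ((\<lambda>m. d (n m)) ` {..<M}))"
          unfolding m by (intro Max_ge) auto
        then show False using t(2) by (simp add: t0_def)
      qed
      then have "1 / real (Suc m) \<le> 1 / real (Suc M)" by (simp add: frac_le)
      then show ?thesis using n(2)[of m] M by (simp add: m dist_real_def)
    qed
    then show "eventually (\<lambda>t. dist (f t) 0 < e) (at_top_in T)"
      unfolding eventually_at_top_in by blast
  qed
  then show ?thesis using sc pos by blast
qed

text \<open>
  If the images of two classes agree, then their quotient \<open>k\<close> grows sublinearly along some
  scaling set. Hence the restriction of \<open>k\<close> to that set has norm zero, and by independence so
  has \<open>k\<close>.
\<close>

lemma independent_imp_injective:
  assumes ind: "independent_of_scaling G N" and \<omega>: "nonprincipal_ultrafilter \<omega>" and d: "scaling_sequence d"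
  shows "inj_on (rho G N \<omega> d) (carrier (dir_cone G N {0<..}))"
proof (rule inj_onI)
  let ?T = "{0::real<..}"
  fix X Y assume "X \<in> carrier (dir_cone G N ?T)" "Y \<in> carrier (dir_cone G N ?T)"
    and eq: "rho G N \<omega> d X = rho G N \<omega> d Y"
  then obtain g h where g: "g \<in> carrier (dir_C G N ?T)" and h: "h \<in> carrier (dir_C G N ?T)"
    and XY: "X = dir_class G N ?T g" "Y = dir_class G N ?T h"
    unfolding carrier_dir_cone by blast
  define k where "k = (\<lambda>t\<in>?T. inv (g t) \<otimes> h t)"
  have k: "k \<in> carrier (dir_C G N ?T)" unfolding k_def by (rule quotient_in_dir_C[OF scaling_set_positive g h])
  have "((\<lambda>n. N (inv (g (d n)) \<otimes> h (d n)) / d n) \<longlongrightarrow> 0) \<omega>"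
    by (rule sample_tendsto[OF \<omega> d g h eq[unfolded XY]])
  then have "((\<lambda>n. N (k (d n)) / d n) \<longlongrightarrow> 0) \<omega>"
    using d by (simp add: k_def scaling_sequence_def)
  then obtain S where S: "S \<subseteq> ?T" "scaling_set S" "((\<lambda>t. N (k t) / t) \<longlongrightarrow> 0) (at_top_in S)"
    using sublinear_along_scaling_set[OF \<omega> d, of "\<lambda>t. N (k t) / t"] by blast
  have "((\<lambda>t. N (restrict k S t) / t) \<longlongrightarrow> 0) (at_top_in S)"
    by (rule Lim_transform_eventually[OF S(3)], rule eventually_mono[OF eventually_in_scaling_set]) simp
  moreover have "restrict k S \<in> (\<Pi>\<^sub>E t\<in>S. carrier G)"
    using dir_C_subset[OF dir_C_restrict(1)[OF S(2) scaling_set_positive S(1) k]] .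
  ultimately have "dir_C_norm G N S (restrict k S) = 0"
    using dir_C_null_if_sublinear[OF S(2)] by blast
  then have "dir_C_norm G N ?T k = 0"
    using ind k S scaling_set_positive unfolding independent_of_scaling_iff by metis
  then show "X = Y"
    unfolding XY k_def by (simp add: dir_class_eq_iff[OF scaling_set_positive g h])
qed

lemma scaling_sequence_in:
  assumes "scaling_set T" shows "\<exists>d. scaling_sequence d \<and> (\<forall>n. d n \<in> T)"
proof -
  have "\<exists>t\<in>T. real n \<le> t" for n
    using assms unfolding scaling_set_def bdd_above_def by (meson linear)
  then obtain d where d: "\<And>n. d n \<in> T" "\<And>n. real n \<le> d n" by metis
  have "filterlim d at_top sequentially"
    by (rule filterlim_at_top_mono[OF filterlim_real_sequentially]) (simp add: d)
  moreover have "0 < d n" for n using assms d(1)[of n] by (auto simp: scaling_set_def)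
  ultimately have "scaling_sequence d" by (simp add: scaling_sequence_def)
  then show ?thesis using d(1) by blast
qed

text \<open>
  Let \<open>w\<close> lift the restriction of \<open>g\<close> to \<open>T\<close>. Extend \<open>w\<close> to all positive reals. The
  projection \<open>h\<close> of the extension agrees with \<open>g\<close> on \<open>T\<close>, so sampling both along a
  sequence in \<open>T\<close> gives the same element of an ultrafilter cone. By injectivity
  \<open>g\<close> and \<open>h\<close> define the same class, so the norm of \<open>g\<close> is at most that of \<open>w\<close>. An
  arbitrary scaling set in place of the positive reals is treated by extending a lift once more.
\<close>

lemma injective_imp_independent:
  assumes inj: "\<And>\<omega> d. \<lbrakk>nonprincipal_ultrafilter \<omega>; scaling_sequence d\<rbrakk>
                  \<Longrightarrow> inj_on (rho G N \<omega> d) (carrier (dir_cone G N {0<..}))"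
  shows "independent_of_scaling G N"
proof -
  let ?P = "{0::real<..}"
  have from_P: "dir_C_norm G N T (restrict g T) = dir_C_norm G N ?P g"
    if T: "scaling_set T" and g: "g \<in> carrier (dir_C G N ?P)" for T g
  proof (rule antisym)
    have sub: "T \<subseteq> ?P" using T by (simp add: scaling_set_def)
    show "dir_C_norm G N T (restrict g T) \<le> dir_C_norm G N ?P g"
      by (rule dir_C_restrict(2)[OF T scaling_set_positive sub g])
    show "dir_C_norm G N ?P g \<le> dir_C_norm G N T (restrict g T)"
    proof (rule dir_C_norm_greatest[OF T dir_C_restrict(1)[OF T scaling_set_positive sub g]])
      fix w assume w: "w \<in> carrier (dir_D G N T)" "compose T (free_proj G) w = restrict g T"
      obtain w' where w': "w' \<in> carrier (dir_D G N ?P)" "restrict w' T = w"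
        using dir_D_extend[OF T scaling_set_positive sub w(1)] by blast
      define h where "h = compose ?P (free_proj G) w'"
      have h: "h \<in> carrier (dir_C G N ?P)" using w'(1) by (auto simp: h_def carrier_dir_C)
      have hg: "restrict h T = restrict g T"
        using restrict_compose[OF sub, of "free_proj G" w'] w(2) w'(2) by (simp add: h_def)
      obtain \<omega> where \<omega>: "nonprincipal_ultrafilter \<omega>" using nonprincipal_ultrafilter_exists by blast
      obtain d where d: "scaling_sequence d" "\<And>n. d n \<in> T" using scaling_sequence_in[OF T] by blast
      have "g (d n) = h (d n)" for n using fun_cong[OF hg, of "d n"] d(2)[of n] by simp
      then have "rho G N \<omega> d (dir_class G N ?P g) = rho G N \<omega> d (dir_class G N ?P h)"
        by (simp add: rho_class[OF \<omega> d(1)] g h)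
      then have "dir_class G N ?P g = dir_class G N ?P h"
        by (rule inj_onD[OF inj[OF \<omega> d(1)]]) (use g h in \<open>auto simp: carrier_dir_cone\<close>)
      then have "dir_C_norm G N ?P g = dir_C_norm G N ?P h"
        using dir_cone_norm_class[OF scaling_set_positive g] dir_cone_norm_class[OF scaling_set_positive h] by simp
      also have "\<dots> \<le> dir_D_norm G N ?P w'"
        by (rule dir_C_norm_le[OF scaling_set_positive w'(1)]) (simp add: h_def)
      also have "\<dots> = dir_D_norm G N T w"
        using dir_D_restrict(2)[OF T scaling_set_positive sub w'(1)] w'(2) by simp
      finally show "dir_C_norm G N ?P g \<le> dir_D_norm G N T w" .
    qed
  qed
  show ?thesis
    unfolding independent_of_scaling_iff
  proof (intro allI impI ballI)
    fix T T' g assume T: "scaling_set T \<and> scaling_set T' \<and> T \<subseteq> T'" and g: "g \<in> carrier (dir_C G N T')"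
    then obtain w where w: "w \<in> carrier (dir_D G N T')" "g = compose T' (free_proj G) w"
      by (auto simp: carrier_dir_C)
    have sub: "T' \<subseteq> ?P" using T by (simp add: scaling_set_def)
    obtain w' where w': "w' \<in> carrier (dir_D G N ?P)" "restrict w' T' = w"
      using dir_D_extend[OF _ scaling_set_positive sub w(1)] T by blast
    define h where "h = compose ?P (free_proj G) w'"
    have h: "h \<in> carrier (dir_C G N ?P)" using w'(1) by (auto simp: h_def carrier_dir_C)
    have gh: "g = restrict h T'"
      using restrict_compose[OF sub, of "free_proj G" w'] w(2) w'(2) by (simp add: h_def)
    have "restrict g T = restrict h T" using T by (auto simp: gh fun_eq_iff)
    then have "dir_C_norm G N T (restrict g T) = dir_C_norm G N ?P h"
      using from_P[of T h] T h by simp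
    also have "\<dots> = dir_C_norm G N T' g"
      using from_P[of T' h] T h gh by simp
    finally show "dir_C_norm G N T (restrict g T) = dir_C_norm G N T' g" .
  qed
qed

lemma rho_isometric_embedding:
  assumes lim: "\<forall>g\<in>carrier (dir_C G N {0<..}).
       ((\<lambda>t. (1 / t) * N (g t)) \<longlongrightarrow> dir_cone_norm G N {0<..} (dir_class G N {0<..} g)) at_top"
    and \<omega>: "nonprincipal_ultrafilter \<omega>" and d: "scaling_sequence d"
  shows "isometric_embedding (dir_cone G N {0<..}) (dir_cone_norm G N {0<..})
           (ultra_cone G N \<omega> d) (ultra_cone_norm G N \<omega> d) (rho G N \<omega> d)"
  unfolding isometric_embedding_def
proof (intro conjI ballI Pi_I)
  let ?T = "{0::real<..}"
  fix X assume "X \<in> carrier (dir_cone G N ?T)"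
  then obtain g where g: "g \<in> carrier (dir_C G N ?T)" and X: "X = dir_class G N ?T g"
    unfolding carrier_dir_cone by blast
  show "rho G N \<omega> d X \<in> carrier (ultra_cone G N \<omega> d)"
    using sample_in_bseqs[OF \<omega> d g] by (simp add: X rho_class[OF \<omega> d g] ultra_cone_def quotientI)
  fix Y assume "Y \<in> carrier (dir_cone G N ?T)"
  then obtain h where h: "h \<in> carrier (dir_C G N ?T)" and Y: "Y = dir_class G N ?T h"
    unfolding carrier_dir_cone by blast
  define k where "k = (\<lambda>t\<in>?T. inv (g t) \<otimes> h t)"
  have k: "k \<in> carrier (dir_C G N ?T)" unfolding k_def by (rule quotient_in_dir_C[OF scaling_set_positive g h])
  have "((\<lambda>t. (1 / t) * N (k t)) \<longlongrightarrow> dir_C_norm G N ?T k) at_top"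
    using bspec[OF lim k] unfolding dir_cone_norm_class[OF scaling_set_positive k] .
  moreover have "filterlim d at_top \<omega>"
    by (rule filterlim_mono[OF _ order_refl ultrafilter_le_sequentially[OF \<omega>]])
      (use d in \<open>simp add: scaling_sequence_def\<close>)
  ultimately have "((\<lambda>n. (1 / d n) * N (k (d n))) \<longlongrightarrow> dir_C_norm G N ?T k) \<omega>"
    by (rule filterlim_compose)
  then have "((\<lambda>n. N (inv (g (d n)) \<otimes> h (d n)) / d n) \<longlongrightarrow> dir_C_norm G N ?T k) \<omega>"
    using d by (simp add: k_def scaling_sequence_def)
  then have "ultra_norm \<omega> d (\<lambda>n. inv (g (d n)) \<otimes> h (d n)) = dir_C_norm G N ?T k"
    by (rule ultra_norm_eqI[OF \<omega> d])
  then show "norm_dist (ultra_cone G N \<omega> d) (ultra_cone_norm G N \<omega> d) (rho G N \<omega> d X) (rho G N \<omega> d Y)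
      = norm_dist (dir_cone G N ?T) (dir_cone_norm G N ?T) X Y"
    unfolding X Y rho_class[OF \<omega> d g] rho_class[OF \<omega> d h]
    by (simp add: norm_dist_ultra_cone[OF \<omega> d sample_in_bseqs[OF \<omega> d g] sample_in_bseqs[OF \<omega> d h]]
        norm_dist_dir_cone[OF scaling_set_positive g h] k_def)
qed

end

theorem theorem9p3:
  fixes G :: "('a, 'b) monoid_scheme" and N :: "'a \<Rightarrow> real"
  assumes "group G" and "conj_inv_norm G N"
  shows "(independent_of_scaling G N \<longleftrightarrow>
            (\<forall>\<omega> d. nonprincipal_ultrafilter \<omega> \<and> scaling_sequence d \<longrightarrow>
                   inj_on (rho G N \<omega> d) (carrier (dir_cone G N {0<..})))) \<and>
         ((\<forall>g \<in> carrier (dir_C G N {0<..}).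
             ((\<lambda>t. (1 / t) * N (g t)) \<longlongrightarrow> dir_cone_norm G N {0<..} (dir_class G N {0<..} g)) at_top) \<longrightarrow>
          (\<forall>\<omega> d. nonprincipal_ultrafilter \<omega> \<and> scaling_sequence d \<longrightarrow>
                 isometric_embedding (dir_cone G N {0<..}) (dir_cone_norm G N {0<..})
                   (ultra_cone G N \<omega> d) (ultra_cone_norm G N \<omega> d) (rho G N \<omega> d)))"
proof -
  interpret group G by fact
  interpret pseudonormed_group G N
    by unfold_locales (use assms(2) in \<open>auto simp: conj_inv_norm_def\<close>)
  show ?thesis
    using independent_imp_injective injective_imp_independent rho_isometric_embedding by blast
qed

end
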